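(* Let $c_0>0$, $M>0$. There is a constant $C>0$ depending only on $c_0,M$ such that the following holds. Let $n,p\ge 1$ be integers, $\sigma>0$, let $\mathbf X\in\mathbb R^{n\times p}$ be a design matrix and $k_0$ a positive integer such that (i) $\|\mathbf X\|_{\mathrm{op}}/\sigma\ge c_0$; (ii) $A_1\ge c_0(n\wedge p)\|\mathbf X\|_{\mathrm{op}}^2$ and $A_2\ge c_0(n\wedge p)\|\mathbf X\|_{\mathrm{op}}^4$; (iii) $A_k\ge c_0^k\,\|\mathbf X\|_{\mathrm{op}}^{2k}\, p\,\big(\tfrac np\wedge 1\big)^k$ for all $3\le k\le k_0$. Let the prior $g$ be subgaussian with constant $M$, and let $\mathbf y=\mathbf X\boldsymbol\beta+\boldsymbol\varepsilon$ with $\beta_1,\dots,\beta_p$ i.i.d. from $g$ and $\boldsymbol\varepsilon\sim N(0,\sigma^2\mathbf I_n)$ independent of $\boldsymbol\beta$. Set $$\Delta_k=(Ck)^{5k^2}\,\frac{1}{n\wedge p}\Big(\frac pn\vee 1\Big)^{2k^2}.$$ Then for any $2\le k\le k_0$ there exists a $(\mathbf X,\mathbf y)$-measurable event $\mathcal C_k$ with probability at least $1-\Delta_k$ such that $$\mathbb E\big[(\hat\mu_k-\mu_k)^2\,\mathbf 1_{\mathcal C_k}\big]\le\Delta_k .$$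
   Context: Notation: $a\wedge b=\min$, $a\vee b=\max$; $\|\cdot\|$ is the Euclidean norm, $\|\cdot\|_{\mathrm{op}}$ the operator norm; $\mathbf 1$ is the all-ones vector in $\mathbb R^p$. The design $\mathbf X$ is treated as fixed (or conditioned upon), with columns $\mathbf x_1,\dots,\mathbf x_p\in\mathbb R^n$. Prior: $g$ is a probability distribution on $\mathbb R$, with mean $m_1=\mathbb E_{\beta\sim g}[\beta]$ and central moments $\mu_\ell=\mathbb E_{\beta\sim g}[(\beta-m_1)^\ell]$. It is subgaussian with constant $M$ if $(\mathbb E_{\beta\sim g}|\beta-m_1|^q)^{1/q}\le M\sqrt q$ for all positive integers $q$. Let $\mathbf H=\mathbf X^\top\mathbf X=(H_{ij})$ and $A_k=\sum_{i,j=1}^p H_{ij}^k$ (so $A_1=\|\mathbf X\mathbf 1\|^2$ and $A_2=\|\mathbf X^\top\mathbf X\|_F^2$). For positive integers $d_1,\dots,d_t$ with $d_1+\dots+d_t=k$ let $$\gamma^{(d_1,\dots,d_t)}=\binom{k}{d_1,\dots,d_t}\sum_{1\le s_1<\dots<s_t\le p}\ \sum_{j=1}^p H_{j,s_1}^{d_1}\cdots H_{j,s_t}^{d_t}.$$ Let $\mathrm{He}_k(x)=(-1)^ke^{x^2/2}\frac{d^k}{dx^k}e^{-x^2/2}$ be the monic Hermite polynomial, and for $\mathbf z\in\mathbb R^n$ let $$F_k(\mathbf z)=\sum_{j=1}^p(\sigma\|\mathbf x_j\|)^k\,\mathrm{He}_k\Big(\frac{\mathbf x_j^\top\mathbf z}{\sigma\|\mathbf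 x_j\|}\Big),$$ where a summand with $\mathbf x_j=0$ is interpreted as $0$. EBMoM estimators: $\hat m_1=\frac{\mathbf 1^\top\mathbf X^\top\mathbf y}{\|\mathbf X\mathbf 1\|^2}$, $\hat{\mathbf y}=\mathbf y-\hat m_1\mathbf X\mathbf 1$, and recursively for $k\ge2$, $$\hat\mu_k=\frac1{A_k}\Big[F_k(\hat{\mathbf y})-\sum_{t=2}^k\ \sum_{\substack{d_1+\dots+d_t=k\\ d_j\ge2}}\hat\mu_{d_1}\cdots\hat\mu_{d_t}\,\gamma^{(d_1,\dots,d_t)}\Big],$$ the inner sum being over ordered tuples (for $k=2$ the correction sum is empty). *)

theory Defs
  imports "HOL-Probability.Probability"
begin

text \<open>
  The dimensions \<open>n\<close> and \<open>p\<close> are quantified inside the theorem, so they cannot be types: a vector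
  of dimension \<open>n\<close> is a function on \<open>nat\<close> read on \<open>{..<n}\<close>, and an \<open>n \<times> p\<close> matrix is a function
  \<open>X\<close> whose entries \<open>X l j\<close> are read for \<open>l < n\<close> and \<open>j < p\<close> only. Indices start at \<open>0\<close>.
\<close>

type_synonym rvec = "nat \<Rightarrow> real"
type_synonym rmat = "nat \<Rightarrow> nat \<Rightarrow> real"

definition mat_vec :: "nat \<Rightarrow> rmat \<Rightarrow> rvec \<Rightarrow> rvec" where
  "mat_vec p X v = (\<lambda>l. \<Sum>j<p. X l j * v j)"

definition op_norm :: "nat \<Rightarrow> nat \<Rightarrow> rmat \<Rightarrow> real" where
  "op_norm n p X = (SUP v\<in>{v. L2_set v {..<p} \<le> 1}. L2_set (mat_vec p X v) {..<n})"

definition gram :: "nat \<Rightarrow> rmat \<Rightarrow> rmat" where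
  "gram n X = (\<lambda>i j. \<Sum>l<n. X l i * X l j)"

definition A_sum :: "nat \<Rightarrow> nat \<Rightarrow> rmat \<Rightarrow> nat \<Rightarrow> real" where
  "A_sum n p X k = (\<Sum>i<p. \<Sum>j<p. gram n X i j ^ k)"

text \<open>The list \<open>ds\<close> is the tuple \<open>(d\<^sub>1, \<dots>, d\<^sub>t)\<close> and \<open>ss\<close> ranges over the tuples \<open>s\<^sub>1 < \<dots> < s\<^sub>t\<close>.\<close>

definition gamma_coeff :: "nat \<Rightarrow> nat \<Rightarrow> rmat \<Rightarrow> nat list \<Rightarrow> real" where
  "gamma_coeff n p X ds =
     fact (sum_list ds) / (\<Prod>i<length ds. fact (ds ! i)) *
     (\<Sum>ss\<in>{ss. length ss = length ds \<and> sorted_wrt (<) ss \<and> set ss \<subseteq> {..<p}}.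
        \<Sum>j<p. \<Prod>i<length ds. gram n X j (ss ! i) ^ (ds ! i))"

definition hermite :: "nat \<Rightarrow> real \<Rightarrow> real" where
  "hermite k x = (-1) ^ k * exp (x\<^sup>2 / 2) * (deriv ^^ k) (\<lambda>t. exp (- t\<^sup>2 / 2)) x"

definition col_norm :: "nat \<Rightarrow> rmat \<Rightarrow> nat \<Rightarrow> real" where
  "col_norm n X j = L2_set (\<lambda>l. X l j) {..<n}"

definition F_stat :: "nat \<Rightarrow> nat \<Rightarrow> rmat \<Rightarrow> real \<Rightarrow> nat \<Rightarrow> rvec \<Rightarrow> real" where
  "F_stat n p X \<sigma> k z =
     (\<Sum>j<p. if col_norm n X j = 0 then 0
            else (\<sigma> * col_norm n X j) ^ k *
                 hermite k ((\<Sum>l<n. X l j * z l) / (\<sigma> * col_norm n X j)))"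

definition m1_hat :: "nat \<Rightarrow> nat \<Rightarrow> rmat \<Rightarrow> rvec \<Rightarrow> real" where
  "m1_hat n p X y =
     (\<Sum>j<p. \<Sum>l<n. X l j * y l) / (L2_set (mat_vec p X (\<lambda>_. 1)) {..<n})\<^sup>2"

definition y_hat :: "nat \<Rightarrow> nat \<Rightarrow> rmat \<Rightarrow> rvec \<Rightarrow> rvec" where
  "y_hat n p X y = (\<lambda>l. y l - m1_hat n p X y * mat_vec p X (\<lambda>_. 1) l)"

text \<open>
  The recursion is the one for \<open>k \<ge> 2\<close>. The values it gives for \<open>k = 0\<close> and \<open>k = 1\<close> have no
  meaning and are never used, as recursive calls are made at arguments \<open>d \<ge> 2\<close> only.
\<close>

function mu_hat :: "nat \<Rightarrow> nat \<Rightarrow> rmat \<Rightarrow> real \<Rightarrow> rvec \<Rightarrow> nat \<Rightarrow> real" where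
  "mu_hat n p X \<sigma> y k =
     (F_stat n p X \<sigma> k (y_hat n p X y) -
       (\<Sum>t=2..k. \<Sum>ds\<in>{ds. length ds = t \<and> sum_list ds = k \<and> (\<forall>d\<in>set ds. 2 \<le> d)}.
          prod_list (map (mu_hat n p X \<sigma> y) ds) * gamma_coeff n p X ds)) / A_sum n p X k"
  by pat_completeness auto
termination
proof (relation "Wellfounded.measure (\<lambda>(n, p, X, \<sigma>, y, k). k)", simp)
  fix n p :: nat and X :: rmat and \<sigma> :: real and y :: rvec and k t d :: nat and ds :: "nat list"
  assume t: "t \<in> {2..k}" and d: "d \<in> set ds"
    and ds: "ds \<in> {ds. length ds = t \<and> sum_list ds = k \<and> (\<forall>d\<in>set ds. 2 \<le> d)}"
  from d obtain us vs where split: "ds = us @ d # vs"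
    by (meson split_list)
  have "us @ vs \<noteq> []"
    using t ds split by auto
  then obtain e where e: "e \<in> set (us @ vs)"
    by (meson last_in_set)
  then have "2 \<le> e" "e \<le> sum_list (us @ vs)"
    using ds split member_le_sum_list[OF e] by auto
  then have "d < k"
    using ds split by auto
  then show "((n, p, X, \<sigma>, y, d), n, p, X, \<sigma>, y, k) \<in> Wellfounded.measure (\<lambda>(n, p, X, \<sigma>, y, k). k)"
    by simp
qed

declare mu_hat.simps [simp del]

definition prior_mean :: "real measure \<Rightarrow> real" where
  "prior_mean g = (\<integral>b. b \<partial>g)"

definition central_moment :: "real measure \<Rightarrow> nat \<Rightarrow> real" where
  "central_moment g k = (\<integral>b. (b - prior_mean g) ^ k \<partial>g)"

text \<open>
  Integrability is required explicitly because the Bochner integral of a non-integrable function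
  is \<open>0\<close>.
\<close>

definition subgaussian :: "real \<Rightarrow> real measure \<Rightarrow> bool" where
  "subgaussian M g \<longleftrightarrow> integrable g (\<lambda>b. b) \<and>
     (\<forall>q\<ge>1. integrable g (\<lambda>b. \<bar>b - prior_mean g\<bar> ^ q) \<and>
       root q (\<integral>b. \<bar>b - prior_mean g\<bar> ^ q \<partial>g) \<le> M * sqrt (real q))"

definition gaussian_noise :: "nat \<Rightarrow> real \<Rightarrow> rvec measure" where
  "gaussian_noise n \<sigma> = (\<Pi>\<^sub>M l\<in>{..<n}. density lborel (\<lambda>x. ennreal (normal_density 0 \<sigma> x)))"

text \<open>
  The joint law of \<open>(\<beta>, \<epsilon>)\<close>. It serves as the sample space, with the two coordinate projections
  as \<open>\<beta>\<close> and \<open>\<epsilon>\<close>. A sample space of arbitrary type \<open>'a\<close> would have to be fixed outside the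
  statement, and then the constant \<open>C\<close> could depend on \<open>'a\<close>. Nothing is lost, by the lemma
  \<open>distr_eq_model\<close> below.
\<close>

definition model :: "nat \<Rightarrow> nat \<Rightarrow> real \<Rightarrow> real measure \<Rightarrow> (rvec \<times> rvec) measure" where
  "model n p \<sigma> g = (\<Pi>\<^sub>M j\<in>{..<p}. g) \<Otimes>\<^sub>M gaussian_noise n \<sigma>"

definition response :: "nat \<Rightarrow> nat \<Rightarrow> rmat \<Rightarrow> rvec \<times> rvec \<Rightarrow> rvec" where
  "response n p X = (\<lambda>(\<beta>, \<epsilon>). \<lambda>l\<in>{..<n}. mat_vec p X \<beta> l + \<epsilon> l)"

text \<open>The sigma-algebra generated by the response; the design is fixed and contributes nothing.\<close>

definition response_algebra ::
    "nat \<Rightarrow> nat \<Rightarrow> rmat \<Rightarrow> real \<Rightarrow> real measure \<Rightarrow> (rvec \<times> rvec) measure" where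
  "response_algebra n p X \<sigma> g =
     vimage_algebra (space (model n p \<sigma> g)) (response n p X) (\<Pi>\<^sub>M l\<in>{..<n}. borel)"

definition Delta :: "real \<Rightarrow> nat \<Rightarrow> nat \<Rightarrow> nat \<Rightarrow> real" where
  "Delta C n p k =
     (C * real k) ^ (5 * k\<^sup>2) * (1 / min (real n) (real p)) *
     (max (real p / real n) 1) ^ (2 * k\<^sup>2)"

lemma (in prob_space) distr_eq_model:
  fixes \<beta> \<epsilon> :: "nat \<Rightarrow> 'a \<Rightarrow> real"
  assumes "n \<ge> 1" "p \<ge> 1" and g: "real_distribution g"
    and iid: "indep_vars (\<lambda>_. borel) \<beta> {..<p}" "\<And>j. j < p \<Longrightarrow> distr M borel (\<beta> j) = g"
    and noise: "indep_vars (\<lambda>_. borel) \<epsilon> {..<n}"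
      "\<And>l. l < n \<Longrightarrow> distributed M lborel (\<epsilon> l) (normal_density 0 \<sigma>)"
    and indep: "indep_var (\<Pi>\<^sub>M j\<in>{..<p}. borel) (\<lambda>\<omega>. \<lambda>j\<in>{..<p}. \<beta> j \<omega>)
      (\<Pi>\<^sub>M l\<in>{..<n}. borel) (\<lambda>\<omega>. \<lambda>l\<in>{..<n}. \<epsilon> l \<omega>)"
  shows "distr M ((\<Pi>\<^sub>M j\<in>{..<p}. borel) \<Otimes>\<^sub>M (\<Pi>\<^sub>M l\<in>{..<n}. borel))
      (\<lambda>\<omega>. (\<lambda>j\<in>{..<p}. \<beta> j \<omega>, \<lambda>l\<in>{..<n}. \<epsilon> l \<omega>)) = model n p \<sigma> g"
proof -
  have \<beta>: "distr M (\<Pi>\<^sub>M j\<in>{..<p}. borel) (\<lambda>\<omega>. \<lambda>j\<in>{..<p}. \<beta> j \<omega>) = (\<Pi>\<^sub>M j\<in>{..<p}. g)"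
  proof -
    have "distr M (\<Pi>\<^sub>M j\<in>{..<p}. borel) (\<lambda>\<omega>. \<lambda>j\<in>{..<p}. \<beta> j \<omega>)
        = (\<Pi>\<^sub>M j\<in>{..<p}. distr M borel (\<beta> j))"
      using iid(1) \<open>p \<ge> 1\<close> indep_vars_iff_distr_eq_PiM'[where I="{..<p}" and M'="\<lambda>_. borel" and X=\<beta>]
      by (auto simp: indep_vars_def lessThan_empty_iff)
    also have "\<dots> = (\<Pi>\<^sub>M j\<in>{..<p}. g)"
      by (rule PiM_cong) (auto simp: iid(2))
    finally show ?thesis .
  qed
  have \<epsilon>: "distr M (\<Pi>\<^sub>M l\<in>{..<n}. borel) (\<lambda>\<omega>. \<lambda>l\<in>{..<n}. \<epsilon> l \<omega>) = gaussian_noise n \<sigma>"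
  proof -
    have "distr M (\<Pi>\<^sub>M l\<in>{..<n}. borel) (\<lambda>\<omega>. \<lambda>l\<in>{..<n}. \<epsilon> l \<omega>)
        = (\<Pi>\<^sub>M l\<in>{..<n}. distr M borel (\<epsilon> l))"
      using noise(1) \<open>n \<ge> 1\<close> indep_vars_iff_distr_eq_PiM'[where I="{..<n}" and M'="\<lambda>_. borel" and X=\<epsilon>]
      by (auto simp: indep_vars_def lessThan_empty_iff)
    also have "\<dots> = (\<Pi>\<^sub>M l\<in>{..<n}. density lborel (\<lambda>x. ennreal (normal_density 0 \<sigma> x)))"
    proof (rule PiM_cong)
      fix l assume "l \<in> {..<n}"
      then have "distr M lborel (\<epsilon> l) = density lborel (\<lambda>x. ennreal (normal_density 0 \<sigma> x))"
        using distributed_distr_eq_density[OF noise(2)] by auto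
      moreover have "distr M borel (\<epsilon> l) = distr M lborel (\<epsilon> l)"
        by (rule distr_cong) auto
      ultimately show "distr M borel (\<epsilon> l) = density lborel (\<lambda>x. ennreal (normal_density 0 \<sigma> x))"
        by simp
    qed simp
    finally show ?thesis by (simp add: gaussian_noise_def)
  qed
  show ?thesis
    using indep \<beta> \<epsilon> unfolding indep_var_distribution_eq model_def by simp
qed

end

theory Submission
  imports Defs
begin

text \<open>
  Write \<open>u\<^sub>j = x\<^sub>j\<^sup>T (y - m\<^sub>1 X 1)\<close>. This is a linear form in the \<open>n + p\<close> independent centred variables
  \<open>\<epsilon>\<^sub>l / \<sigma>\<close> and \<open>\<beta>\<^sub>i - m\<^sub>1\<close> whose coefficient matrix has operator norm of the order of the square of
  that of \<open>X\<close>. The Hermite polynomials remove the noise in expectation, so \<open>E F\<^sub>k\<close> at the exact mean is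
  the multinomial expansion that the recursion for the estimators inverts. The variance of \<open>F\<^sub>k\<close> is
  bounded by the Efron-Stein inequality and a first-order Taylor expansion in each variable, and
  replacing \<open>m\<^sub>1\<close> by its estimate, whose error is another linear form of size \<open>(min n p) ^ (-1/2)\<close>, costs
  no more. On the event that all lower estimates are within distance \<open>1\<close> of the truth, the error of the
  \<open>k\<close>-th estimate is at most the normalised fluctuation of \<open>F\<^sub>k\<close> plus a multiple of the lower errors. The
  first failure of that event has small probability by the second-moment bound for a lower order.
\<close>

text \<open>The sizes balance as follows. Put r = min n p, \<rho> = p / r and B the operator norm.
  The hypotheses amount to A_k >= p (c / \<rho>)^k B^(2 k), and F_k has mean squared error of order
  (p^2 / r) \<rho>^k B^(4 k) up to powers of k, so the quotient is \<rho>^(3 k) / r. Solving for the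
  k-th moment multiplies squared lower errors by (C k)^(6 k) \<rho>^(2 k). Accumulating such factors
  makes the exponents quadratic: 5 k^2 - 5 (k - 1)^2 = 10 k - 5 leaves room for 6 k, and 2 k^2 - 2
  (k - 1)^2 = 4 k - 2 for 2 k. Two obstacles shape the proof. The variance of F_k must be linear in
  p although its p summands are dependent, so the operator norm has to act before absolute values
  are taken inside the sum over the columns. And the recursion is a polynomial in lower estimates
  for which only truncated second moments are available; truncating the lower estimates, never the
  current one, makes it linear in the errors.\<close>

section \<open>Rescaled Hermite polynomials\<close>

text \<open>
  \<open>hpoly v u k\<close> is \<open>s ^ k * He\<^sub>k (u / s)\<close> for \<open>v = s\<^sup>2\<close>. The recursion makes sense for every real
  \<open>v\<close>: at \<open>v = 0\<close> it gives \<open>u ^ k\<close>, which settles the columns \<open>x\<^sub>j = 0\<close>, and \<open>hpoly (-1) 0 k\<close> is the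
  \<open>k\<close>-th moment of the standard normal law.
\<close>

fun hpoly :: "real \<Rightarrow> real \<Rightarrow> nat \<Rightarrow> real" where
  "hpoly v u 0 = 1"
| "hpoly v u (Suc k) = u * hpoly v u k - v * real k * hpoly v u (k - 1)"

text \<open>The product of exponential generating functions, on coefficients. The next lemmas are
  the product rule for derivatives and multiplication by the variable.\<close>

definition binomial_conv :: "(nat \<Rightarrow> real) \<Rightarrow> (nat \<Rightarrow> real) \<Rightarrow> nat \<Rightarrow> real" where
  "binomial_conv f g k = (\<Sum>i\<le>k. real (k choose i) * f i * g (k - i))"

lemma binomial_conv_Suc:
  "binomial_conv f g (Suc k) = binomial_conv (\<lambda>i. f (Suc i)) g k + binomial_conv f (\<lambda>i. g (Suc i)) k"
proof -
  have "binomial_conv f g (Suc k)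
      = f 0 * g (Suc k) + (\<Sum>i\<le>k. real (Suc k choose Suc i) * f (Suc i) * g (k - i))"
    unfolding binomial_conv_def by (subst sum.atMost_Suc_shift) simp
  also have "\<dots> = (f 0 * g (Suc k) + (\<Sum>i\<le>k. real (k choose Suc i) * f (Suc i) * g (k - i)))
      + binomial_conv (\<lambda>i. f (Suc i)) g k"
    unfolding binomial_conv_def by (simp add: sum.distrib[symmetric] algebra_simps)
  also have "f 0 * g (Suc k) + (\<Sum>i\<le>k. real (k choose Suc i) * f (Suc i) * g (k - i))
      = (\<Sum>i\<le>Suc k. real (k choose i) * f i * g (Suc k - i))"
    by (subst sum.atMost_Suc_shift) simp
  also have "\<dots> = binomial_conv f (\<lambda>i. g (Suc i)) k"
    unfolding binomial_conv_def by (simp add: Suc_diff_le)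
  finally show ?thesis by simp
qed

lemma binomial_conv_commute: "binomial_conv f g k = binomial_conv g f k"
  unfolding binomial_conv_def
  by (rule sum.reindex_bij_witness[of _ "\<lambda>i. k - i" "\<lambda>i. k - i"])
     (auto simp: binomial_symmetric[symmetric])

lemma binomial_conv_shift_left:
  "binomial_conv (\<lambda>i. real i * f (i - 1)) g k = real k * binomial_conv f g (k - 1)"
proof (cases k)
  case (Suc j)
  have "real (Suc j choose Suc i) * (1 + real i) = (1 + real j) * real (j choose i)" for i
    by (metis Suc_times_binomial mult.commute of_nat_Suc of_nat_mult)
  then show ?thesis
    unfolding Suc binomial_conv_def
    by (subst sum.atMost_Suc_shift) (simp add: sum_distrib_left mult.assoc[symmetric] cong: sum.cong)
qed (simp add: binomial_conv_def)

lemma binomial_conv_linear: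
  "binomial_conv (\<lambda>i. a * f i - b * f' i) g k = a * binomial_conv f g k - b * binomial_conv f' g k"
  unfolding binomial_conv_def by (simp add: sum_distrib_left sum_subtractf[symmetric] algebra_simps)

lemma binomial_conv_hpoly_step:
  "binomial_conv (\<lambda>i. hpoly v u (Suc i)) g k
    = u * binomial_conv (hpoly v u) g k - v * (real k * binomial_conv (hpoly v u) g (k - 1))"
  using binomial_conv_linear[of u "hpoly v u" v "\<lambda>i. real i * hpoly v u (i - 1)" g k]
  by (simp add: binomial_conv_shift_left mult.assoc del: One_nat_def)

text \<open>The exponential generating function of \<open>hpoly v u\<close> is exp (u z - v z^2 /
  2), which is multiplicative in the pair of parameters. On coefficients: by the product rule the
  convolution obeys the three-term recursion of the left side.\<close>

lemma hpoly_add: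
  "hpoly (v + v') (u + u') k = binomial_conv (hpoly v u) (hpoly v' u') k"
proof (induction k rule: less_induct)
  case (less k)
  show ?case
  proof (cases k)
    case 0
    then show ?thesis by (simp add: binomial_conv_def)
  next
    case (Suc j)
    have "binomial_conv (hpoly v u) (\<lambda>i. hpoly v' u' (Suc i)) j
        = u' * binomial_conv (hpoly v u) (hpoly v' u') j
          - v' * (real j * binomial_conv (hpoly v u) (hpoly v' u') (j - 1))"
      using binomial_conv_hpoly_step[of v' u' "hpoly v u" j]
      by (simp only: binomial_conv_commute[of "hpoly v u"])
    then have "binomial_conv (hpoly v u) (hpoly v' u') k
        = (u + u') * binomial_conv (hpoly v u) (hpoly v' u') j
          - (v + v') * (real j * binomial_conv (hpoly v u) (hpoly v' u') (j - 1))"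
      unfolding Suc binomial_conv_Suc binomial_conv_hpoly_step by (simp only:) (simp add: algebra_simps)
    moreover have "hpoly (v + v') (u + u') j = binomial_conv (hpoly v u) (hpoly v' u') j"
      and "real j * hpoly (v + v') (u + u') (j - 1)
        = real j * binomial_conv (hpoly v u) (hpoly v' u') (j - 1)"
      using less[of j] less[of "j - 1"] Suc by auto
    ultimately show ?thesis
      using Suc by (simp del: of_nat_Suc add: mult.assoc)
  qed
qed

lemma hpoly_0_variance [simp]: "hpoly 0 u k = u ^ k"
  by (induction k) auto

lemma hpoly_scale: "hpoly (s\<^sup>2 * v) (s * u) k = s ^ k * hpoly v u k"
proof (induction k rule: less_induct)
  case (less k)
  show ?case
  proof (cases k)
    case (Suc j)
    have a: "hpoly (s\<^sup>2 * v) (s * u) j = s ^ j * hpoly v u j" using less Suc by auto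
    have b: "real j * hpoly (s\<^sup>2 * v) (s * u) (j - 1) = real j * (s ^ (j - 1) * hpoly v u (j - 1))"
      using less[of "j - 1"] Suc by auto
    have "hpoly (s\<^sup>2 * v) (s * u) k = s * u * hpoly (s\<^sup>2 * v) (s * u) j
        - v * (s\<^sup>2 * (real j * hpoly (s\<^sup>2 * v) (s * u) (j - 1)))"
      unfolding Suc hpoly.simps by (simp only: mult_ac)
    then have "hpoly (s\<^sup>2 * v) (s * u) k
        = s * u * (s ^ j * hpoly v u j) - v * (s\<^sup>2 * (real j * (s ^ (j - 1) * hpoly v u (j - 1))))"
      by (simp only: a b)
    also have "s\<^sup>2 * (real j * (s ^ (j - 1) * hpoly v u (j - 1))) = s ^ k * (real j * hpoly v u (j - 1))"
      unfolding Suc by (cases j) (auto simp: power2_eq_square)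
    finally show ?thesis using Suc by (simp add: algebra_simps)
  qed simp
qed

lemma has_derivative_hpoly:
  "((\<lambda>u. hpoly v u k) has_real_derivative real k * hpoly v u (k - 1)) (at u)"
proof (induction k rule: less_induct)
  case (less k)
  show ?case
  proof (cases k)
    case (Suc j)
    have j: "((\<lambda>u. hpoly v u j) has_real_derivative real j * hpoly v u (j - 1)) (at u)"
      using less Suc by auto
    have "((\<lambda>u. v * real j * hpoly v u (j - 1)) has_real_derivative
        v * real j * (real (j - 1) * hpoly v u (j - 1 - 1))) (at u)"
      using less[of "j - 1"] Suc by (intro DERIV_cmult) auto
    with j have "((\<lambda>u. hpoly v u k) has_real_derivative
        (1 * hpoly v u j + real j * hpoly v u (j - 1) * u)
          - v * real j * (real (j - 1) * hpoly v u (j - 1 - 1))) (at u)"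
      unfolding Suc hpoly.simps by (intro DERIV_diff DERIV_mult DERIV_ident)
    moreover have "hpoly v u j + real j * hpoly v u (j - 1) * u
        - v * real j * (real (j - 1) * hpoly v u (j - 1 - 1)) = real k * hpoly v u (k - 1)"
      unfolding Suc by (cases j) (auto simp: algebra_simps)
    ultimately show ?thesis by simp
  qed simp
qed

lemma hermite_eq_hpoly: "hermite k x = hpoly 1 x k"
proof -
  have "(deriv ^^ k) (\<lambda>t. exp (- t\<^sup>2 / 2)) = (\<lambda>t::real. (-1) ^ k * hpoly 1 t k * exp (- t\<^sup>2 / 2))"
  proof (induction k)
    case (Suc k)
    have "((\<lambda>t. (-1) ^ k * hpoly 1 t k * exp (- t\<^sup>2 / 2)) has_real_derivative
        (-1) ^ Suc k * hpoly 1 t (Suc k) * exp (- t\<^sup>2 / 2)) (at t)" for t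
    proof -
      have e: "((\<lambda>t. exp (- t\<^sup>2 / 2)) has_real_derivative - t * exp (- t\<^sup>2 / 2)) (at t)"
        by (auto intro!: derivative_eq_intros)
      have "((\<lambda>t. (-1) ^ k * hpoly 1 t k) has_real_derivative
          (-1) ^ k * (real k * hpoly 1 t (k - 1))) (at t)"
        by (intro DERIV_cmult has_derivative_hpoly)
      from DERIV_mult[OF this e] show ?thesis
        by (simp add: algebra_simps)
    qed
    then show ?case
      by (simp only: funpow.simps o_apply Suc.IH) (auto intro!: ext DERIV_imp_deriv)
  qed auto
  then show ?thesis
    unfolding hermite_def
    using exp_add[of "x\<^sup>2 / 2" "- (x\<^sup>2 / 2)"] power_mult_distrib[of "-1::real" "-1" k]
    by (simp add: mult_ac)
qed

text \<open>Each step of the recursion gains a factor \<open>\<bar>u\<bar> + c\<close> as soon as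
  the square of \<open>c\<close> dominates all coefficients \<open>v * real j\<close> that occur.
  The fixed \<open>k\<close> bounds them, so that one \<open>c\<close> serves for every lower
  degree, in particular for the derivatives.\<close>

lemma abs_hpoly_le:
  assumes "0 \<le> v" "0 \<le> c" "real k * v \<le> c\<^sup>2" "i \<le> k"
  shows "\<bar>hpoly v u i\<bar> \<le> (\<bar>u\<bar> + c) ^ i"
  using assms(4)
proof (induction i rule: less_induct)
  case (less i)
  show ?case
  proof (cases i)
    case (Suc j)
    have j: "\<bar>hpoly v u j\<bar> \<le> (\<bar>u\<bar> + c) ^ j"
      using less Suc by auto
    have "\<bar>v * real j * hpoly v u (j - 1)\<bar> \<le> c * (\<bar>u\<bar> + c) ^ j"
    proof (cases j)
      case (Suc l)
      have "v * real j \<le> c\<^sup>2"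
        using assms(1,3) less.prems \<open>i = Suc j\<close> mult_left_mono[of "real j" "real k" v]
        by (simp add: mult.commute)
      moreover have "\<bar>hpoly v u l\<bar> \<le> (\<bar>u\<bar> + c) ^ l"
        using less \<open>i = Suc j\<close> Suc by auto
      ultimately have "\<bar>v * real j * hpoly v u l\<bar> \<le> c\<^sup>2 * (\<bar>u\<bar> + c) ^ l"
        unfolding abs_mult using assms(1) by (intro mult_mono) auto
      also have "\<dots> \<le> c * (\<bar>u\<bar> + c) ^ j"
        using assms(2) Suc by (simp add: power2_eq_square mult_left_mono mult_right_mono mult.assoc)
      finally show ?thesis using Suc by simp
    qed (use assms in auto)
    moreover have "\<bar>u * hpoly v u j\<bar> \<le> \<bar>u\<bar> * (\<bar>u\<bar> + c) ^ j"
      using j by (simp add: abs_mult mult_left_mono)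
    ultimately show ?thesis
      unfolding Suc hpoly.simps
      using abs_triangle_ineq4[of "u * hpoly v u j" "v * real j * hpoly v u (j - 1)"]
      by (simp add: distrib_left distrib_right mult.assoc del: One_nat_def)
  qed simp
qed

lemma abs_hpoly_diff_le:
  assumes "0 \<le> v" "0 \<le> c" "real k * v \<le> c\<^sup>2" "i \<le> k"
  shows "\<bar>hpoly v (u + h) i - hpoly v u i\<bar> \<le> \<bar>h\<bar> * (real i * (\<bar>u\<bar> + \<bar>h\<bar> + c) ^ (i - 1))"
proof -
  have "norm (hpoly v (u + h) i - hpoly v u i)
      \<le> (real i * (\<bar>u\<bar> + \<bar>h\<bar> + c) ^ (i - 1)) * norm (u + h - u)"
  proof (rule field_differentiable_bound[where S="closed_segment u (u + h)"
        and f'="\<lambda>z. real i * hpoly v z (i - 1)"])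
    fix z assume "z \<in> closed_segment u (u + h)"
    then have "\<bar>z\<bar> \<le> \<bar>u\<bar> + \<bar>h\<bar>"
      by (auto simp: closed_segment_eq_real_ivl split: if_splits)
    then have "(\<bar>z\<bar> + c) ^ (i - 1) \<le> (\<bar>u\<bar> + \<bar>h\<bar> + c) ^ (i - 1)"
      using assms(2) by (intro power_mono) auto
    then have "\<bar>hpoly v z (i - 1)\<bar> \<le> (\<bar>u\<bar> + \<bar>h\<bar> + c) ^ (i - 1)"
      using abs_hpoly_le[OF assms(1-3), of "i - 1" z] assms(4) by linarith
    then show "norm (real i * hpoly v z (i - 1)) \<le> real i * (\<bar>u\<bar> + \<bar>h\<bar> + c) ^ (i - 1)"
      by (simp add: abs_mult mult_left_mono del: One_nat_def)
  qed (use has_field_derivative_at_within[OF has_derivative_hpoly] in auto)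
  then show ?thesis by (simp add: mult.commute)
qed

text \<open>The mean value theorem for the function minus its linear part at \<open>u\<close>: the
  derivative is a difference of \<open>hpoly\<close> in degree \<open>i - 1\<close>, which
  \<open>abs_hpoly_diff_le\<close> bounds. For \<open>i < 2\<close> the truncated exponent is
  harmless, as the left side is then \<open>0\<close>.\<close>

lemma abs_hpoly_taylor_le:
  assumes "0 \<le> v" "0 \<le> c" "real k * v \<le> c\<^sup>2" "i \<le> k"
  shows "\<bar>hpoly v (u + h) i - hpoly v u i - h * (real i * hpoly v u (i - 1))\<bar>
    \<le> h\<^sup>2 * ((real i)\<^sup>2 * (\<bar>u\<bar> + \<bar>h\<bar> + c) ^ (i - 2))"
proof -
  let ?g = "\<lambda>z. hpoly v z i - z * (real i * hpoly v u (i - 1))"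
  let ?B = "\<bar>h\<bar> * ((real i)\<^sup>2 * (\<bar>u\<bar> + \<bar>h\<bar> + c) ^ (i - 2))"
  have "norm (?g (u + h) - ?g u) \<le> ?B * norm (u + h - u)"
  proof (rule field_differentiable_bound[where S="closed_segment u (u + h)"
        and f'="\<lambda>z. real i * hpoly v z (i - 1) - real i * hpoly v u (i - 1)"])
    fix z assume "z \<in> closed_segment u (u + h)"
    then have z: "\<bar>z - u\<bar> \<le> \<bar>h\<bar>"
      by (auto simp: closed_segment_eq_real_ivl split: if_splits)
    have "\<bar>hpoly v (u + (z - u)) (i - 1) - hpoly v u (i - 1)\<bar>
        \<le> \<bar>z - u\<bar> * (real (i - 1) * (\<bar>u\<bar> + \<bar>z - u\<bar> + c) ^ (i - 1 - 1))"
      using assms(4) by (intro abs_hpoly_diff_le[OF assms(1-3)]) auto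
    also have "\<dots> \<le> \<bar>h\<bar> * (real i * (\<bar>u\<bar> + \<bar>h\<bar> + c) ^ (i - 1 - 1))"
      using z assms(2) by (intro mult_mono power_mono) auto
    finally have "\<bar>hpoly v z (i - 1) - hpoly v u (i - 1)\<bar>
        \<le> \<bar>h\<bar> * (real i * (\<bar>u\<bar> + \<bar>h\<bar> + c) ^ (i - 2))"
      by (simp add: numeral_2_eq_2)
    then have "real i * \<bar>hpoly v z (i - 1) - hpoly v u (i - 1)\<bar>
        \<le> real i * (\<bar>h\<bar> * (real i * (\<bar>u\<bar> + \<bar>h\<bar> + c) ^ (i - 2)))"
      by (intro mult_left_mono) auto
    then show "norm (real i * hpoly v z (i - 1) - real i * hpoly v u (i - 1)) \<le> ?B"
      by (simp add: right_diff_distrib[symmetric] abs_mult power2_eq_square mult_ac del: right_diff_distrib)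
  next
    show "(?g has_field_derivative real i * hpoly v z (i - 1) - real i * hpoly v u (i - 1))
        (at z within closed_segment u (u + h))" for z
      by (rule derivative_eq_intros has_field_derivative_at_within[OF has_derivative_hpoly] refl)+ simp
  qed auto
  also have "?B * norm (u + h - u) = (\<bar>h\<bar> * \<bar>h\<bar>) * ((real i)\<^sup>2 * (\<bar>u\<bar> + \<bar>h\<bar> + c) ^ (i - 2))"
    by simp
  also have "\<bar>h\<bar> * \<bar>h\<bar> = h\<^sup>2" by (simp add: power2_eq_square)
  also have "?g (u + h) - ?g u = hpoly v (u + h) i - hpoly v u i - h * (real i * hpoly v u (i - 1))"
    by (simp add: algebra_simps)
  finally show ?thesis by simp
qed

section \<open>The Efron-Stein inequality\<close>

lemma (in prob_space) integral_square_le: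
  fixes f :: "'a \<Rightarrow> real"
  assumes "f \<in> borel_measurable M" "integrable M (\<lambda>x. (f x)\<^sup>2)"
  shows "(\<integral>x. f x \<partial>M)\<^sup>2 \<le> (\<integral>x. (f x)\<^sup>2 \<partial>M)"
proof -
  have "integrable M f"
    using assms by (rule square_integrable_imp_integrable)
  then show ?thesis
    using variance_eq[of f] variance_positive[of f] assms by simp
qed

lemma integrable_square_diff:
  fixes f g :: "'a \<Rightarrow> real"
  assumes [measurable]: "f \<in> borel_measurable M" "g \<in> borel_measurable M"
    and "integrable M (\<lambda>x. (f x)\<^sup>2)" "integrable M (\<lambda>x. (g x)\<^sup>2)"
  shows "integrable M (\<lambda>x. (f x - g x)\<^sup>2)"
proof (rule Bochner_Integration.integrable_bound)
  show "integrable M (\<lambda>x. 2 * (f x)\<^sup>2 + 2 * (g x)\<^sup>2)"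
    using assms by auto
  have "(f x - g x)\<^sup>2 \<le> 2 * (f x)\<^sup>2 + 2 * (g x)\<^sup>2" for x
    using zero_le_power2[of "f x + g x"] by (simp add: power2_eq_square algebra_simps)
  then show "AE x in M. norm ((f x - g x)\<^sup>2) \<le> norm (2 * (f x)\<^sup>2 + 2 * (g x)\<^sup>2)"
    by (simp add: add_nonneg_nonneg)
qed measurable

text \<open>Total variance: the variance of \<open>F\<close> is the mean of its conditional variance
  given the first coordinate plus the variance of the conditional mean. The latter is the least mean
  square distance to a constant; with the mean of \<open>H\<close> as that constant, Jensen's
  inequality bounds it by the last term.\<close>

lemma pair_variance_le:
  fixes F :: "'a \<times> 'b \<Rightarrow> real"
  assumes "prob_space A" "prob_space B"
    and F [measurable]: "F \<in> borel_measurable (A \<Otimes>\<^sub>M B)" and F2: "integrable (A \<Otimes>\<^sub>M B) (\<lambda>z. (F z)\<^sup>2)"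
    and H [measurable]: "H \<in> borel_measurable B" and H2: "integrable (A \<Otimes>\<^sub>M B) (\<lambda>z. (H (snd z))\<^sup>2)"
  shows "integrable A (\<lambda>y. (\<integral>x. (F (y, x))\<^sup>2 \<partial>B) - (\<integral>x. F (y, x) \<partial>B)\<^sup>2)" (is ?int)
    and "(\<integral>z. (F z)\<^sup>2 \<partial>(A \<Otimes>\<^sub>M B)) - (\<integral>z. F z \<partial>(A \<Otimes>\<^sub>M B))\<^sup>2
      \<le> (\<integral>y. (\<integral>x. (F (y, x))\<^sup>2 \<partial>B) - (\<integral>x. F (y, x) \<partial>B)\<^sup>2 \<partial>A)
        + (\<integral>z. (F z - H (snd z))\<^sup>2 \<partial>(A \<Otimes>\<^sub>M B))" (is ?le)
proof -
  interpret A: prob_space A by fact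
  interpret B: prob_space B by fact
  interpret AB: pair_prob_space A B ..
  define b where "b y = (\<integral>x. F (y, x) \<partial>B)" for y
  define c where "c = (\<integral>x. H x \<partial>B)"
  have b_meas [measurable]: "b \<in> borel_measurable A"
    unfolding b_def by measurable
  have F1: "integrable (A \<Otimes>\<^sub>M B) F"
    using F F2 by (rule AB.P.square_integrable_imp_integrable)
  have "AE y in A. integrable B (\<lambda>x. (H x)\<^sup>2)"
    using AB.AE_integrable_fst'[OF H2] by simp
  then have HB2: "integrable B (\<lambda>x. (H x)\<^sup>2)"
    by (simp add: A.AE_const)
  with H have H1: "integrable B H"
    by (rule B.square_integrable_imp_integrable)
  have ae2: "AE y in A. integrable B (\<lambda>x. (F (y, x))\<^sup>2)"
    using AB.AE_integrable_fst'[OF F2] by simp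
  have i2: "integrable A (\<lambda>y. \<integral>x. (F (y, x))\<^sup>2 \<partial>B)"
    using AB.integrable_fst'[OF F2] by simp
  have ae_b: "AE y in A. (b y)\<^sup>2 \<le> (\<integral>x. (F (y, x))\<^sup>2 \<partial>B)"
    using ae2 AE_space
  proof eventually_elim
    case (elim y)
    have "(\<lambda>x. F (y, x)) \<in> borel_measurable B"
      using elim(2) by measurable
    then show ?case unfolding b_def using elim(1) by (rule B.integral_square_le)
  qed
  have b2: "integrable A (\<lambda>y. (b y)\<^sup>2)"
    by (rule Bochner_Integration.integrable_bound[OF i2]) (use ae_b in auto)
  with i2 show ?int
    unfolding b_def[symmetric] by (rule Bochner_Integration.integrable_diff)
  have b1: "integrable A b"
    using b_meas b2 by (rule A.square_integrable_imp_integrable)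
  have int_b: "(\<integral>z. F z \<partial>(A \<Otimes>\<^sub>M B)) = (\<integral>y. b y \<partial>A)"
    unfolding b_def using AB.integral_fst'[OF F1] by simp
  have int_2: "(\<integral>z. (F z)\<^sup>2 \<partial>(A \<Otimes>\<^sub>M B)) = (\<integral>y. \<integral>x. (F (y, x))\<^sup>2 \<partial>B \<partial>A)"
    using AB.integral_fst'[OF F2] by simp
  have D2: "integrable (A \<Otimes>\<^sub>M B) (\<lambda>z. (F z - H (snd z))\<^sup>2)"
    by (rule integrable_square_diff[OF _ _ F2 H2]) measurable
  have "AE y in A. (b y - c)\<^sup>2 \<le> (\<integral>x. (F (y, x) - H x)\<^sup>2 \<partial>B)"
    using ae2 AE_space
  proof eventually_elim
    case (elim y)
    have Fy: "(\<lambda>x. F (y, x)) \<in> borel_measurable B"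
      using elim(2) by measurable
    have "integrable B (\<lambda>x. F (y, x))"
      using Fy elim(1) by (rule B.square_integrable_imp_integrable)
    then have "b y - c = (\<integral>x. F (y, x) - H x \<partial>B)"
      unfolding b_def c_def using H1 by simp
    moreover have "(\<integral>x. F (y, x) - H x \<partial>B)\<^sup>2 \<le> (\<integral>x. (F (y, x) - H x)\<^sup>2 \<partial>B)"
      using Fy elim(1) HB2 by (intro B.integral_square_le integrable_square_diff) auto
    ultimately show ?case by simp
  qed
  moreover have iD: "integrable A (\<lambda>y. \<integral>x. (F (y, x) - H x)\<^sup>2 \<partial>B)"
    using AB.integrable_fst'[OF D2] by simp
  moreover have ic: "integrable A (\<lambda>y. (b y - c)\<^sup>2)"
    using b2 by (intro integrable_square_diff) auto
  ultimately have "(\<integral>y. (b y - c)\<^sup>2 \<partial>A) \<le> (\<integral>y. \<integral>x. (F (y, x) - H x)\<^sup>2 \<partial>B \<partial>A)"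
    by (intro integral_mono_AE)
  also have "\<dots> = (\<integral>z. (F z - H (snd z))\<^sup>2 \<partial>(A \<Otimes>\<^sub>M B))"
    using AB.integral_fst'[OF D2] by simp
  finally have 1: "(\<integral>y. (b y - c)\<^sup>2 \<partial>A) \<le> (\<integral>z. (F z - H (snd z))\<^sup>2 \<partial>(A \<Otimes>\<^sub>M B))" .
  have "(\<integral>y. (b y - c)\<^sup>2 \<partial>A) = (\<integral>y. (b y)\<^sup>2 - 2 * c * b y + c\<^sup>2 \<partial>A)"
    by (simp add: power2_diff algebra_simps)
  also have "\<dots> = (\<integral>y. (b y)\<^sup>2 \<partial>A) - 2 * c * (\<integral>y. b y \<partial>A) + c\<^sup>2"
    using b1 b2 by (simp add: A.prob_space)
  finally have "(\<integral>y. (b y)\<^sup>2 \<partial>A) - (\<integral>y. b y \<partial>A)\<^sup>2 \<le> (\<integral>y. (b y - c)\<^sup>2 \<partial>A)"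
    using zero_le_power2[of "c - (\<integral>y. b y \<partial>A)"] by (simp add: power2_diff)
  with 1 show ?le
    unfolding int_b int_2 b_def[symmetric] using i2 b2 by simp
qed

lemma efron_stein:
  fixes f :: "('i \<Rightarrow> 'a) \<Rightarrow> real" and h :: "'i \<Rightarrow> ('i \<Rightarrow> 'a) \<Rightarrow> real"
  assumes "finite I" and M: "\<And>i. prob_space (M i)"
    and "f \<in> borel_measurable (Pi\<^sub>M I M)" "integrable (Pi\<^sub>M I M) (\<lambda>x. (f x)\<^sup>2)"
    and "\<And>s. s \<in> I \<Longrightarrow> h s \<in> borel_measurable (Pi\<^sub>M I M)"
    and "\<And>s. s \<in> I \<Longrightarrow> integrable (Pi\<^sub>M I M) (\<lambda>x. (h s x)\<^sup>2)"
    and "\<And>s x y. s \<in> I \<Longrightarrow> h s (x(s := y)) = h s x"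
  shows "(\<integral>x. (f x)\<^sup>2 \<partial>Pi\<^sub>M I M) - (\<integral>x. f x \<partial>Pi\<^sub>M I M)\<^sup>2 \<le> (\<Sum>s\<in>I. \<integral>x. (f x - h s x)\<^sup>2 \<partial>Pi\<^sub>M I M)"
  using assms(1,3-)
proof (induction I arbitrary: f h rule: finite_induct)
  case empty
  interpret prob_space "Pi\<^sub>M {} M" by (rule prob_space_PiM[OF M])
  show ?case by (simp add: PiM_empty lebesgue_integral_count_space_finite)
next
  case (insert i I)
  let ?A = "M i" and ?B = "Pi\<^sub>M I M" and ?P = "Pi\<^sub>M (insert i I) M"
  define \<phi> where "\<phi> = (\<lambda>(y :: 'a, x :: 'i \<Rightarrow> 'a). x(i := y))"
  interpret A: prob_space ?A by (rule M)
  interpret B: prob_space ?B by (rule prob_space_PiM[OF M])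
  interpret AB: pair_prob_space ?A ?B ..
  have P: "?P = distr (?A \<Otimes>\<^sub>M ?B) ?P \<phi>"
    unfolding \<phi>_def using distr_pair_PiM_eq_PiM[of I M i] M insert by simp
  have \<phi> [measurable]: "\<phi> \<in> measurable (?A \<Otimes>\<^sub>M ?B) ?P"
    unfolding \<phi>_def by (auto intro!: measurable_fun_upd[where J=I])
  have [measurable]: "f \<in> borel_measurable ?P" and
    h_meas: "\<And>s. s \<in> insert i I \<Longrightarrow> h s \<in> borel_measurable ?P"
    using insert by auto
  have i_eq: "integrable ?P g \<longleftrightarrow> integrable (?A \<Otimes>\<^sub>M ?B) (\<lambda>z. g (\<phi> z))"
    and int_eq: "(\<integral>x. g x \<partial>?P) = (\<integral>z. g (\<phi> z) \<partial>(?A \<Otimes>\<^sub>M ?B))"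
    if "g \<in> borel_measurable ?P" for g :: "_ \<Rightarrow> real"
    using that by (subst P, simp add: integrable_distr_eq integral_distr)+
  \<comment> \<open>\<open>h i\<close> ignores coordinate \<open>i\<close>, so freezing that
    coordinate at any point expresses it through the remaining ones.\<close>
  obtain y0 where y0: "y0 \<in> space ?A" using A.not_empty by auto
  define H where "H x = h i (x(i := y0))" for x
  have H: "h i (\<phi> z) = H (snd z)" for z
    using insert.prems(5)[OF insertI1, of "snd z" "fst z"] insert.prems(5)[OF insertI1, of "snd z" y0]
    unfolding H_def \<phi>_def by (cases z) (simp only: case_prod_conv fst_conv snd_conv)
  have sec [measurable]: "(\<lambda>x. x(i := y)) \<in> measurable ?B ?P" if "y \<in> space ?A" for y
    using that by (auto intro!: measurable_fun_upd[where J=I])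
  have H_meas [measurable]: "H \<in> borel_measurable ?B"
    unfolding H_def using sec[OF y0] h_meas[of i] by (auto intro: measurable_compose)
  have f2: "integrable (?A \<Otimes>\<^sub>M ?B) (\<lambda>z. (f (\<phi> z))\<^sup>2)"
    using insert.prems(2) by (subst (asm) i_eq) auto
  have h2: "integrable (?A \<Otimes>\<^sub>M ?B) (\<lambda>z. (h s (\<phi> z))\<^sup>2)" if "s \<in> insert i I" for s
    using insert.prems(4)[OF that] h_meas[OF that] by (subst (asm) i_eq) auto
  have fh2: "integrable (?A \<Otimes>\<^sub>M ?B) (\<lambda>z. (f (\<phi> z) - h s (\<phi> z))\<^sup>2)" if "s \<in> insert i I" for s
    using h_meas[OF that] by (intro integrable_square_diff[OF _ _ f2 h2[OF that]]) simp_all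
  note pair = pair_variance_le[where F="\<lambda>z. f (\<phi> z)" and H=H, OF A.prob_space_axioms B.prob_space_axioms _ f2 H_meas]
  have "AE y in ?A. \<forall>s\<in>I. integrable ?B (\<lambda>x. (h s (\<phi> (y, x)))\<^sup>2)"
    using AB.AE_integrable_fst'[OF h2] \<open>finite I\<close> by (simp add: AE_finite_all)
  moreover have "AE y in ?A. integrable ?B (\<lambda>x. (f (\<phi> (y, x)))\<^sup>2)"
    using AB.AE_integrable_fst'[OF f2] by simp
  ultimately have "AE y in ?A. (\<integral>x. (f (\<phi> (y, x)))\<^sup>2 \<partial>?B) - (\<integral>x. f (\<phi> (y, x)) \<partial>?B)\<^sup>2
      \<le> (\<Sum>s\<in>I. \<integral>x. (f (\<phi> (y, x)) - h s (\<phi> (y, x)))\<^sup>2 \<partial>?B)"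
    using AE_space
  proof eventually_elim
    case (elim y)
    show ?case
    proof (rule insert.IH)
      show "(\<lambda>x. f (\<phi> (y, x))) \<in> borel_measurable ?B"
        unfolding \<phi>_def using sec[OF elim(3)] by simp
      show "(\<lambda>x. h s (\<phi> (y, x))) \<in> borel_measurable ?B" if "s \<in> I" for s
        unfolding \<phi>_def using sec[OF elim(3)] h_meas[of s] that by (auto intro: measurable_compose)
      show "h s (\<phi> (y, x(s := y'))) = h s (\<phi> (y, x))" if "s \<in> I" for s x y'
      proof -
        have "x(s := y', i := y) = x(i := y, s := y')"
          using that insert.hyps by (intro fun_upd_twist) auto
        then show ?thesis
          unfolding \<phi>_def using insert.prems(5)[OF insertI2[OF that], of "x(i := y)" y']
          by (simp only: case_prod_conv)
      qed
    qed (use elim in auto)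
  qed
  moreover have "integrable ?A (\<lambda>y. \<Sum>s\<in>I. \<integral>x. (f (\<phi> (y, x)) - h s (\<phi> (y, x)))\<^sup>2 \<partial>?B)"
    using AB.integrable_fst'[OF fh2] by (intro Bochner_Integration.integrable_sum) simp
  moreover have "integrable ?A (\<lambda>y. (\<integral>x. (f (\<phi> (y, x)))\<^sup>2 \<partial>?B) - (\<integral>x. f (\<phi> (y, x)) \<partial>?B)\<^sup>2)"
    using h2[of i] by (intro pair(1)) (auto simp: H)
  ultimately have "(\<integral>y. (\<integral>x. (f (\<phi> (y, x)))\<^sup>2 \<partial>?B) - (\<integral>x. f (\<phi> (y, x)) \<partial>?B)\<^sup>2 \<partial>?A)
      \<le> (\<integral>y. (\<Sum>s\<in>I. \<integral>x. (f (\<phi> (y, x)) - h s (\<phi> (y, x)))\<^sup>2 \<partial>?B) \<partial>?A)"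
    by (intro integral_mono_AE)
  also have "\<dots> = (\<Sum>s\<in>I. \<integral>y. \<integral>x. (f (\<phi> (y, x)) - h s (\<phi> (y, x)))\<^sup>2 \<partial>?B \<partial>?A)"
    using AB.integrable_fst'[OF fh2] by (intro Bochner_Integration.integral_sum) simp
  also have "\<dots> = (\<Sum>s\<in>I. \<integral>z. (f (\<phi> z) - h s (\<phi> z))\<^sup>2 \<partial>(?A \<Otimes>\<^sub>M ?B))"
    using AB.integral_fst'[OF fh2] by (intro sum.cong) auto
  finally have 1: "(\<integral>y. (\<integral>x. (f (\<phi> (y, x)))\<^sup>2 \<partial>?B) - (\<integral>x. f (\<phi> (y, x)) \<partial>?B)\<^sup>2 \<partial>?A)
      \<le> (\<Sum>s\<in>I. \<integral>z. (f (\<phi> z) - h s (\<phi> z))\<^sup>2 \<partial>(?A \<Otimes>\<^sub>M ?B))" .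
  have "(\<integral>z. (f (\<phi> z))\<^sup>2 \<partial>(?A \<Otimes>\<^sub>M ?B)) - (\<integral>z. f (\<phi> z) \<partial>(?A \<Otimes>\<^sub>M ?B))\<^sup>2
      \<le> (\<integral>y. (\<integral>x. (f (\<phi> (y, x)))\<^sup>2 \<partial>?B) - (\<integral>x. f (\<phi> (y, x)) \<partial>?B)\<^sup>2 \<partial>?A)
        + (\<integral>z. (f (\<phi> z) - H (snd z))\<^sup>2 \<partial>(?A \<Otimes>\<^sub>M ?B))"
    using h2[of i] by (intro pair(2)) (auto simp: H)
  also have "\<dots> \<le> (\<Sum>s\<in>insert i I. \<integral>z. (f (\<phi> z) - h s (\<phi> z))\<^sup>2 \<partial>(?A \<Otimes>\<^sub>M ?B))"
    using 1 insert.hyps by (simp add: H)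
  finally show ?case
    using h_meas by (simp add: int_eq)
qed

section \<open>Moments of linear forms\<close>

text \<open>This class is closed under sums and products, hence under polynomials, so that the
  integrability conditions of all later steps follow from the shape of the terms.\<close>

definition all_moments :: "'a measure \<Rightarrow> ('a \<Rightarrow> real) \<Rightarrow> bool" where
  "all_moments M f \<longleftrightarrow> f \<in> borel_measurable M \<and> (\<forall>d::nat. integrable M (\<lambda>x. \<bar>f x\<bar> ^ d))"

lemma all_moments_measurable: "all_moments M f \<Longrightarrow> f \<in> borel_measurable M"
  by (simp add: all_moments_def)

lemma all_moments_integrable: "all_moments M f \<Longrightarrow> integrable M f"
  unfolding all_moments_def using integrable_abs_cancel[of M f]
  by (metis (no_types, lifting) Bochner_Integration.integrable_cong power_one_right)

lemma power_sum_le_max: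
  fixes x y :: real
  assumes "0 \<le> x" "0 \<le> y"
  shows "(x + y) ^ d \<le> 2 ^ d * (x ^ d + y ^ d)"
proof -
  have "(x + y) ^ d \<le> (2 * max x y) ^ d"
    using assms by (intro power_mono) auto
  also have "(max x y) ^ d \<le> x ^ d + y ^ d"
    using assms by (auto simp: max_def)
  then have "(2 * max x y) ^ d \<le> 2 ^ d * (x ^ d + y ^ d)"
    by (simp add: power_mult_distrib)
  finally show ?thesis .
qed

context prob_space
begin

lemma all_moments_const [intro, simp]: "all_moments M (\<lambda>_. c)"
  by (simp add: all_moments_def)

lemma all_moments_add [intro]:
  assumes "all_moments M f" "all_moments M g"
  shows "all_moments M (\<lambda>x. f x + g x)"
  unfolding all_moments_def
proof (intro conjI allI)
  have [measurable]: "f \<in> borel_measurable M" "g \<in> borel_measurable M"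
    using assms by (auto simp: all_moments_def)
  show "(\<lambda>x. f x + g x) \<in> borel_measurable M" by simp
  fix d :: nat
  show "integrable M (\<lambda>x. \<bar>f x + g x\<bar> ^ d)"
  proof (rule Bochner_Integration.integrable_bound)
    show "integrable M (\<lambda>x. 2 ^ d * (\<bar>f x\<bar> ^ d + \<bar>g x\<bar> ^ d))"
      using assms by (auto simp: all_moments_def)
    have "\<bar>f x + g x\<bar> ^ d \<le> 2 ^ d * (\<bar>f x\<bar> ^ d + \<bar>g x\<bar> ^ d)" for x
      by (rule order_trans[OF power_mono[OF abs_triangle_ineq] power_sum_le_max]) auto
    then show "AE x in M. norm (\<bar>f x + g x\<bar> ^ d) \<le> norm (2 ^ d * (\<bar>f x\<bar> ^ d + \<bar>g x\<bar> ^ d))"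
      by (simp add: abs_of_nonneg power_abs[symmetric])
  qed simp
qed

lemma all_moments_mult [intro]:
  assumes "all_moments M f" "all_moments M g"
  shows "all_moments M (\<lambda>x. f x * g x)"
  unfolding all_moments_def
proof (intro conjI allI)
  have [measurable]: "f \<in> borel_measurable M" "g \<in> borel_measurable M"
    using assms by (auto simp: all_moments_def)
  show "(\<lambda>x. f x * g x) \<in> borel_measurable M" by simp
  fix d :: nat
  show "integrable M (\<lambda>x. \<bar>f x * g x\<bar> ^ d)"
  proof (rule Bochner_Integration.integrable_bound)
    show "integrable M (\<lambda>x. \<bar>f x\<bar> ^ (2 * d) + \<bar>g x\<bar> ^ (2 * d))"
      using assms by (intro Bochner_Integration.integrable_add) (auto simp: all_moments_def)
    have "\<bar>f x * g x\<bar> ^ d \<le> \<bar>f x\<bar> ^ (2 * d) + \<bar>g x\<bar> ^ (2 * d)" for x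
    proof -
      have "0 \<le> a * b \<Longrightarrow> a * b \<le> a\<^sup>2 + b\<^sup>2" for a b :: real
        using zero_le_power2[of "a - b"] by (simp add: power2_diff)
      from this[of "\<bar>f x\<bar> ^ d" "\<bar>g x\<bar> ^ d"] show ?thesis
        by (simp add: abs_mult power_mult_distrib power_mult[symmetric] mult.commute)
    qed
    then show "AE x in M. norm (\<bar>f x * g x\<bar> ^ d) \<le> norm (\<bar>f x\<bar> ^ (2 * d) + \<bar>g x\<bar> ^ (2 * d))"
      by (simp add: abs_of_nonneg)
  qed simp
qed

lemma all_moments_minus [intro]: "all_moments M f \<Longrightarrow> all_moments M (\<lambda>x. - f x)"
  by (auto simp: all_moments_def)

lemma all_moments_diff [intro]:
  "all_moments M f \<Longrightarrow> all_moments M g \<Longrightarrow> all_moments M (\<lambda>x. f x - g x)"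
  using all_moments_add[of f "\<lambda>x. - g x"] by auto

lemma all_moments_abs [intro]: "all_moments M f \<Longrightarrow> all_moments M (\<lambda>x. \<bar>f x\<bar>)"
  by (auto simp: all_moments_def)

lemma all_moments_power [intro]: "all_moments M f \<Longrightarrow> all_moments M (\<lambda>x. f x ^ k)"
  by (induction k) auto

lemma all_moments_integrable_square: "all_moments M f \<Longrightarrow> integrable M (\<lambda>\<omega>. (f \<omega>)\<^sup>2)"
  by (intro all_moments_integrable all_moments_power)

lemma all_moments_sum [intro]:
  "(\<And>i. i \<in> I \<Longrightarrow> all_moments M (f i)) \<Longrightarrow> all_moments M (\<lambda>x. \<Sum>i\<in>I. f i x)"
  by (induction I rule: infinite_finite_induct) auto

lemma all_moments_hpoly [intro]:
  assumes "all_moments M f"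
  shows "all_moments M (\<lambda>x. hpoly v (f x) k)"
proof (induction k rule: less_induct)
  case (less k)
  show ?case
  proof (cases k)
    case (Suc j)
    have "all_moments M (\<lambda>x. f x * hpoly v (f x) j - v * real j * hpoly v (f x) (j - 1))"
      using less[of j] less[of "j - 1"] Suc assms by (intro all_moments_diff all_moments_mult) auto
    then show ?thesis using Suc by simp
  qed simp
qed

lemma expectation_mult_indep:
  assumes "indep_var borel f borel g" "all_moments M f" "all_moments M g"
  shows "expectation (\<lambda>x. f x * g x) = expectation f * expectation g"
  using assms by (intro indep_var_lebesgue_integral all_moments_integrable)

end

lemma hpoly_measurable [measurable]: "(\<lambda>u. hpoly v u k) \<in> borel_measurable borel"
proof -
  have "continuous_on UNIV (\<lambda>u. hpoly v u k)"
    using DERIV_isCont[OF has_derivative_hpoly] by (auto simp: continuous_on_eq_continuous_at)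
  then show ?thesis by (rule borel_measurable_continuous_onI)
qed

lemma power_split:
  fixes x :: "'a :: monoid_mult"
  assumes "a \<le> n"
  shows "x ^ n = x ^ a * x ^ (n - a)"
  using assms by (simp flip: power_add)

text \<open>Made for the induction in \<open>linear_moment_le\<close>: \<open>N0\<close> belongs to
  the old sum, \<open>y\<close> to the new variable, and the squares add up as in a Euclidean norm.
  There is no term of degree 1, so each of the at most \<open>K\<close> terms contains the square of
  \<open>y\<close>, and the rest of it is at most \<open>R ^ (k - 2)\<close>.\<close>

lemma geometric_mix_le:
  fixes N0 y R :: real
  assumes "0 \<le> N0" "0 \<le> y" "0 \<le> R" "R\<^sup>2 = N0\<^sup>2 + real K * y\<^sup>2" "k \<le> K"
  shows "N0 ^ k + (\<Sum>l\<in>{2..k}. y ^ l * N0 ^ (k - l)) \<le> R ^ k"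
proof -
  have NR: "N0 \<le> R"
    by (rule power2_le_imp_le[OF _ assms(3)]) (simp add: assms(4))
  show ?thesis
  proof (cases "k \<ge> 2")
    case True
    then have "1 \<le> real K" using assms by simp
    then have "y\<^sup>2 \<le> R\<^sup>2"
      using mult_right_mono[of 1 "real K" "y\<^sup>2"] by (simp add: assms(4) add_increasing)
    then have yR: "y \<le> R" by (rule power2_le_imp_le[OF _ assms(3)])
    have "y ^ l * N0 ^ (k - l) \<le> y\<^sup>2 * R ^ (k - 2)" if "l \<in> {2..k}" for l
    proof -
      have "y ^ l * N0 ^ (k - l) = y\<^sup>2 * (y ^ (l - 2) * N0 ^ (k - l))"
        using that power_split[of 2 l y] by simp
      also have "\<dots> \<le> y\<^sup>2 * (R ^ (l - 2) * R ^ (k - l))"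
        using assms NR yR by (intro mult_left_mono mult_mono power_mono) auto
      also have "R ^ (l - 2) * R ^ (k - l) = R ^ (k - 2)"
        using that by (simp add: power_add[symmetric])
      finally show ?thesis .
    qed
    then have "(\<Sum>l\<in>{2..k}. y ^ l * N0 ^ (k - l)) \<le> real (card {2..k}) * (y\<^sup>2 * R ^ (k - 2))"
      by (rule sum_bounded_above)
    also have "\<dots> \<le> real K * (y\<^sup>2 * R ^ (k - 2))"
      using assms by (intro mult_right_mono) auto
    finally have "(\<Sum>l\<in>{2..k}. y ^ l * N0 ^ (k - l)) \<le> (real K * y\<^sup>2) * R ^ (k - 2)"
      by simp
    moreover have "N0 ^ k \<le> N0\<^sup>2 * R ^ (k - 2)"
    proof -
      have "N0 ^ k = N0\<^sup>2 * N0 ^ (k - 2)"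
        using True by (rule power_split)
      also have "\<dots> \<le> N0\<^sup>2 * R ^ (k - 2)"
        using assms NR by (intro mult_left_mono power_mono) auto
      finally show ?thesis .
    qed
    ultimately have "N0 ^ k + (\<Sum>l\<in>{2..k}. y ^ l * N0 ^ (k - l)) \<le> R\<^sup>2 * R ^ (k - 2)"
      by (simp add: assms(4) algebra_simps)
    also have "\<dots> = R ^ k" using True power_split[of 2 k R] by simp
    finally show ?thesis .
  next
    case False
    then have "k = 0 \<or> k = 1" by auto
    then show ?thesis using NR by auto
  qed
qed

text \<open>The factorial in \<open>moment_le\<close> is what an induction over the variables
  preserves, because (k choose l) l! (k - l)! = k!. The bound covers standard normal and subgaussian
  variables alike.\<close>

locale indep_system = prob_space M for M :: "'a measure" +
  fixes \<xi> :: "nat \<Rightarrow> 'a \<Rightarrow> real" and N :: nat and m :: real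
  assumes indep: "indep_vars (\<lambda>_. borel) \<xi> {..<N}"
    and moments: "\<And>s. s < N \<Longrightarrow> all_moments M (\<xi> s)"
    and mean_0: "\<And>s. s < N \<Longrightarrow> expectation (\<xi> s) = 0"
    and moment_le: "\<And>s d. s < N \<Longrightarrow> \<bar>expectation (\<lambda>x. \<xi> s x ^ d)\<bar> \<le> fact d * m ^ d"
    and m_ge_1: "1 \<le> m"
begin

text \<open>A plain power is \<open>hpoly 0\<close>, so \<open>hpoly_add\<close> with first variance
  \<open>0\<close> splits off the new variable while the remaining sum keeps \<open>v\<close>. The
  case \<open>v = 0\<close> gives ordinary moments, the case of the noise variance gives the removal
  of the noise.\<close>

lemma expectation_hpoly_insert:
  assumes "finite A" "i \<notin> A" "insert i A \<subseteq> {..<N}"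
  shows "expectation (\<lambda>x. hpoly v (\<Sum>s\<in>insert i A. a s * \<xi> s x) k)
    = binomial_conv (\<lambda>l. a i ^ l * expectation (\<lambda>x. \<xi> i x ^ l))
        (\<lambda>l. expectation (\<lambda>x. hpoly v (\<Sum>s\<in>A. a s * \<xi> s x) l)) k"
proof -
  let ?S = "\<lambda>x. \<Sum>s\<in>A. a s * \<xi> s x"
  have mom_i: "all_moments M (\<lambda>x. a i * \<xi> i x)" and mom_S: "all_moments M ?S"
    using assms by (intro all_moments_sum all_moments_mult all_moments_const moments, auto)+
  have "indep_vars (\<lambda>_. borel) (\<lambda>s x. a s * \<xi> s x) (insert i A)"
    using indep_vars_compose2[OF indep_vars_subset[OF indep assms(3)], of "\<lambda>s. (*) (a s)" "\<lambda>_. borel"]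
    by simp
  then have ind: "indep_var borel (\<lambda>x. a i * \<xi> i x) borel ?S"
    using assms by (intro indep_vars_sum)
  have E: "expectation (\<lambda>x. (a i * \<xi> i x) ^ l * hpoly v (?S x) l')
      = a i ^ l * expectation (\<lambda>x. \<xi> i x ^ l) * expectation (\<lambda>x. hpoly v (?S x) l')" for l l'
  proof -
    have "indep_var borel ((\<lambda>t. t ^ l) \<circ> (\<lambda>x. a i * \<xi> i x)) borel ((\<lambda>u. hpoly v u l') \<circ> ?S)"
      by (rule indep_var_compose[OF ind]) measurable
    then have "expectation (\<lambda>x. (a i * \<xi> i x) ^ l * hpoly v (?S x) l')
        = expectation (\<lambda>x. (a i * \<xi> i x) ^ l) * expectation (\<lambda>x. hpoly v (?S x) l')"
      using mom_i mom_S by (intro expectation_mult_indep) (auto simp: comp_def)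
    then show ?thesis by (simp add: power_mult_distrib)
  qed
  have "expectation (\<lambda>x. hpoly v (\<Sum>s\<in>insert i A. a s * \<xi> s x) k)
      = expectation (\<lambda>x. \<Sum>l\<le>k. real (k choose l) * ((a i * \<xi> i x) ^ l * hpoly v (?S x) (k - l)))"
    using hpoly_add[of 0 v] assms by (simp add: binomial_conv_def mult.assoc)
  also have "\<dots>
      = (\<Sum>l\<le>k. real (k choose l) * expectation (\<lambda>x. (a i * \<xi> i x) ^ l * hpoly v (?S x) (k - l)))"
    using mom_i mom_S
    by (subst Bochner_Integration.integral_sum)
       (auto intro!: all_moments_integrable all_moments_mult all_moments_power)
  finally show ?thesis
    unfolding E binomial_conv_def by (simp add: mult.assoc)
qed

text \<open>
  The parameter \<open>K\<close> stays fixed in the induction on \<open>A\<close>. Its factor \<open>sqrt K\<close> absorbs the terms of degree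
  at least \<open>2\<close> in the new variable, and the term of degree \<open>1\<close> vanishes because the variables are centred.
\<close>

lemma linear_moment_le:
  assumes "finite A" "A \<subseteq> {..<N}" "k \<le> K"
  shows "\<bar>expectation (\<lambda>x. (\<Sum>s\<in>A. a s * \<xi> s x) ^ k)\<bar>
    \<le> fact k * (sqrt (real K) * m * L2_set a A) ^ k"
  using assms
proof (induction A arbitrary: k rule: finite_induct)
  case empty
  show ?case by (cases k) (auto simp: prob_space)
next
  case (insert i A)
  let ?e = "\<lambda>l. expectation (\<lambda>x. (\<Sum>s\<in>A. a s * \<xi> s x) ^ l)"
  define N0 where "N0 = sqrt (real K) * m * L2_set a A"
  define y where "y = \<bar>a i\<bar> * m"
  define R where "R = sqrt (real K) * m * L2_set a (insert i A)"
  have m0: "0 \<le> m" using m_ge_1 by simp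
  have nonneg: "0 \<le> N0" "0 \<le> y" "0 \<le> R"
    unfolding N0_def y_def R_def using m0 by (auto simp: L2_set_nonneg)
  have R2: "R\<^sup>2 = N0\<^sup>2 + real K * y\<^sup>2"
    unfolding N0_def y_def R_def L2_set_def power_mult_distrib
    using insert.hyps by (simp add: sum_nonneg real_sqrt_pow2 algebra_simps)
  have summand: "\<bar>real (k choose l) * (a i ^ l * expectation (\<lambda>x. \<xi> i x ^ l)) * ?e (k - l)\<bar>
      \<le> fact k * (y ^ l * N0 ^ (k - l))" if "l \<le> k" for l
  proof -
    have "\<bar>a i ^ l * expectation (\<lambda>x. \<xi> i x ^ l)\<bar> \<le> \<bar>a i\<bar> ^ l * (fact l * m ^ l)"
      unfolding abs_mult power_abs using moment_le[of i l] insert.prems by (intro mult_left_mono) auto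
    also have "\<dots> = fact l * y ^ l" by (simp add: y_def power_mult_distrib)
    finally have 1: "\<bar>a i ^ l * expectation (\<lambda>x. \<xi> i x ^ l)\<bar> \<le> fact l * y ^ l" .
    have 2: "\<bar>?e (k - l)\<bar> \<le> fact (k - l) * N0 ^ (k - l)"
      unfolding N0_def using insert.prems by (intro insert.IH) auto
    have "\<bar>real (k choose l) * (a i ^ l * expectation (\<lambda>x. \<xi> i x ^ l)) * ?e (k - l)\<bar>
        \<le> real (k choose l) * (fact l * y ^ l) * (fact (k - l) * N0 ^ (k - l))"
      unfolding abs_mult[of _ "?e (k - l)"] abs_mult[of "real _"]
      using 1 2 nonneg by (intro mult_mono) (auto simp: mult_nonneg_nonneg)
    also have "\<dots> = (real (k choose l) * fact l * fact (k - l)) * (y ^ l * N0 ^ (k - l))"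
      by (simp add: mult_ac)
    also have "real (k choose l) * fact l * fact (k - l) = fact k"
      using binomial_fact_lemma[OF that] by (metis (no_types, lifting) mult.assoc mult.commute of_nat_fact of_nat_mult)
    finally show ?thesis .
  qed
  have "expectation (\<lambda>x. (\<Sum>s\<in>insert i A. a s * \<xi> s x) ^ k)
      = (\<Sum>l\<le>k. real (k choose l) * (a i ^ l * expectation (\<lambda>x. \<xi> i x ^ l)) * ?e (k - l))"
    using expectation_hpoly_insert[OF insert.hyps insert.prems(1), of 0 a k]
    by (simp add: binomial_conv_def)
  also have "\<dots> = (\<Sum>l\<in>insert 0 {2..k}. real (k choose l) * (a i ^ l * expectation (\<lambda>x. \<xi> i x ^ l)) * ?e (k - l))"
  proof (rule sum.mono_neutral_right)
    have "l = 1" if "l \<in> {..k} - insert 0 {2..k}" for l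
      using that by auto
    then show "\<forall>l\<in>{..k} - insert 0 {2..k}.
        real (k choose l) * (a i ^ l * expectation (\<lambda>x. \<xi> i x ^ l)) * ?e (k - l) = 0"
      using mean_0[of i] insert.prems by fastforce
  qed auto
  also have "\<bar>\<dots>\<bar> \<le> (\<Sum>l\<in>insert 0 {2..k}. fact k * (y ^ l * N0 ^ (k - l)))"
    by (rule order_trans[OF sum_abs sum_mono]) (rule summand, auto)
  also have "\<dots> = fact k * (N0 ^ k + (\<Sum>l\<in>{2..k}. y ^ l * N0 ^ (k - l)))"
    by (simp add: sum_distrib_left distrib_left)
  also have "\<dots> \<le> fact k * R ^ k"
    using geometric_mix_le[OF nonneg R2 insert.prems(2)] by (intro mult_left_mono) auto
  finally show ?case unfolding R_def .
qed

end

section \<open>Fluctuations of sums of Hermite polynomials\<close>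

lemma weighted_sum_square_le:
  fixes a r :: "'i \<Rightarrow> real"
  shows "(\<Sum>j\<in>J. (a j)\<^sup>2 * r j)\<^sup>2 \<le> (\<Sum>j\<in>J. (a j)\<^sup>2) * (\<Sum>j\<in>J. (a j)\<^sup>2 * (r j)\<^sup>2)"
  using Cauchy_Schwarz_ineq_sum[of a "\<lambda>j. a j * r j" J]
  by (simp add: power2_eq_square mult_ac)

lemma square_add_le: "(x + y)\<^sup>2 \<le> 2 * x\<^sup>2 + 2 * y\<^sup>2" for x y :: real
  using zero_le_power2[of "x - y"] by (simp add: power2_eq_square algebra_simps)

lemma fact_le_power_real: "k \<le> n \<Longrightarrow> (fact k :: real) \<le> real n ^ k"
  using fact_le_power[of k] power_mono[of "real k" "real n" k]
  by (metis (no_types, opaque_lifting) of_nat_0_le_iff of_nat_fact of_nat_le_iff of_nat_power order_trans)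

lemma power_three_sum_le:
  fixes x y z :: real
  assumes "0 \<le> x" "0 \<le> y" "0 \<le> z"
  shows "(x + y + z) ^ d \<le> 3 ^ d * (x ^ d + y ^ d + z ^ d)"
proof -
  have "(x + y + z) ^ d \<le> (3 * max x (max y z)) ^ d"
    using assms by (intro power_mono) auto
  also have "(max x (max y z)) ^ d \<le> x ^ d + y ^ d + z ^ d"
    using assms by (auto simp: max_def)
  then have "(3 * max x (max y z)) ^ d \<le> 3 ^ d * (x ^ d + y ^ d + z ^ d)"
    by (simp add: power_mult_distrib)
  finally show ?thesis .
qed

context indep_system
begin

lemma all_moments_linear [intro]:
  "A \<subseteq> {..<N} \<Longrightarrow> all_moments M (\<lambda>x. \<Sum>s\<in>A. a s * \<xi> s x)"
  by (intro all_moments_sum all_moments_mult all_moments_const moments) auto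

text \<open>The factorial and the square root in \<open>linear_moment_le\<close> are both replaced
  by powers of \<open>2 * k\<close>. This loses a power of \<open>k\<close> inside a power of order
  \<open>2 * k\<close>, which the factor (C k)^(5 k^2) of the final bound absorbs.\<close>

lemma linear_even_moment_le:
  assumes "A \<subseteq> {..<N}" "L2_set a A \<le> B"
  shows "expectation (\<lambda>x. (\<Sum>s\<in>A. a s * \<xi> s x) ^ (2 * k)) \<le> (4 * (real k)\<^sup>2 * m * B) ^ (2 * k)"
proof (cases "k = 0")
  case False
  have m0: "0 \<le> m" using m_ge_1 by simp
  have B0: "0 \<le> B" using assms(2) L2_set_nonneg[of a A] by linarith
  have "expectation (\<lambda>x. (\<Sum>s\<in>A. a s * \<xi> s x) ^ (2 * k))
      \<le> fact (2 * k) * (sqrt (real (2 * k)) * m * L2_set a A) ^ (2 * k)"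
    using linear_moment_le[OF _ assms(1), of "2 * k" "2 * k" a] assms(1) finite_subset by fastforce
  also have "\<dots> \<le> real (2 * k) ^ (2 * k) * (real (2 * k) * m * B) ^ (2 * k)"
  proof (rule mult_mono)
    have "sqrt (real (2 * k)) \<le> real (2 * k)"
      by (rule real_le_lsqrt) (use False in \<open>auto simp: power2_eq_square\<close>)
    then have "sqrt (real (2 * k)) * m * L2_set a A \<le> real (2 * k) * m * B"
      using assms(2) m0 B0 by (intro mult_mono mult_right_mono) (auto simp: L2_set_nonneg)
    then show "(sqrt (real (2 * k)) * m * L2_set a A) ^ (2 * k) \<le> (real (2 * k) * m * B) ^ (2 * k)"
      using m0 by (intro power_mono) (auto simp: L2_set_nonneg)
  qed (use m0 in \<open>auto simp: L2_set_nonneg intro!: fact_le_power_real[of "2 * k" "2 * k", simplified]\<close>)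
  also have "\<dots> = (real (2 * k) * (real (2 * k) * m * B)) ^ (2 * k)"
    by (rule power_mult_distrib[symmetric])
  also have "real (2 * k) * (real (2 * k) * m * B) = 4 * (real k)\<^sup>2 * m * B"
    by (simp add: power2_eq_square)
  finally show ?thesis .
qed (simp add: prob_space)

text \<open>In both uses one of the two linear forms is a score. The other is a multiple of a single
  variable in \<open>expectation_Z_le\<close> and the rescaled error of the estimated mean in
  \<open>expectation_shift_le\<close>.\<close>

lemma envelope_moment_le:
  assumes "L2_set a {..<N} \<le> B" "L2_set b {..<N} \<le> B" "0 \<le> c" "c \<le> 4 * (real k)\<^sup>2 * m * B"
  shows "expectation (\<lambda>x. (\<bar>\<Sum>s<N. a s * \<xi> s x\<bar> + \<bar>\<Sum>s<N. b s * \<xi> s x\<bar> + c) ^ (2 * k))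
    \<le> 3 * (12 * (real k)\<^sup>2 * m * B) ^ (2 * k)"
proof -
  have lin: "all_moments M (\<lambda>x. \<Sum>s<N. a s * \<xi> s x)" "all_moments M (\<lambda>x. \<Sum>s<N. b s * \<xi> s x)"
    by auto
  have "expectation (\<lambda>x. (\<bar>\<Sum>s<N. a s * \<xi> s x\<bar> + \<bar>\<Sum>s<N. b s * \<xi> s x\<bar> + c) ^ (2 * k))
      \<le> expectation (\<lambda>x. 3 ^ (2 * k) * ((\<Sum>s<N. a s * \<xi> s x) ^ (2 * k)
            + (\<Sum>s<N. b s * \<xi> s x) ^ (2 * k) + c ^ (2 * k)))"
  proof (rule integral_mono)
    fix x
    show "(\<bar>\<Sum>s<N. a s * \<xi> s x\<bar> + \<bar>\<Sum>s<N. b s * \<xi> s x\<bar> + c) ^ (2 * k)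
      \<le> 3 ^ (2 * k) * ((\<Sum>s<N. a s * \<xi> s x) ^ (2 * k) + (\<Sum>s<N. b s * \<xi> s x) ^ (2 * k) + c ^ (2 * k))"
      using power_three_sum_le[of "\<bar>\<Sum>s<N. a s * \<xi> s x\<bar>" "\<bar>\<Sum>s<N. b s * \<xi> s x\<bar>" c "2 * k"] assms
      by (simp add: power_even_abs)
  qed (rule all_moments_integrable, intro all_moments_power all_moments_add all_moments_mult
      all_moments_abs all_moments_const lin)+
  also have "\<dots> = 3 ^ (2 * k) * (expectation (\<lambda>x. (\<Sum>s<N. a s * \<xi> s x) ^ (2 * k))
      + expectation (\<lambda>x. (\<Sum>s<N. b s * \<xi> s x) ^ (2 * k)) + c ^ (2 * k))"
    using lin by (simp add: all_moments_integrable all_moments_power prob_space)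
  also have "\<dots> \<le> 3 ^ (2 * k) * ((4 * (real k)\<^sup>2 * m * B) ^ (2 * k)
      + (4 * (real k)\<^sup>2 * m * B) ^ (2 * k) + (4 * (real k)\<^sup>2 * m * B) ^ (2 * k))"
    using assms by (intro mult_left_mono add_mono linear_even_moment_le power_mono) auto
  also have "\<dots> = 3 * (3 ^ (2 * k) * (4 * (real k)\<^sup>2 * m * B) ^ (2 * k))"
    by simp
  also have "3 ^ (2 * k) * (4 * (real k)\<^sup>2 * m * B) ^ (2 * k) = (3 * (4 * (real k)\<^sup>2 * m * B)) ^ (2 * k)"
    by (rule power_mult_distrib[symmetric])
  also have "3 * (4 * (real k)\<^sup>2 * m * B) = 12 * (real k)\<^sup>2 * m * B"
    by simp
  finally show ?thesis .
qed

text \<open>All terms depend on the joint law of the variables only, which by independence is a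
  product measure.\<close>

lemma efron_stein_indep:
  fixes f :: "(nat \<Rightarrow> real) \<Rightarrow> real"
  assumes "0 < N"
    and [measurable]: "f \<in> borel_measurable (\<Pi>\<^sub>M s\<in>{..<N}. borel)"
    and h [measurable]: "\<And>s. s < N \<Longrightarrow> h s \<in> borel_measurable (\<Pi>\<^sub>M s\<in>{..<N}. borel)"
    and f2: "integrable M (\<lambda>\<omega>. (f (\<lambda>s\<in>{..<N}. \<xi> s \<omega>))\<^sup>2)"
    and h2: "\<And>s. s < N \<Longrightarrow> integrable M (\<lambda>\<omega>. (h s (\<lambda>s\<in>{..<N}. \<xi> s \<omega>))\<^sup>2)"
    and h_upd: "\<And>s x y. s < N \<Longrightarrow> h s (x(s := y)) = h s x"
  shows "expectation (\<lambda>\<omega>. (f (\<lambda>s\<in>{..<N}. \<xi> s \<omega>))\<^sup>2) - (expectation (\<lambda>\<omega>. f (\<lambda>s\<in>{..<N}. \<xi> s \<omega>)))\<^sup>2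
    \<le> (\<Sum>s<N. expectation (\<lambda>\<omega>. (f (\<lambda>s\<in>{..<N}. \<xi> s \<omega>) - h s (\<lambda>s\<in>{..<N}. \<xi> s \<omega>))\<^sup>2))"
proof -
  \<comment> \<open>\<open>efron_stein\<close> asks for a probability measure at every index;
    outside the range a point mass fills in.\<close>
  define L where "L s = (if s < N then distr M borel (\<xi> s) else return borel 0)" for s
  define \<Phi> where "\<Phi> \<omega> = (\<lambda>s\<in>{..<N}. \<xi> s \<omega>)" for \<omega>
  have rv [measurable]: "\<xi> s \<in> borel_measurable M" if "s < N" for s
    using moments[OF that] by (rule all_moments_measurable)
  have \<Phi>_meas [measurable]: "\<Phi> \<in> measurable M (\<Pi>\<^sub>M s\<in>{..<N}. borel)"
    unfolding \<Phi>_def by (rule measurable_restrict) simp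
  have L: "prob_space (L s)" for s
    unfolding L_def by (auto intro!: prob_space_distr prob_space_return)
  have sets_L: "sets (L s) = sets borel" for s
    by (simp add: L_def)
  have "distr M (\<Pi>\<^sub>M s\<in>{..<N}. borel) \<Phi> = (\<Pi>\<^sub>M s\<in>{..<N}. distr M borel (\<xi> s))"
    unfolding \<Phi>_def using indep \<open>0 < N\<close>
    by (subst indep_vars_iff_distr_eq_PiM'[symmetric]) auto
  also have "\<dots> = Pi\<^sub>M {..<N} L"
    by (rule PiM_cong) (auto simp: L_def)
  finally have P: "Pi\<^sub>M {..<N} L = distr M (\<Pi>\<^sub>M s\<in>{..<N}. borel) \<Phi>" by simp
  have sets_P: "sets (Pi\<^sub>M {..<N} L) = sets (\<Pi>\<^sub>M s\<in>{..<N}. borel)"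
    by (rule sets_PiM_cong) (auto simp: sets_L)
  have meas: "borel_measurable (Pi\<^sub>M {..<N} L) = borel_measurable (\<Pi>\<^sub>M s\<in>{..<N}. borel)"
    by (rule measurable_cong_sets[OF sets_P refl])
  have "(\<integral>x. (f x)\<^sup>2 \<partial>Pi\<^sub>M {..<N} L) - (\<integral>x. f x \<partial>Pi\<^sub>M {..<N} L)\<^sup>2
      \<le> (\<Sum>s<N. \<integral>x. (f x - h s x)\<^sup>2 \<partial>Pi\<^sub>M {..<N} L)"
  proof (rule efron_stein[OF _ L])
    show "integrable (Pi\<^sub>M {..<N} L) (\<lambda>x. (f x)\<^sup>2)"
      unfolding P using f2 by (subst integrable_distr_eq) (auto simp: \<Phi>_def)
    show "integrable (Pi\<^sub>M {..<N} L) (\<lambda>x. (h s x)\<^sup>2)" if "s \<in> {..<N}" for s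
      unfolding P using h2[of s] h[of s] that by (subst integrable_distr_eq) (auto simp: \<Phi>_def)
  qed (use h h_upd in \<open>auto simp: meas\<close>)
  then show ?thesis
    unfolding P \<Phi>_def[symmetric] by (simp add: integral_distr)
qed

end

text \<open>\<open>op_le\<close> bounds the norm of the transpose of the matrix \<open>G\<close>.
  This dual form is the one that gets applied: \<open>w\<close> will be the vector of the
  derivatives of the summands, indexed by the columns of the design.\<close>

locale hermite_sum = indep_system +
  fixes G :: "nat \<Rightarrow> nat \<Rightarrow> real" and v :: "nat \<Rightarrow> real" and p k :: nat and T :: real
  assumes k_ge_2: "2 \<le> k" and N_pos: "0 < N" and T_pos: "0 < T"
    and op_le: "\<And>w. (\<Sum>s<N. (\<Sum>j<p. G j s * w j)\<^sup>2) \<le> T\<^sup>2 * (\<Sum>j<p. (w j)\<^sup>2)"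
    and v_nonneg: "\<And>j. j < p \<Longrightarrow> 0 \<le> v j" and v_le: "\<And>j. j < p \<Longrightarrow> v j \<le> T\<^sup>2"
begin

definition u :: "nat \<Rightarrow> 'a \<Rightarrow> real" where
  "u j \<omega> = (\<Sum>s<N. G j s * \<xi> s \<omega>)"

definition u_out :: "nat \<Rightarrow> nat \<Rightarrow> 'a \<Rightarrow> real" where
  "u_out s j \<omega> = (\<Sum>r\<in>{..<N} - {s}. G j r * \<xi> r \<omega>)"

definition F :: "'a \<Rightarrow> real" where
  "F \<omega> = (\<Sum>j<p. hpoly (v j) (u j \<omega>) k)"

definition F_out :: "nat \<Rightarrow> 'a \<Rightarrow> real" where
  "F_out s \<omega> = (\<Sum>j<p. hpoly (v j) (u_out s j \<omega>) k)"

text \<open>The least constant that \<open>abs_hpoly_le\<close> admits when the \<open>v j\<close>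
  may be as large as \<open>T\<^sup>2\<close>.\<close>

definition c :: real where "c = sqrt (real k) * T"

text \<open>
  An envelope for everything that occurs when \<open>\<xi> s\<close> is removed from \<open>u j\<close>; since \<open>T \<le> Z s j \<omega>\<close>, only
  its moment of order \<open>2 * k\<close> is ever needed.
\<close>

definition Z :: "nat \<Rightarrow> nat \<Rightarrow> 'a \<Rightarrow> real" where
  "Z s j \<omega> = \<bar>u j \<omega>\<bar> + 2 * T * \<bar>\<xi> s \<omega>\<bar> + c"

text \<open>\<open>\<kappa> = 1\<close> belongs to the exact mean; a larger \<open>\<kappa>\<close>
  leaves room for the error of the estimated mean. The \<open>24\<close> is \<open>12 * 2\<close>,
  as \<open>envelope_moment_le\<close> gets applied with the norm bound
  \<open>2 * (\<kappa> * T)\<close>.\<close>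

definition Q :: "real \<Rightarrow> real" where
  "Q \<kappa> = 3 * (24 * (real k)\<^sup>2 * m * (\<kappa> * T)) ^ (2 * k)"

lemma row_le: assumes "j < p" shows "(\<Sum>s<N. (G j s)\<^sup>2) \<le> T\<^sup>2"
  using op_le[of "\<lambda>i. if i = j then 1 else 0"] assms
  by (simp add: if_distrib[of "\<lambda>x. _ * x"] if_distrib[of "\<lambda>x. x\<^sup>2"] sum.delta cong: if_cong)

text \<open>Testing \<open>op_le\<close> with the column \<open>s\<close> itself gives S^2 <= T^2 S
  for its squared norm S.\<close>

lemma col_le: assumes "s < N" shows "(\<Sum>j<p. (G j s)\<^sup>2) \<le> T\<^sup>2"
proof -
  let ?S = "\<Sum>j<p. (G j s)\<^sup>2"
  have "?S\<^sup>2 = (\<Sum>j<p. G j s * G j s)\<^sup>2" by (simp add: power2_eq_square)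
  also have "\<dots> \<le> (\<Sum>r<N. (\<Sum>j<p. G j r * G j s)\<^sup>2)"
    using assms by (intro member_le_sum) auto
  also have "\<dots> \<le> T\<^sup>2 * ?S" by (rule op_le)
  finally have "?S * ?S \<le> T\<^sup>2 * ?S" by (simp add: power2_eq_square)
  moreover have "0 \<le> ?S" by (rule sum_nonneg) simp
  ultimately show ?thesis by (cases "?S = 0") (auto simp: mult_le_cancel_right)
qed

lemma entry_le: assumes "j < p" "s < N" shows "\<bar>G j s\<bar> \<le> T"
proof -
  have "(G j s)\<^sup>2 \<le> (\<Sum>s<N. (G j s)\<^sup>2)"
    using assms by (intro member_le_sum) auto
  with row_le[OF assms(1)] have "\<bar>G j s\<bar>\<^sup>2 \<le> T\<^sup>2" by simp
  then show ?thesis by (rule power2_le_imp_le) (use T_pos in simp)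
qed

lemma sum_entries_le: "(\<Sum>s<N. \<Sum>j<p. (G j s)\<^sup>2) \<le> real p * T\<^sup>2"
  using sum_bounded_above[of "{..<p}" "\<lambda>j. \<Sum>s<N. (G j s)\<^sup>2"] row_le
  by (subst sum.swap) simp

lemma c_props: "0 \<le> c" "T \<le> c" "j < p \<Longrightarrow> real k * v j \<le> c\<^sup>2"
  using T_pos k_ge_2 v_le[of j] by (auto simp: c_def power_mult_distrib)

lemma moments_u [intro]: "all_moments M (u j)" "all_moments M (u_out s j)"
  unfolding u_def u_out_def by auto

lemma moments_Z [intro]: "s < N \<Longrightarrow> all_moments M (Z s j)"
  unfolding Z_def
  by (intro all_moments_add all_moments_abs all_moments_mult all_moments_const moments moments_u)

lemma moments_F [intro]: "all_moments M F" "all_moments M (F_out s)"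
  unfolding F_def F_out_def by (intro all_moments_sum all_moments_hpoly moments_u)+

lemma u_split: "s < N \<Longrightarrow> u j \<omega> = u_out s j \<omega> + G j s * \<xi> s \<omega>"
  unfolding u_def u_out_def by (subst sum.remove[of _ s]) auto

text \<open>\<open>u_out s j\<close> differs from \<open>u j\<close> by the increment, of size at
  most \<open>T\<close> times the variable. Together with the increment itself that makes two of
  them, hence the \<open>2 * T\<close> in \<open>Z\<close>.\<close>

lemma Z_ge: "s < N \<Longrightarrow> j < p \<Longrightarrow> \<bar>u_out s j \<omega>\<bar> + \<bar>G j s * \<xi> s \<omega>\<bar> + c \<le> Z s j \<omega>"
  "\<bar>u j \<omega>\<bar> + c \<le> Z s j \<omega>" "T \<le> Z s j \<omega>" "2 * T * \<bar>\<xi> s \<omega>\<bar> \<le> Z s j \<omega>"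
proof -
  assume "s < N" "j < p"
  then have "\<bar>G j s * \<xi> s \<omega>\<bar> \<le> T * \<bar>\<xi> s \<omega>\<bar>"
    using entry_le by (auto simp: abs_mult intro: mult_right_mono)
  moreover have "\<bar>u_out s j \<omega>\<bar> \<le> \<bar>u j \<omega>\<bar> + \<bar>G j s * \<xi> s \<omega>\<bar>"
    using u_split[OF \<open>s < N\<close>, of j \<omega>] by linarith
  ultimately show "\<bar>u_out s j \<omega>\<bar> + \<bar>G j s * \<xi> s \<omega>\<bar> + c \<le> Z s j \<omega>"
    unfolding Z_def by linarith
next
  have "0 \<le> 2 * T * \<bar>\<xi> s \<omega>\<bar>" using T_pos by simp
  then show "\<bar>u j \<omega>\<bar> + c \<le> Z s j \<omega>" "T \<le> Z s j \<omega>" "2 * T * \<bar>\<xi> s \<omega>\<bar> \<le> Z s j \<omega>"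
    unfolding Z_def using c_props(1,2) abs_ge_zero[of "u j \<omega>"] by linarith+
qed

lemma c_le: "1 \<le> \<kappa> \<Longrightarrow> c \<le> 4 * (real k)\<^sup>2 * m * (2 * (\<kappa> * T))"
proof -
  assume "1 \<le> \<kappa>"
  have "sqrt (real k) \<le> real k"
    using k_ge_2 by (intro real_le_lsqrt) (auto simp: power2_eq_square)
  also have "\<dots> \<le> (real k)\<^sup>2" using k_ge_2 by (simp add: power2_eq_square)
  also have "\<dots> \<le> (real k)\<^sup>2 * (8 * (m * \<kappa>))"
  proof -
    have "1 \<le> m * \<kappa>" using mult_mono[OF m_ge_1 \<open>1 \<le> \<kappa>\<close>] m_ge_1 by simp
    then show ?thesis using mult_left_mono[of 1 "8 * (m * \<kappa>)" "(real k)\<^sup>2"] by simp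
  qed
  finally have "sqrt (real k) * T \<le> (real k)\<^sup>2 * (8 * (m * \<kappa>)) * T"
    using T_pos by (intro mult_right_mono) auto
  then show ?thesis by (simp add: c_def mult_ac)
qed

lemma L2_row_le: "j < p \<Longrightarrow> L2_set (G j) {..<N} \<le> T"
  unfolding L2_set_def using row_le[of j] T_pos by (intro real_le_lsqrt) (auto simp: sum_nonneg)

lemma expectation_Z_le:
  assumes "s < N" "j < p"
  shows "expectation (\<lambda>\<omega>. Z s j \<omega> ^ (2 * k)) \<le> Q 1"
proof -
  let ?e = "\<lambda>r. if r = s then 2 * T else 0"
  have "(\<Sum>r<N. ?e r * \<xi> r \<omega>) = 2 * T * \<xi> s \<omega>" for \<omega>
    using assms by (simp add: if_distrib[of "\<lambda>x. x * _"] sum.delta cong: if_cong)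
  then have eq: "Z s j \<omega> = \<bar>\<Sum>r<N. G j r * \<xi> r \<omega>\<bar> + \<bar>\<Sum>r<N. ?e r * \<xi> r \<omega>\<bar> + c" for \<omega>
    using T_pos by (simp only: Z_def u_def) (simp add: abs_mult)
  have e: "L2_set ?e {..<N} \<le> 2 * (1 * T)"
    using assms T_pos
    by (simp add: L2_set_def if_distrib[of "\<lambda>x. x\<^sup>2"] sum.delta real_sqrt_mult cong: if_cong)
  have G: "L2_set (G j) {..<N} \<le> 2 * (1 * T)"
    using L2_row_le[OF assms(2)] T_pos by simp
  have num: "12 * (real k)\<^sup>2 * m * (2 * (1 * T)) = 24 * (real k)\<^sup>2 * m * (1 * T)"
    by simp
  show ?thesis
    unfolding eq Q_def num[symmetric]
    by (rule envelope_moment_le[OF G e c_props(1) c_le]) simp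
qed

lemma expectation_shift_le:
  assumes "j < p" "1 \<le> \<kappa>" "0 < r" "L2_set a {..<N} \<le> \<kappa> / sqrt r"
  shows "expectation (\<lambda>\<omega>. (sqrt r * T * \<bar>\<Sum>s<N. a s * \<xi> s \<omega>\<bar> + \<bar>u j \<omega>\<bar> + c) ^ (2 * k)) \<le> Q \<kappa>"
proof -
  have eq: "sqrt r * T * \<bar>\<Sum>s<N. a s * \<xi> s \<omega>\<bar> = \<bar>\<Sum>s<N. (sqrt r * T * a s) * \<xi> s \<omega>\<bar>" for \<omega>
    using assms(3) T_pos by (simp add: sum_distrib_left[symmetric] mult.assoc abs_mult)
  have a: "L2_set (\<lambda>s. sqrt r * T * a s) {..<N} \<le> 2 * (\<kappa> * T)"
  proof -
    have "L2_set (\<lambda>s. sqrt r * T * a s) {..<N} = sqrt r * T * L2_set a {..<N}"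
      using assms(3) T_pos by (simp add: L2_set_right_distrib)
    also have "\<dots> \<le> sqrt r * T * (\<kappa> / sqrt r)"
      using assms T_pos by (intro mult_left_mono) auto
    also have "\<dots> \<le> 2 * (\<kappa> * T)" using assms(2,3) T_pos by simp
    finally show ?thesis .
  qed
  have "T \<le> \<kappa> * T" using mult_right_mono[OF assms(2), of T] T_pos by simp
  then have G: "L2_set (G j) {..<N} \<le> 2 * (\<kappa> * T)"
    using L2_row_le[OF assms(1)] T_pos by linarith
  have num: "12 * (real k)\<^sup>2 * m * (2 * (\<kappa> * T)) = 24 * (real k)\<^sup>2 * m * (\<kappa> * T)"
    by simp
  show ?thesis
    unfolding eq Q_def num[symmetric] u_def
    by (rule envelope_moment_le[OF a G c_props(1) c_le[OF assms(2)]])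
qed

end

text \<open>Each entry is at most the Euclidean norm, which may therefore replace k - 2 of the k
  factors: the norm of order k >= 2 is below the Euclidean one.\<close>

lemma sum_power_square_le:
  fixes x :: "'i \<Rightarrow> real"
  assumes "finite J" "\<And>j. j \<in> J \<Longrightarrow> 0 \<le> x j" "2 \<le> k"
  shows "(\<Sum>j\<in>J. x j ^ k)\<^sup>2 \<le> (\<Sum>j\<in>J. (x j)\<^sup>2) ^ k"
proof -
  define S where "S = sqrt (\<Sum>j\<in>J. (x j)\<^sup>2)"
  have S0: "0 \<le> S" by (simp add: S_def sum_nonneg)
  have S2: "S\<^sup>2 = (\<Sum>j\<in>J. (x j)\<^sup>2)" by (simp add: S_def sum_nonneg)
  have "x j ^ k \<le> S ^ (k - 2) * (x j)\<^sup>2" if "j \<in> J" for j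
  proof -
    have "(x j)\<^sup>2 \<le> S\<^sup>2" unfolding S2 using assms(1) that by (intro member_le_sum) auto
    then have "x j \<le> S" using S0 by (rule power2_le_imp_le)
    then have "x j ^ (k - 2) * (x j)\<^sup>2 \<le> S ^ (k - 2) * (x j)\<^sup>2"
      using assms(2)[OF that] by (intro mult_right_mono power_mono) auto
    then show ?thesis using power_split[OF assms(3), of "x j"] by (simp add: mult.commute)
  qed
  then have "(\<Sum>j\<in>J. x j ^ k) \<le> S ^ (k - 2) * S\<^sup>2"
    unfolding S2 sum_distrib_left by (rule sum_mono)
  also have "\<dots> = S ^ k" using power_split[OF assms(3), of S] by (simp add: mult.commute)
  finally have "(\<Sum>j\<in>J. x j ^ k)\<^sup>2 \<le> (S ^ k)\<^sup>2"
    using assms(2) by (intro power_mono sum_nonneg) auto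
  also have "\<dots> = (S\<^sup>2) ^ k" by (simp add: power_mult[symmetric] mult.commute)
  finally show ?thesis by (simp only: S2)
qed

section \<open>Increments in a single variable, the variance, and the shift by the mean
  error\<close>

context hermite_sum
begin

definition V :: "nat \<Rightarrow> 'a \<Rightarrow> real" where
  "V s \<omega> = (\<Sum>j<p. G j s * hpoly (v j) (u j \<omega>) (k - 1))"

definition W :: "nat \<Rightarrow> 'a \<Rightarrow> real" where
  "W s \<omega> = (\<Sum>j<p. G j s * hpoly (v j) (u_out s j \<omega>) (k - 1))"

definition P :: "nat \<Rightarrow> 'a \<Rightarrow> real" where
  "P s \<omega> = (\<Sum>j<p. (G j s)\<^sup>2 * Z s j \<omega> ^ (2 * k))"

lemma moments_VW [intro]: "all_moments M (V s)" "all_moments M (W s)"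
  unfolding V_def W_def by (intro all_moments_sum all_moments_mult all_moments_const all_moments_hpoly moments_u)+

lemma moments_P [intro]: "s < N \<Longrightarrow> all_moments M (P s)"
  unfolding P_def by (intro all_moments_sum all_moments_mult all_moments_const all_moments_power moments_Z)

lemma Z_nonneg: "0 \<le> Z s j \<omega>"
  using Z_ge(3)[of s j \<omega>] T_pos by linarith

lemma P_nonneg: "0 \<le> P s \<omega>"
  unfolding P_def by (intro sum_nonneg mult_nonneg_nonneg zero_le_power2 zero_le_power[OF Z_nonneg])

text \<open>Cauchy-Schwarz with the weights \<open>(G j s)\<^sup>2\<close>: one copy of them sums to
  at most \<open>T\<^sup>2\<close> down the column, the other stays in \<open>P\<close> and is
  summed over \<open>s\<close> along the rows later.\<close>

lemma weighted_envelope_le: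
  assumes "s < N" "0 \<le> b" "\<And>j. j < p \<Longrightarrow> \<bar>y j\<bar> \<le> (G j s)\<^sup>2 * (b * Z s j \<omega> ^ k)"
  shows "(\<Sum>j<p. y j)\<^sup>2 \<le> T\<^sup>2 * b\<^sup>2 * P s \<omega>"
proof -
  have "\<bar>\<Sum>j<p. y j\<bar> \<le> (\<Sum>j<p. (G j s)\<^sup>2 * (b * Z s j \<omega> ^ k))"
    using assms(3) by (intro order_trans[OF sum_abs sum_mono]) auto
  then have "\<bar>\<Sum>j<p. y j\<bar>\<^sup>2 \<le> (\<Sum>j<p. (G j s)\<^sup>2 * (b * Z s j \<omega> ^ k))\<^sup>2"
    by (rule power_mono) simp
  also have "\<dots> \<le> (\<Sum>j<p. (G j s)\<^sup>2) * (\<Sum>j<p. (G j s)\<^sup>2 * (b * Z s j \<omega> ^ k)\<^sup>2)"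
    by (rule weighted_sum_square_le)
  also have "(\<Sum>j<p. (G j s)\<^sup>2 * (b * Z s j \<omega> ^ k)\<^sup>2) = b\<^sup>2 * P s \<omega>"
    unfolding P_def sum_distrib_left
    by (intro sum.cong) (auto simp: power_mult_distrib power_mult[symmetric] mult_ac)
  also have "(\<Sum>j<p. (G j s)\<^sup>2) * (b\<^sup>2 * P s \<omega>) \<le> T\<^sup>2 * (b\<^sup>2 * P s \<omega>)"
    using col_le[OF assms(1)] P_nonneg[of s \<omega>] by (intro mult_right_mono) auto
  finally show ?thesis by (simp add: mult.assoc)
qed

lemma F_diff_le:
  assumes "s < N"
  shows "(F \<omega> - F_out s \<omega> - real k * \<xi> s \<omega> * W s \<omega>)\<^sup>2 \<le> real k ^ 4 / (16 * T\<^sup>2) * P s \<omega>"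
proof -
  let ?y = "\<lambda>j. hpoly (v j) (u j \<omega>) k - hpoly (v j) (u_out s j \<omega>) k
      - real k * \<xi> s \<omega> * (G j s * hpoly (v j) (u_out s j \<omega>) (k - 1))"
  \<comment> \<open>The squared increment is absorbed by
    \<open>2 * T * \<bar>\<xi> s \<omega>\<bar> \<le> Z s j \<omega>\<close>, which costs the factor
    \<open>1 / (4 * T\<^sup>2)\<close>.\<close>
  let ?b = "(real k)\<^sup>2 / (4 * T\<^sup>2)"
  have "\<bar>?y j\<bar> \<le> (G j s)\<^sup>2 * (?b * Z s j \<omega> ^ k)" if j: "j < p" for j
  proof -
    let ?h = "G j s * \<xi> s \<omega>"
    let ?z = "Z s j \<omega>"
    have "\<bar>?y j\<bar> = \<bar>hpoly (v j) (u_out s j \<omega> + ?h) k - hpoly (v j) (u_out s j \<omega>) k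
        - ?h * (real k * hpoly (v j) (u_out s j \<omega>) (k - 1))\<bar>"
      by (simp add: u_split[OF assms] mult_ac)
    also have "\<dots> \<le> ?h\<^sup>2 * ((real k)\<^sup>2 * (\<bar>u_out s j \<omega>\<bar> + \<bar>?h\<bar> + c) ^ (k - 2))"
      using v_nonneg[OF j] c_props j by (intro abs_hpoly_taylor_le[where k=k]) auto
    also have "\<dots> \<le> ?h\<^sup>2 * ((real k)\<^sup>2 * ?z ^ (k - 2))"
      using Z_ge(1)[OF assms j] c_props(1) by (intro mult_left_mono power_mono) auto
    also have "\<dots> = (G j s)\<^sup>2 * ((real k)\<^sup>2 / (4 * T\<^sup>2) * ((2 * T * \<bar>\<xi> s \<omega>\<bar>)\<^sup>2 * ?z ^ (k - 2)))"
      using T_pos by (simp add: power_mult_distrib field_simps)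
    also have "\<dots> \<le> (G j s)\<^sup>2 * ((real k)\<^sup>2 / (4 * T\<^sup>2) * (?z\<^sup>2 * ?z ^ (k - 2)))"
      using Z_ge(4)[where s=s and j=j and \<omega>=\<omega>] T_pos Z_nonneg[of s j \<omega>]
      by (intro mult_left_mono mult_right_mono power_mono) auto
    also have "?z\<^sup>2 * ?z ^ (k - 2) = ?z ^ k"
      using power_split[OF k_ge_2, of ?z] by simp
    finally show ?thesis .
  qed
  from weighted_envelope_le[OF assms _ this]
  have "(\<Sum>j<p. ?y j)\<^sup>2 \<le> T\<^sup>2 * ?b\<^sup>2 * P s \<omega>" by simp
  also have "(\<Sum>j<p. ?y j) = F \<omega> - F_out s \<omega> - real k * \<xi> s \<omega> * W s \<omega>"
    by (simp add: F_def F_out_def W_def sum_subtractf sum_distrib_left)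
  also have "T\<^sup>2 * ?b\<^sup>2 = real k ^ 4 / (16 * T\<^sup>2)"
    using T_pos by (simp add: field_simps power2_eq_square power4_eq_xxxx)
  finally show ?thesis .
qed

lemma V_diff_le:
  assumes "s < N"
  shows "(V s \<omega> - W s \<omega>)\<^sup>2 \<le> (real k)\<^sup>2 / (4 * T\<^sup>2) * P s \<omega>"
proof -
  let ?y = "\<lambda>j. G j s * (hpoly (v j) (u j \<omega>) (k - 1) - hpoly (v j) (u_out s j \<omega>) (k - 1))"
  \<comment> \<open>The mean value theorem leaves degree \<open>k - 2\<close> in the envelope. The
    lower bounds \<open>T\<close> and \<open>2 * T * \<bar>\<xi> s \<omega>\<bar>\<close> on the
    envelope raise it to \<open>k\<close>, so that the same \<open>P\<close> serves, at the price of
    \<open>1 / (2 * T\<^sup>2)\<close>.\<close>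
  let ?b = "real k / (2 * T\<^sup>2)"
  have "\<bar>?y j\<bar> \<le> (G j s)\<^sup>2 * (?b * Z s j \<omega> ^ k)" if j: "j < p" for j
  proof -
    let ?h = "G j s * \<xi> s \<omega>"
    let ?z = "Z s j \<omega>"
    have "\<bar>?y j\<bar> = \<bar>G j s\<bar> * \<bar>hpoly (v j) (u_out s j \<omega> + ?h) (k - 1) - hpoly (v j) (u_out s j \<omega>) (k - 1)\<bar>"
      by (simp add: u_split[OF assms] abs_mult)
    also have "\<dots> \<le> \<bar>G j s\<bar> * (\<bar>?h\<bar> * (real (k - 1) * (\<bar>u_out s j \<omega>\<bar> + \<bar>?h\<bar> + c) ^ (k - 1 - 1)))"
      using v_nonneg[OF j] c_props j by (intro mult_left_mono abs_hpoly_diff_le[where k=k]) auto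
    also have "\<dots> \<le> \<bar>G j s\<bar> * (\<bar>?h\<bar> * (real k * ?z ^ (k - 1 - 1)))"
      using Z_ge(1)[OF assms j] c_props(1) Z_nonneg by (intro mult_left_mono mult_mono power_mono) auto
    also have "\<dots> = (G j s)\<^sup>2 * (real k / (2 * T\<^sup>2) * (T * (2 * T * \<bar>\<xi> s \<omega>\<bar>) * ?z ^ (k - 2)))"
      using T_pos by (simp add: abs_mult field_simps power2_eq_square numeral_2_eq_2)
    also have "\<dots> \<le> (G j s)\<^sup>2 * (real k / (2 * T\<^sup>2) * (?z * ?z * ?z ^ (k - 2)))"
      using Z_ge(3,4)[where s=s and j=j and \<omega>=\<omega>] T_pos Z_nonneg[of s j \<omega>]
      by (intro mult_left_mono mult_right_mono mult_mono) auto
    also have "?z * ?z * ?z ^ (k - 2) = ?z ^ k"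
      using power_split[OF k_ge_2, of ?z] by (simp add: power2_eq_square)
    finally show ?thesis .
  qed
  from weighted_envelope_le[OF assms _ this]
  have "(\<Sum>j<p. ?y j)\<^sup>2 \<le> T\<^sup>2 * ?b\<^sup>2 * P s \<omega>" by simp
  also have "(\<Sum>j<p. ?y j) = V s \<omega> - W s \<omega>"
    by (simp add: V_def W_def sum_subtractf right_diff_distrib)
  also have "T\<^sup>2 * ?b\<^sup>2 = (real k)\<^sup>2 / (4 * T\<^sup>2)"
    using T_pos by (simp add: field_simps power2_eq_square)
  finally show ?thesis .
qed

lemma abs_hpoly_pred_le:
  assumes "j < p"
  shows "T\<^sup>2 * (hpoly (v j) (u j \<omega>) (k - 1))\<^sup>2 \<le> (\<bar>u j \<omega>\<bar> + c) ^ (2 * k)"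
proof -
  have "\<bar>hpoly (v j) (u j \<omega>) (k - 1)\<bar> \<le> (\<bar>u j \<omega>\<bar> + c) ^ (k - 1)"
    using v_nonneg[OF assms] c_props assms by (intro abs_hpoly_le[where k=k]) auto
  then have "T * \<bar>hpoly (v j) (u j \<omega>) (k - 1)\<bar> \<le> (\<bar>u j \<omega>\<bar> + c) * (\<bar>u j \<omega>\<bar> + c) ^ (k - 1)"
    using T_pos c_props by (intro mult_mono) auto
  also have "\<dots> = (\<bar>u j \<omega>\<bar> + c) ^ k"
    using power_split[of 1 k "\<bar>u j \<omega>\<bar> + c"] k_ge_2 by simp
  finally have "(T * \<bar>hpoly (v j) (u j \<omega>) (k - 1)\<bar>)\<^sup>2 \<le> ((\<bar>u j \<omega>\<bar> + c) ^ k)\<^sup>2"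
    using T_pos by (intro power_mono) auto
  then show ?thesis
    by (simp add: power_mult_distrib power_mult[symmetric] mult.commute)
qed

text \<open>\<open>op_le\<close> applies because the vector of the values
  \<open>hpoly (v j) (u j \<omega>) (k - 1)\<close> is the same for every \<open>s\<close>. The
  index \<open>0\<close> on the right is arbitrary, as every \<open>Z s j\<close> dominates
  \<open>\<bar>u j \<omega>\<bar> + c\<close>.\<close>

lemma sum_V_le: "(\<Sum>s<N. (V s \<omega>)\<^sup>2) \<le> (\<Sum>j<p. Z 0 j \<omega> ^ (2 * k))"
proof -
  have "(\<Sum>s<N. (V s \<omega>)\<^sup>2) \<le> (\<Sum>j<p. T\<^sup>2 * (hpoly (v j) (u j \<omega>) (k - 1))\<^sup>2)"
    unfolding V_def sum_distrib_left[symmetric] by (rule op_le)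
  also have "\<dots> \<le> (\<Sum>j<p. Z 0 j \<omega> ^ (2 * k))"
  proof (rule sum_mono)
    fix j assume "j \<in> {..<p}"
    then have "T\<^sup>2 * (hpoly (v j) (u j \<omega>) (k - 1))\<^sup>2 \<le> (\<bar>u j \<omega>\<bar> + c) ^ (2 * k)"
      by (intro abs_hpoly_pred_le) simp
    also have "\<dots> \<le> Z 0 j \<omega> ^ (2 * k)"
      using Z_ge(2) c_props by (intro power_mono) auto
    finally show "T\<^sup>2 * (hpoly (v j) (u j \<omega>) (k - 1))\<^sup>2 \<le> Z 0 j \<omega> ^ (2 * k)" .
  qed
  finally show ?thesis .
qed

lemma Q_nonneg: "0 \<le> Q \<kappa>"
  unfolding Q_def by simp

lemma sum_expectation_P_le: "(\<Sum>s<N. expectation (P s)) \<le> real p * T\<^sup>2 * Q 1"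
proof -
  have "expectation (P s) \<le> (\<Sum>j<p. (G j s)\<^sup>2) * Q 1" if "s < N" for s
  proof -
    have "expectation (P s) = (\<Sum>j<p. (G j s)\<^sup>2 * expectation (\<lambda>\<omega>. Z s j \<omega> ^ (2 * k)))"
      unfolding P_def using that
      by (subst Bochner_Integration.integral_sum)
         (auto intro!: all_moments_integrable all_moments_mult all_moments_power moments_Z)
    also have "\<dots> \<le> (\<Sum>j<p. (G j s)\<^sup>2 * Q 1)"
      using expectation_Z_le[OF that] by (intro sum_mono mult_left_mono) auto
    finally show ?thesis by (simp add: sum_distrib_right)
  qed
  then have "(\<Sum>s<N. expectation (P s)) \<le> (\<Sum>s<N. \<Sum>j<p. (G j s)\<^sup>2) * Q 1"
    by (subst sum_distrib_right) (rule sum_mono, simp)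
  also have "\<dots> \<le> real p * T\<^sup>2 * Q 1"
    using sum_entries_le Q_nonneg by (rule mult_right_mono)
  finally show ?thesis .
qed

text \<open>\<open>W s\<close> involves only the variables other than \<open>s\<close>, so the
  expectation factors; the constant is \<open>moment_le\<close> at order 2.\<close>

lemma expectation_xi_W:
  assumes "s < N"
  shows "expectation (\<lambda>\<omega>. (\<xi> s \<omega>)\<^sup>2 * (W s \<omega>)\<^sup>2) \<le> 2 * m\<^sup>2 * expectation (\<lambda>\<omega>. (W s \<omega>)\<^sup>2)"
proof -
  define w where "w x = (\<Sum>j<p. G j s * hpoly (v j) (\<Sum>r\<in>{..<N} - {s}. G j r * x r) (k - 1))" for x
  have w: "w \<in> borel_measurable (\<Pi>\<^sub>M r\<in>{..<N} - {s}. borel)"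
    unfolding w_def by measurable
  have "indep_var (\<Pi>\<^sub>M r\<in>{s}. borel) (\<lambda>\<omega>. restrict (\<lambda>r. \<xi> r \<omega>) {s})
      (\<Pi>\<^sub>M r\<in>{..<N} - {s}. borel) (\<lambda>\<omega>. restrict (\<lambda>r. \<xi> r \<omega>) ({..<N} - {s}))"
    using assms by (intro indep_var_restrict[OF indep]) auto
  then have "indep_var borel ((\<lambda>x. (x s)\<^sup>2) \<circ> (\<lambda>\<omega>. restrict (\<lambda>r. \<xi> r \<omega>) {s}))
      borel ((\<lambda>x. (w x)\<^sup>2) \<circ> (\<lambda>\<omega>. restrict (\<lambda>r. \<xi> r \<omega>) ({..<N} - {s})))"
    using w by (intro indep_var_compose) (auto intro!: borel_measurable_power)
  also have "(\<lambda>x. (x s)\<^sup>2) \<circ> (\<lambda>\<omega>. restrict (\<lambda>r. \<xi> r \<omega>) {s}) = (\<lambda>\<omega>. (\<xi> s \<omega>)\<^sup>2)"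
    by (auto simp: fun_eq_iff)
  also have "(\<lambda>x. (w x)\<^sup>2) \<circ> (\<lambda>\<omega>. restrict (\<lambda>r. \<xi> r \<omega>) ({..<N} - {s})) = (\<lambda>\<omega>. (W s \<omega>)\<^sup>2)"
    by (auto simp: fun_eq_iff w_def W_def u_out_def)
  finally have "expectation (\<lambda>\<omega>. (\<xi> s \<omega>)\<^sup>2 * (W s \<omega>)\<^sup>2)
      = expectation (\<lambda>\<omega>. (\<xi> s \<omega>)\<^sup>2) * expectation (\<lambda>\<omega>. (W s \<omega>)\<^sup>2)"
    using moments[OF assms] by (intro expectation_mult_indep) auto
  also have "\<dots> \<le> 2 * m\<^sup>2 * expectation (\<lambda>\<omega>. (W s \<omega>)\<^sup>2)"
    using moment_le[OF assms, of 2] by (intro mult_right_mono) auto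
  finally show ?thesis .
qed

text \<open>
  The coefficient \<open>W s\<close> of the linear term is independent of \<open>\<xi> s\<close>, but only \<open>V s\<close>, which uses the same
  vector of scores for every \<open>s\<close>, can be summed over \<open>s\<close> with the operator norm of \<open>G\<close>. Their
  difference is quadratic in the entries of \<open>G\<close>, as is the Taylor remainder, and such terms are
  controlled by the row and column norms of \<open>G\<close>.
\<close>

lemma expectation_diff_le:
  assumes "s < N"
  shows "expectation (\<lambda>\<omega>. (F \<omega> - F_out s \<omega>)\<^sup>2)
    \<le> 8 * m\<^sup>2 * (real k)\<^sup>2 * expectation (\<lambda>\<omega>. (V s \<omega>)\<^sup>2) + 3 * m\<^sup>2 * real k ^ 4 / T\<^sup>2 * expectation (P s)"
proof -
  let ?D = "\<lambda>\<omega>. F \<omega> - F_out s \<omega> - real k * \<xi> s \<omega> * W s \<omega>"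
  have iP: "integrable M (P s)" and iV: "integrable M (\<lambda>\<omega>. (V s \<omega>)\<^sup>2)" and iW: "integrable M (\<lambda>\<omega>. (W s \<omega>)\<^sup>2)"
    using assms by (auto intro!: all_moments_integrable)
  have ixW: "integrable M (\<lambda>\<omega>. (\<xi> s \<omega>)\<^sup>2 * (W s \<omega>)\<^sup>2)"
    using assms by (intro all_moments_integrable all_moments_mult all_moments_power moments moments_VW)
  have EP: "0 \<le> expectation (P s)"
    by (rule Bochner_Integration.integral_nonneg) (rule P_nonneg)
  have EW: "expectation (\<lambda>\<omega>. (W s \<omega>)\<^sup>2) \<le> 2 * expectation (\<lambda>\<omega>. (V s \<omega>)\<^sup>2) + (real k)\<^sup>2 / (2 * T\<^sup>2) * expectation (P s)"
  proof -
    have "(W s \<omega>)\<^sup>2 \<le> 2 * (V s \<omega>)\<^sup>2 + (real k)\<^sup>2 / (2 * T\<^sup>2) * P s \<omega>" for \<omega>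
      using square_add_le[of "V s \<omega>" "W s \<omega> - V s \<omega>"] V_diff_le[OF assms, of \<omega>]
      by (simp add: power2_commute[of "W s \<omega>"])
    then have "expectation (\<lambda>\<omega>. (W s \<omega>)\<^sup>2) \<le> expectation (\<lambda>\<omega>. 2 * (V s \<omega>)\<^sup>2 + (real k)\<^sup>2 / (2 * T\<^sup>2) * P s \<omega>)"
      using iW iV iP by (intro integral_mono) auto
    then show ?thesis using iV iP by simp
  qed
  have "(F \<omega> - F_out s \<omega>)\<^sup>2 \<le> 2 * (real k)\<^sup>2 * ((\<xi> s \<omega>)\<^sup>2 * (W s \<omega>)\<^sup>2) + real k ^ 4 / (8 * T\<^sup>2) * P s \<omega>" for \<omega>
    using square_add_le[of "real k * \<xi> s \<omega> * W s \<omega>" "?D \<omega>"] F_diff_le[OF assms, of \<omega>]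
    by (simp add: power_mult_distrib)
  then have "expectation (\<lambda>\<omega>. (F \<omega> - F_out s \<omega>)\<^sup>2)
      \<le> expectation (\<lambda>\<omega>. 2 * (real k)\<^sup>2 * ((\<xi> s \<omega>)\<^sup>2 * (W s \<omega>)\<^sup>2) + real k ^ 4 / (8 * T\<^sup>2) * P s \<omega>)"
    using ixW iP by (intro integral_mono all_moments_integrable_square all_moments_diff moments_F
        Bochner_Integration.integrable_add integrable_mult_right)
  also have "\<dots> = 2 * (real k)\<^sup>2 * expectation (\<lambda>\<omega>. (\<xi> s \<omega>)\<^sup>2 * (W s \<omega>)\<^sup>2) + real k ^ 4 / (8 * T\<^sup>2) * expectation (P s)"
    using ixW iP by simp
  also have "\<dots> \<le> 2 * (real k)\<^sup>2 * (2 * m\<^sup>2 * (2 * expectation (\<lambda>\<omega>. (V s \<omega>)\<^sup>2)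
      + (real k)\<^sup>2 / (2 * T\<^sup>2) * expectation (P s))) + real k ^ 4 / (8 * T\<^sup>2) * expectation (P s)"
    using order_trans[OF expectation_xi_W[OF assms] mult_left_mono[OF EW, of "2 * m\<^sup>2"]]
    by (intro add_right_mono mult_left_mono) auto
  also have "\<dots> = 8 * m\<^sup>2 * (real k)\<^sup>2 * expectation (\<lambda>\<omega>. (V s \<omega>)\<^sup>2)
      + (2 * m\<^sup>2 + 1 / 8) * (real k ^ 4 / T\<^sup>2 * expectation (P s))"
    using T_pos by (simp add: field_simps power2_eq_square power4_eq_xxxx)
  also have "\<dots> \<le> 8 * m\<^sup>2 * (real k)\<^sup>2 * expectation (\<lambda>\<omega>. (V s \<omega>)\<^sup>2)
      + 3 * m\<^sup>2 * (real k ^ 4 / T\<^sup>2 * expectation (P s))"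
    using one_le_power[OF m_ge_1, of 2] EP by (intro add_left_mono mult_right_mono) auto
  finally show ?thesis by simp
qed

text \<open>Deleting the variable \<open>s\<close> is the competitor in the Efron-Stein inequality.
  The linear terms contribute a multiple of p Q through the operator norm, the remainders p T^2 Q
  divided by T^2 through the rows and columns, hence a bound linear in \<open>p\<close>.\<close>

lemma variance_F_le:
  "expectation (\<lambda>\<omega>. (F \<omega>)\<^sup>2) - (expectation F)\<^sup>2 \<le> 5 * m\<^sup>2 * real k ^ 4 * real p * Q 1"
proof -
  define f where "f x = (\<Sum>j<p. hpoly (v j) (\<Sum>r<N. G j r * x r) k)" for x
  define h where "h s x = (\<Sum>j<p. hpoly (v j) (\<Sum>r\<in>{..<N} - {s}. G j r * x r) k)" for s x
  have f: "f (\<lambda>s\<in>{..<N}. \<xi> s \<omega>) = F \<omega>" and h: "h s (\<lambda>s\<in>{..<N}. \<xi> s \<omega>) = F_out s \<omega>" for \<omega> s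
    by (auto simp: f_def F_def u_def h_def F_out_def u_out_def)
  have "expectation (\<lambda>\<omega>. (F \<omega>)\<^sup>2) - (expectation F)\<^sup>2 \<le> (\<Sum>s<N. expectation (\<lambda>\<omega>. (F \<omega> - F_out s \<omega>)\<^sup>2))"
  proof (rule efron_stein_indep[OF N_pos, of f h, unfolded f h])
    show "f \<in> borel_measurable (\<Pi>\<^sub>M s\<in>{..<N}. borel)"
      unfolding f_def by measurable
    show "h s \<in> borel_measurable (\<Pi>\<^sub>M s\<in>{..<N}. borel)" for s
    proof -
      have [measurable]: "(\<lambda>x. x r) \<in> borel_measurable (\<Pi>\<^sub>M s\<in>{..<N}. borel)" if "r \<in> {..<N} - {s}" for r
        using that by simp
      show ?thesis unfolding h_def by measurable
    qed
    show "h s (x(s := y)) = h s x" for s x y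
      by (simp add: h_def)
  qed (auto intro!: all_moments_integrable_square)
  also have "\<dots> \<le> (\<Sum>s<N. 8 * m\<^sup>2 * (real k)\<^sup>2 * expectation (\<lambda>\<omega>. (V s \<omega>)\<^sup>2)
      + 3 * m\<^sup>2 * real k ^ 4 / T\<^sup>2 * expectation (P s))"
    by (intro sum_mono expectation_diff_le) simp
  also have "\<dots> = 8 * m\<^sup>2 * (real k)\<^sup>2 * (\<Sum>s<N. expectation (\<lambda>\<omega>. (V s \<omega>)\<^sup>2))
      + 3 * m\<^sup>2 * real k ^ 4 / T\<^sup>2 * (\<Sum>s<N. expectation (P s))"
    by (simp add: sum.distrib sum_distrib_left)
  also have "\<dots> \<le> 8 * m\<^sup>2 * (real k)\<^sup>2 * (real p * Q 1) + 3 * m\<^sup>2 * real k ^ 4 / T\<^sup>2 * (real p * T\<^sup>2 * Q 1)"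
  proof (intro add_mono mult_left_mono sum_expectation_P_le)
    have "(\<Sum>s<N. expectation (\<lambda>\<omega>. (V s \<omega>)\<^sup>2)) = expectation (\<lambda>\<omega>. \<Sum>s<N. (V s \<omega>)\<^sup>2)"
      by (subst Bochner_Integration.integral_sum) (auto intro!: all_moments_integrable_square)
    also have "\<dots> \<le> expectation (\<lambda>\<omega>. \<Sum>j<p. Z 0 j \<omega> ^ (2 * k))"
      using N_pos sum_V_le
      by (intro integral_mono all_moments_integrable all_moments_sum all_moments_power moments_VW moments_Z)
    also have "\<dots> = (\<Sum>j<p. expectation (\<lambda>\<omega>. Z 0 j \<omega> ^ (2 * k)))"
      using N_pos by (subst Bochner_Integration.integral_sum) (auto intro!: all_moments_integrable)
    also have "\<dots> \<le> (\<Sum>j<p. Q 1)"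
      using expectation_Z_le[OF N_pos] by (intro sum_mono) auto
    finally show "(\<Sum>s<N. expectation (\<lambda>\<omega>. (V s \<omega>)\<^sup>2)) \<le> real p * Q 1" by simp
  qed (use T_pos in auto)
  also have "\<dots> = m\<^sup>2 * real p * Q 1 * (8 * (real k)\<^sup>2 + 3 * real k ^ 4)"
    using T_pos by (simp add: field_simps)
  also have "\<dots> \<le> m\<^sup>2 * real p * Q 1 * (5 * real k ^ 4)"
  proof (intro mult_left_mono)
    have "4 * (real k)\<^sup>2 \<le> (real k)\<^sup>2 * (real k)\<^sup>2"
      using power_mono[of 2 "real k" 2] k_ge_2 by (intro mult_right_mono) auto
    then show "8 * (real k)\<^sup>2 + 3 * real k ^ 4 \<le> 5 * real k ^ 4"
      by (simp add: power2_eq_square power4_eq_xxxx)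
  qed (use Q_nonneg in auto)
  finally show ?thesis by (simp add: mult_ac)
qed

text \<open>The \<open>h j\<close> are controlled in mean square only, and a single one may be as
  large as sqrt p T, so they cannot enter the envelope. The part linear in \<open>h\<close> is
  summed by Cauchy-Schwarz, the part of degree \<open>k\<close> by
  \<open>sum_power_square_le\<close>. The factor \<open>sqrt r * T\<close> brings
  \<open>\<delta>\<close> to the size of the scores.\<close>

lemma shift_pointwise_le:
  fixes \<delta> r :: real and h :: "nat \<Rightarrow> real" and \<omega> :: 'a
  assumes "0 < r" "0 < p" and h2: "(\<Sum>j<p. (h j)\<^sup>2) \<le> real p * T\<^sup>2"
  defines "Y \<equiv> \<lambda>j. sqrt r * T * \<bar>\<delta>\<bar> + \<bar>u j \<omega>\<bar> + c"
  shows "(\<Sum>j<p. hpoly (v j) (u j \<omega> + \<delta> * h j) k - hpoly (v j) (u j \<omega>) k)\<^sup>2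
    \<le> (real k)\<^sup>2 * 4 ^ k * (real p / r * (\<Sum>j<p. Y j ^ (2 * k)) + (real p / r) ^ k * Y 0 ^ (2 * k))"
proof -
  define b where "b j = (\<bar>u j \<omega>\<bar> + c) ^ (k - 1)" for j
  let ?d = "sqrt r * T * \<bar>\<delta>\<bar>"
  have d0: "0 \<le> ?d" using assms(1) T_pos by simp
  have b0: "0 \<le> b j" for j using c_props(1) by (simp add: b_def)
  have term_le: "\<bar>hpoly (v j) (u j \<omega> + \<delta> * h j) k - hpoly (v j) (u j \<omega>) k\<bar>
      \<le> real k * 2 ^ (k - 1) * (\<bar>\<delta>\<bar> * (\<bar>h j\<bar> * b j) + \<bar>\<delta> * h j\<bar> ^ k)" if j: "j < p" for j
  proof -
    let ?x = "\<bar>\<delta> * h j\<bar>"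
    have "\<bar>hpoly (v j) (u j \<omega> + \<delta> * h j) k - hpoly (v j) (u j \<omega>) k\<bar>
        \<le> ?x * (real k * (\<bar>u j \<omega>\<bar> + ?x + c) ^ (k - 1))"
      using v_nonneg[OF j] c_props j by (intro abs_hpoly_diff_le[where k=k]) auto
    also have "(\<bar>u j \<omega>\<bar> + ?x + c) ^ (k - 1) = ((\<bar>u j \<omega>\<bar> + c) + ?x) ^ (k - 1)"
      by (simp add: algebra_simps)
    also have "?x * (real k * ((\<bar>u j \<omega>\<bar> + c) + ?x) ^ (k - 1))
        \<le> ?x * (real k * (2 ^ (k - 1) * (b j + ?x ^ (k - 1))))"
      unfolding b_def using c_props(1) by (intro mult_left_mono power_sum_le_max) auto
    also have "\<dots> = real k * 2 ^ (k - 1) * (?x * b j + ?x * ?x ^ (k - 1))"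
      by (simp add: algebra_simps)
    also have "?x * ?x ^ (k - 1) = ?x ^ k"
      using power_split[of 1 k ?x] k_ge_2 by simp
    also have "?x * b j = \<bar>\<delta>\<bar> * (\<bar>h j\<bar> * b j)"
      by (simp add: abs_mult)
    finally show ?thesis .
  qed
  have "\<bar>\<Sum>j<p. hpoly (v j) (u j \<omega> + \<delta> * h j) k - hpoly (v j) (u j \<omega>) k\<bar>
      \<le> (\<Sum>j<p. real k * 2 ^ (k - 1) * (\<bar>\<delta>\<bar> * (\<bar>h j\<bar> * b j) + \<bar>\<delta> * h j\<bar> ^ k))"
    using term_le by (intro order_trans[OF sum_abs sum_mono]) auto
  also have "\<dots> = real k * 2 ^ (k - 1) * (\<bar>\<delta>\<bar> * (\<Sum>j<p. \<bar>h j\<bar> * b j) + (\<Sum>j<p. \<bar>\<delta> * h j\<bar> ^ k))"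
    by (simp only: sum_distrib_left[symmetric] sum.distrib)
  finally have "\<bar>\<Sum>j<p. hpoly (v j) (u j \<omega> + \<delta> * h j) k - hpoly (v j) (u j \<omega>) k\<bar>\<^sup>2
      \<le> (real k * 2 ^ (k - 1) * (\<bar>\<delta>\<bar> * (\<Sum>j<p. \<bar>h j\<bar> * b j) + (\<Sum>j<p. \<bar>\<delta> * h j\<bar> ^ k)))\<^sup>2"
    by (rule power_mono) simp
  also have "\<dots> = (real k)\<^sup>2 * 4 ^ (k - 1) * (\<bar>\<delta>\<bar> * (\<Sum>j<p. \<bar>h j\<bar> * b j) + (\<Sum>j<p. \<bar>\<delta> * h j\<bar> ^ k))\<^sup>2"
    by (simp add: power_mult_distrib power_mult[symmetric] mult.commute[of _ 2]) (simp add: power_mult)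
  also have "\<dots> \<le> (real k)\<^sup>2 * 4 ^ (k - 1) *
      (2 * (\<bar>\<delta>\<bar> * (\<Sum>j<p. \<bar>h j\<bar> * b j))\<^sup>2 + 2 * (\<Sum>j<p. \<bar>\<delta> * h j\<bar> ^ k)\<^sup>2)"
    by (intro mult_left_mono square_add_le) auto
  also have "\<dots> \<le> (real k)\<^sup>2 * 4 ^ (k - 1) *
      (2 * (real p / r * (\<Sum>j<p. Y j ^ (2 * k))) + 2 * ((real p / r) ^ k * Y 0 ^ (2 * k)))"
  proof (intro mult_left_mono add_mono)
    have "(\<bar>\<delta>\<bar> * (\<Sum>j<p. \<bar>h j\<bar> * b j))\<^sup>2 \<le> \<delta>\<^sup>2 * ((\<Sum>j<p. \<bar>h j\<bar>\<^sup>2) * (\<Sum>j<p. (b j)\<^sup>2))"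
      unfolding power_mult_distrib power2_abs by (intro mult_left_mono Cauchy_Schwarz_ineq_sum[of "\<lambda>j. \<bar>h j\<bar>", unfolded power2_abs]) auto
    also have "\<dots> \<le> \<delta>\<^sup>2 * ((real p * T\<^sup>2) * (\<Sum>j<p. (b j)\<^sup>2))"
      using h2 by (intro mult_left_mono mult_right_mono) (auto intro!: sum_nonneg)
    also have "\<dots> = real p / r * (\<Sum>j<p. (?d * b j)\<^sup>2)"
      using assms(1) by (simp add: power_mult_distrib sum_distrib_left field_simps)
    also have "\<dots> \<le> real p / r * (\<Sum>j<p. Y j ^ (2 * k))"
    proof (intro mult_left_mono sum_mono)
      fix j
      have "?d * b j \<le> Y j * Y j ^ (k - 1)"
        unfolding b_def Y_def using d0 c_props(1) by (intro mult_mono power_mono) auto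
      also have "\<dots> = Y j ^ k" using power_split[of 1 k "Y j"] k_ge_2 by simp
      finally have "(?d * b j)\<^sup>2 \<le> (Y j ^ k)\<^sup>2"
        using d0 b0 by (intro power_mono) auto
      then show "(?d * b j)\<^sup>2 \<le> Y j ^ (2 * k)" by (simp add: power_mult[symmetric] mult.commute)
    qed (use assms(1) in auto)
    finally show "(\<bar>\<delta>\<bar> * (\<Sum>j<p. \<bar>h j\<bar> * b j))\<^sup>2 \<le> real p / r * (\<Sum>j<p. Y j ^ (2 * k))" .
  next
    have "(\<Sum>j<p. \<bar>\<delta> * h j\<bar> ^ k)\<^sup>2 \<le> (\<Sum>j<p. \<bar>\<delta> * h j\<bar>\<^sup>2) ^ k"
      using k_ge_2 by (intro sum_power_square_le) auto
    also have "(\<Sum>j<p. \<bar>\<delta> * h j\<bar>\<^sup>2) = \<delta>\<^sup>2 * (\<Sum>j<p. (h j)\<^sup>2)"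
      by (simp add: power_mult_distrib sum_distrib_left)
    also have "(\<delta>\<^sup>2 * (\<Sum>j<p. (h j)\<^sup>2)) ^ k \<le> (\<delta>\<^sup>2 * (real p * T\<^sup>2)) ^ k"
      using h2 by (intro power_mono mult_left_mono mult_nonneg_nonneg sum_nonneg) auto
    also have "\<delta>\<^sup>2 * (real p * T\<^sup>2) = real p / r * ?d\<^sup>2"
      using assms(1) by (simp add: power_mult_distrib)
    also have "(real p / r * ?d\<^sup>2) ^ k = (real p / r) ^ k * ?d ^ (2 * k)"
      unfolding power_mult_distrib[of "real p / r"] by (simp only: power_mult[symmetric])
    also have "\<dots> \<le> (real p / r) ^ k * Y 0 ^ (2 * k)"
      using assms(1) d0 c_props(1) by (intro mult_left_mono power_mono) (auto simp: Y_def)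
    finally show "(\<Sum>j<p. \<bar>\<delta> * h j\<bar> ^ k)\<^sup>2 \<le> (real p / r) ^ k * Y 0 ^ (2 * k)" .
  qed auto
  also have "\<dots> = (real k)\<^sup>2 * (2 * 4 ^ (k - 1)) *
      (real p / r * (\<Sum>j<p. Y j ^ (2 * k)) + (real p / r) ^ k * Y 0 ^ (2 * k))"
    by (simp add: algebra_simps)
  also have "\<dots> \<le> (real k)\<^sup>2 * 4 ^ k *
      (real p / r * (\<Sum>j<p. Y j ^ (2 * k)) + (real p / r) ^ k * Y 0 ^ (2 * k))"
  proof (intro mult_right_mono mult_left_mono)
    show "2 * 4 ^ (k - 1) \<le> (4::real) ^ k"
      using power_split[of 1 k "4::real"] k_ge_2 by simp
    show "0 \<le> real p / r * (\<Sum>j<p. Y j ^ (2 * k)) + (real p / r) ^ k * Y 0 ^ (2 * k)"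
      using assms(1) d0 c_props(1)
      by (intro add_nonneg_nonneg mult_nonneg_nonneg sum_nonneg zero_le_power) (auto simp: Y_def)
  qed auto
  finally show ?thesis by simp
qed

lemma expectation_shift_square_le:
  assumes "0 < r" "0 < p" "(\<Sum>j<p. (h j)\<^sup>2) \<le> real p * T\<^sup>2" "1 \<le> \<kappa>" "L2_set a {..<N} \<le> \<kappa> / sqrt r"
  defines "\<delta> \<equiv> \<lambda>\<omega>. \<Sum>s<N. a s * \<xi> s \<omega>"
  shows "expectation (\<lambda>\<omega>. (\<Sum>j<p. hpoly (v j) (u j \<omega> + \<delta> \<omega> * h j) k - hpoly (v j) (u j \<omega>) k)\<^sup>2)
    \<le> (real k)\<^sup>2 * 4 ^ k * ((real p)\<^sup>2 / r + (real p / r) ^ k) * Q \<kappa>"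
proof -
  let ?Y = "\<lambda>j \<omega>. (sqrt r * T * \<bar>\<delta> \<omega>\<bar> + \<bar>u j \<omega>\<bar> + c) ^ (2 * k)"
  have md: "all_moments M \<delta>" unfolding \<delta>_def by auto
  have mY: "all_moments M (?Y j)" for j
    by (intro all_moments_power all_moments_add all_moments_mult all_moments_abs all_moments_const md moments_u)
  have EY: "expectation (?Y j) \<le> Q \<kappa>" if "j < p" for j
    unfolding \<delta>_def using assms that by (intro expectation_shift_le) auto
  have "expectation (\<lambda>\<omega>. (\<Sum>j<p. hpoly (v j) (u j \<omega> + \<delta> \<omega> * h j) k - hpoly (v j) (u j \<omega>) k)\<^sup>2)
      \<le> expectation (\<lambda>\<omega>. (real k)\<^sup>2 * 4 ^ k * (real p / r * (\<Sum>j<p. ?Y j \<omega>) + (real p / r) ^ k * ?Y 0 \<omega>))"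
  proof (rule integral_mono)
    show "integrable M (\<lambda>\<omega>. (\<Sum>j<p. hpoly (v j) (u j \<omega> + \<delta> \<omega> * h j) k - hpoly (v j) (u j \<omega>) k)\<^sup>2)"
      by (intro all_moments_integrable_square all_moments_sum all_moments_diff all_moments_hpoly all_moments_add
          all_moments_mult all_moments_const md moments_u)
    show "integrable M (\<lambda>\<omega>. (real k)\<^sup>2 * 4 ^ k * (real p / r * (\<Sum>j<p. ?Y j \<omega>) + (real p / r) ^ k * ?Y 0 \<omega>))"
      by (intro all_moments_integrable all_moments_add all_moments_mult all_moments_const all_moments_sum mY)
  qed (rule shift_pointwise_le[OF assms(1-3)])
  also have "\<dots> = (real k)\<^sup>2 * 4 ^ k * (real p / r * (\<Sum>j<p. expectation (?Y j)) + (real p / r) ^ k * expectation (?Y 0))"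
    using mY by (simp add: all_moments_integrable)
  also have "\<dots> \<le> (real k)\<^sup>2 * 4 ^ k * (real p / r * (\<Sum>j<p. Q \<kappa>) + (real p / r) ^ k * Q \<kappa>)"
    using assms(1,2) EY by (intro mult_left_mono add_mono sum_mono) auto
  also have "\<dots> = (real k)\<^sup>2 * 4 ^ k * ((real p)\<^sup>2 / r + (real p / r) ^ k) * Q \<kappa>"
    by (simp add: algebra_simps power2_eq_square)
  finally show ?thesis .
qed

end

section \<open>The multinomial expansion\<close>

text \<open>In contrast to the sum in \<open>mu_hat\<close> this includes the one-part composition
  \<open>[k]\<close>, the term that carries the moment of order \<open>k\<close>.\<close>

definition comps :: "nat \<Rightarrow> nat list set" where
  "comps k = {ds. sum_list ds = k \<and> (\<forall>d\<in>set ds. 2 \<le> d)}"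

definition chains :: "nat \<Rightarrow> nat \<Rightarrow> nat list set" where
  "chains t m = {ss. length ss = t \<and> sorted_wrt (<) ss \<and> set ss \<subseteq> {..<m}}"

text \<open>
  The coefficient of \<open>z ^ k\<close> in the product over \<open>s < m\<close> of \<open>1 + c s 2 * z ^ 2 + c s 3 * z ^ 3 + \<dots>\<close>.
\<close>

definition chain_sum :: "(nat \<Rightarrow> nat \<Rightarrow> real) \<Rightarrow> nat \<Rightarrow> nat \<Rightarrow> real" where
  "chain_sum c m k = (\<Sum>ds\<in>comps k. \<Sum>ss\<in>chains (length ds) m. \<Prod>i<length ds. c (ss ! i) (ds ! i))"

lemma length_le_sum_list: "\<forall>d\<in>set ds. 2 \<le> d \<Longrightarrow> length ds \<le> sum_list (ds :: nat list)"
  by (induction ds) auto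

lemma comps_subset: "comps k \<subseteq> {ds. set ds \<subseteq> {..k} \<and> length ds \<le> k}"
  unfolding comps_def using member_le_sum_list length_le_sum_list by fastforce

lemma finite_comps: "finite (comps k)"
  by (rule finite_subset[OF comps_subset finite_lists_length_le]) simp

lemma finite_chains: "finite (chains t m)"
  by (rule finite_subset[OF _ finite_lists_length_eq[of "{..<m}" t]]) (auto simp: chains_def)

lemma comps_0: "comps 0 = {[]}"
  unfolding comps_def by (auto, metis list.set_intros(1) neq_Nil_conv not_numeral_le_zero)

text \<open>An increasing tuple can contain the new largest index only as its last entry.\<close>

lemma chains_Suc:
  "chains (Suc t) (Suc m) = chains (Suc t) m \<union> (\<lambda>ss. ss @ [m]) ` chains t m"
proof (intro equalityI subsetI)
  fix ss assume "ss \<in> chains (Suc t) (Suc m)"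
  then have ss: "length ss = Suc t" "sorted_wrt (<) ss" "set ss \<subseteq> {..<Suc m}"
    by (auto simp: chains_def)
  then obtain us x where us: "ss = us @ [x]"
    by (metis Zero_not_Suc list.size(3) rev_exhaust)
  have lt: "\<forall>y\<in>set us. y < x"
    using ss(2) us by (auto simp: sorted_wrt_append)
  show "ss \<in> chains (Suc t) m \<union> (\<lambda>ss. ss @ [m]) ` chains t m"
  proof (cases "x = m")
    case True
    then have "us \<in> chains t m"
      using ss lt us by (auto simp: chains_def sorted_wrt_append)
    then show ?thesis using us True by auto
  next
    case False
    then have "x < m" using ss us by auto
    then have "ss \<in> chains (Suc t) m"
      using ss lt us by (auto simp: chains_def)
    then show ?thesis by simp
  qed
qed (auto simp: chains_def sorted_wrt_append)

lemma comps_snoc: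
  "{ds \<in> comps k. ds \<noteq> []} = (\<Union>d\<in>{2..k}. (\<lambda>ds. ds @ [d]) ` comps (k - d))"
proof (intro equalityI subsetI)
  fix ds assume ds: "ds \<in> {ds \<in> comps k. ds \<noteq> []}"
  then obtain es d where es: "ds = es @ [d]" by (metis (mono_tags, lifting) mem_Collect_eq rev_exhaust)
  then have "es \<in> comps (k - d)" "d \<in> {2..k}"
    using ds by (auto simp: comps_def)
  then show "ds \<in> (\<Union>d\<in>{2..k}. (\<lambda>ds. ds @ [d]) ` comps (k - d))"
    using es by auto
qed (auto simp: comps_def)

text \<open>The generating product acquires the factor of index \<open>m\<close>: a chain that ends
  in \<open>m\<close> matches the last part \<open>d\<close> with that index. For
  \<open>k \<ge> 1\<close> no composition is empty, so a last part exists.\<close>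

lemma chain_sum_Suc:
  assumes "1 \<le> k"
  shows "chain_sum c (Suc m) k = chain_sum c m k + (\<Sum>d=2..k. c m d * chain_sum c m (k - d))"
proof -
  let ?w = "\<lambda>ds ss. \<Prod>i<length ds. c (ss ! i) (ds ! i)"
  have ne: "ds \<noteq> []" if "ds \<in> comps k" for ds
    using assms that by (auto simp: comps_def)
  have eq: "comps k = (\<Union>d\<in>{2..k}. (\<lambda>ds. ds @ [d]) ` comps (k - d))"
    unfolding comps_snoc[symmetric] using ne by blast
  have split: "(\<Sum>ss\<in>chains (length ds) (Suc m). ?w ds ss)
      = (\<Sum>ss\<in>chains (length ds) m. ?w ds ss)
        + (\<Sum>ss\<in>chains (length ds - 1) m. ?w ds (ss @ [m]))" if ds: "ds \<in> comps k" for ds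
  proof -
    obtain t where t: "length ds = Suc t"
      using ne[OF ds] by (cases "length ds") auto
    have "chains (Suc t) m \<inter> (\<lambda>ss. ss @ [m]) ` chains t m = {}"
      by (auto simp: chains_def)
    then show ?thesis
      unfolding t chains_Suc
      by (subst sum.union_disjoint) (auto simp: finite_chains sum.reindex inj_on_def)
  qed
  have "chain_sum c (Suc m) k
      = chain_sum c m k + (\<Sum>ds\<in>comps k. \<Sum>ss\<in>chains (length ds - 1) m. ?w ds (ss @ [m]))"
    unfolding chain_sum_def by (simp add: split sum.distrib)
  also have "(\<Sum>ds\<in>comps k. \<Sum>ss\<in>chains (length ds - 1) m. ?w ds (ss @ [m]))
      = (\<Sum>ds\<in>(\<Union>d\<in>{2..k}. (\<lambda>ds. ds @ [d]) ` comps (k - d)). \<Sum>ss\<in>chains (length ds - 1) m. ?w ds (ss @ [m]))"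
    by (rule sum.cong[OF eq refl])
  also have "\<dots> = (\<Sum>d=2..k. \<Sum>ds\<in>(\<lambda>ds. ds @ [d]) ` comps (k - d). \<Sum>ss\<in>chains (length ds - 1) m. ?w ds (ss @ [m]))"
    by (rule sum.UNION_disjoint) (auto simp: finite_comps)
  also have "\<dots> = (\<Sum>d=2..k. \<Sum>ds\<in>comps (k - d). \<Sum>ss\<in>chains (length ds) m. ?w (ds @ [d]) (ss @ [m]))"
    by (simp add: sum.reindex inj_on_def)
  also have "\<dots> = (\<Sum>d=2..k. c m d * chain_sum c m (k - d))"
  proof (rule sum.cong[OF refl])
    fix d
    have "?w (ds @ [d]) (ss @ [m]) = c m d * ?w ds ss" if "ss \<in> chains (length ds) m" for ds ss
    proof -
      have "length ss = length ds" using that by (simp add: chains_def)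
      then show ?thesis by (simp add: nth_append mult.commute)
    qed
    then show "(\<Sum>ds\<in>comps (k - d). \<Sum>ss\<in>chains (length ds) m. ?w (ds @ [d]) (ss @ [m])) = c m d * chain_sum c m (k - d)"
      unfolding chain_sum_def by (simp add: sum_distrib_left)
  qed
  finally show ?thesis .
qed

lemma chains_0: "chains t 0 = (if t = 0 then {[]} else {})"
  by (auto simp: chains_def)

lemma chains_zero: "chains 0 m = {[]}"
  by (auto simp: chains_def)

lemma chain_sum_0: "chain_sum c m 0 = 1"
  by (simp add: chain_sum_def comps_0 chains_zero)

lemma chain_sum_no_index: "1 \<le> k \<Longrightarrow> chain_sum c 0 k = 0"
  unfolding chain_sum_def by (rule sum.neutral) (auto simp: chains_0 comps_def)

section \<open>Normal moments and the mean of a Hermite polynomial of a linear form\<close>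

lemma hpoly_gauss_even: "hpoly (-1) 0 (2 * k) = fact (2 * k) / (2 ^ k * fact k)"
proof (induction k)
  case (Suc k)
  have "hpoly (-1) 0 (2 * Suc k) = real (Suc (2 * k)) * hpoly (-1) 0 (2 * k)"
    by (simp add: algebra_simps)
  also have "\<dots> = fact (2 * Suc k) / (2 ^ Suc k * fact (Suc k))"
  proof -
    have 1: "(fact (2 * Suc k) :: real) = 2 * real (Suc k) * real (Suc (2 * k)) * fact (2 * k)"
      by (simp add: algebra_simps)
    have 2: "b * (x / (y * z)) = 2 * a * b * x / (2 * y * (a * z))" if "a \<noteq> 0" for a b x y z :: real
      using that by simp
    show ?thesis
      unfolding Suc 1 fact_Suc[of k] power_Suc of_nat_mult by (rule 2) simp
  qed
  finally show ?case .
qed simp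

lemma hpoly_gauss_odd: "hpoly (-1) 0 (2 * k + 1) = 0"
  by (induction k) auto

text \<open>This is \<open>moment_le\<close> of \<open>indep_system\<close> for the standardised
  noise, with \<open>m = 1\<close>.\<close>

lemma abs_hpoly_gauss_le: "\<bar>hpoly (-1) 0 d\<bar> \<le> fact d"
proof (induction d rule: less_induct)
  case (less d)
  show ?case
  proof (cases d)
    case (Suc j)
    show ?thesis
    proof (cases j)
      case (Suc i)
      have "\<bar>hpoly (-1) 0 i\<bar> \<le> fact i" using less \<open>d = Suc j\<close> Suc by auto
      then have "real j * \<bar>hpoly (-1) 0 i\<bar> \<le> real j * fact i"
        by (rule mult_left_mono) simp
      also have "\<dots> \<le> real (Suc j) * (real j * fact i)"
        using mult_right_mono[of 1 "real (Suc j)" "real j * fact i"] by simp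
      finally have "real j * \<bar>hpoly (-1) 0 i\<bar> \<le> real (Suc j) * (real j * fact i)" .
      moreover have "\<bar>hpoly (-1) 0 d\<bar> = real j * \<bar>hpoly (-1) 0 i\<bar>"
        and "fact d = real (Suc j) * (real j * fact i)"
        using Suc \<open>d = Suc j\<close> by (simp_all add: abs_mult)
      ultimately show ?thesis by (simp only:)
    qed (use Suc in simp)
  qed simp
qed

lemma gauss_moments:
  fixes \<sigma> :: real
  assumes "0 < \<sigma>"
  defines "G \<equiv> density lborel (\<lambda>x. ennreal (normal_density 0 \<sigma> x))"
  shows "integrable G (\<lambda>x. \<bar>x / \<sigma>\<bar> ^ d)" and "(\<integral>x. (x / \<sigma>) ^ d \<partial>G) = hpoly (-1) 0 d"
proof -
  have G: "integrable G f \<longleftrightarrow> integrable lborel (\<lambda>x. normal_density 0 \<sigma> x * f x)"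
    "(\<integral>x. f x \<partial>G) = (\<integral>x. normal_density 0 \<sigma> x * f x \<partial>lborel)"
    if "f \<in> borel_measurable borel" for f :: "real \<Rightarrow> real"
    unfolding G_def using that by (auto simp: integrable_density integral_density)
  have "integrable lborel (\<lambda>x. normal_density 0 \<sigma> x * \<bar>x - 0\<bar> ^ d)"
    by (rule integrable_normal_moment_abs[OF assms(1)])
  then have "integrable lborel (\<lambda>x. (normal_density 0 \<sigma> x * \<bar>x - 0\<bar> ^ d) / \<sigma> ^ d)"
    by (rule integrable_divide)
  then show "integrable G (\<lambda>x. \<bar>x / \<sigma>\<bar> ^ d)"
    using assms(1) by (subst G) (auto simp: power_divide abs_divide)
  have "(\<integral>x. (x / \<sigma>) ^ d \<partial>G) = (\<integral>x. normal_density 0 \<sigma> x * (x - 0) ^ d \<partial>lborel) / \<sigma> ^ d"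
    by (subst G) (auto simp: power_divide)
  also have "\<dots> = hpoly (-1) 0 d"
  proof (cases "even d")
    case True
    then obtain k where d: "d = 2 * k" by (elim evenE)
    have "(\<integral>x. normal_density 0 \<sigma> x * (x - 0) ^ (2 * k) \<partial>lborel) = fact (2 * k) / ((2 / \<sigma>\<^sup>2) ^ k * fact k)"
      by (rule has_bochner_integral_integral_eq[OF normal_moment_even[OF assms(1)]])
    moreover have "(2 / \<sigma>\<^sup>2) ^ k = 2 ^ k / \<sigma> ^ (2 * k)"
      by (simp add: power_divide power_mult)
    ultimately show ?thesis
      unfolding d hpoly_gauss_even using assms(1) by simp
  next
    case False
    then obtain k where d: "d = 2 * k + 1" by (elim oddE)
    have "(\<integral>x. normal_density 0 \<sigma> x * (x - 0) ^ (2 * k + 1) \<partial>lborel) = 0"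
      by (rule has_bochner_integral_integral_eq[OF normal_moment_odd[OF assms(1)]])
    then show ?thesis unfolding d hpoly_gauss_odd by simp
  qed
  finally show "(\<integral>x. (x / \<sigma>) ^ d \<partial>G) = hpoly (-1) 0 d" .
qed

context indep_system
begin

text \<open>The moments of \<open>a\<close> times a standard normal variable are
  \<open>hpoly\<close> with variance -a^2 at \<open>0\<close>, so by \<open>hpoly_add\<close> every
  noise variable lowers \<open>v\<close> by its squared coefficient. If \<open>v\<close> is the
  whole noise variance, only \<open>0 ^ k\<close> is left.\<close>

lemma expectation_hpoly_gauss:
  assumes "n \<le> N" "\<And>s l. s < n \<Longrightarrow> expectation (\<lambda>x. \<xi> s x ^ l) = hpoly (-1) 0 l"
  shows "expectation (\<lambda>x. hpoly v (\<Sum>s<n. a s * \<xi> s x) k) = hpoly (v - (\<Sum>s<n. (a s)\<^sup>2)) 0 k"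
  using assms
proof (induction n arbitrary: k)
  case 0
  then show ?case by (simp add: prob_space)
next
  case (Suc n)
  have "expectation (\<lambda>x. hpoly v (\<Sum>s<Suc n. a s * \<xi> s x) k)
      = binomial_conv (\<lambda>l. a n ^ l * expectation (\<lambda>x. \<xi> n x ^ l))
          (\<lambda>l. expectation (\<lambda>x. hpoly v (\<Sum>s<n. a s * \<xi> s x) l)) k"
    using expectation_hpoly_insert[of "{..<n}" n v a k] Suc.prems(1)
    by (simp only: lessThan_Suc) auto
  also have "(\<lambda>l. a n ^ l * expectation (\<lambda>x. \<xi> n x ^ l)) = hpoly ((a n)\<^sup>2 * (-1)) (a n * 0)"
    by (rule ext) (simp only: hpoly_scale Suc.prems(2)[OF lessI])
  also have "(\<lambda>l. expectation (\<lambda>x. hpoly v (\<Sum>s<n. a s * \<xi> s x) l)) = hpoly (v - (\<Sum>s<n. (a s)\<^sup>2)) 0"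
    using Suc by auto
  finally show ?case
    unfolding hpoly_add[symmetric] by (simp add: algebra_simps)
qed

text \<open>Divided by k!, the expectation is the coefficient of z^k in the product of the (formal)
  moment generating functions of the summands; \<open>base\<close> says that the first
  \<open>n\<close> variables contribute the factor 1. The other factors have no term of degree 1,
  since the variables are centred, which is why all parts are at least 2.\<close>

lemma expectation_hpoly_chain:
  assumes "n + m' \<le> N" and base: "\<And>k. expectation (\<lambda>x. hpoly v (\<Sum>s<n. a s * \<xi> s x) k) = 0 ^ k"
    and \<nu>: "\<And>j l. j < m' \<Longrightarrow> expectation (\<lambda>x. \<xi> (n + j) x ^ l) = \<nu> l"
  shows "expectation (\<lambda>x. hpoly v (\<Sum>s<n + m'. a s * \<xi> s x) k)
    = fact k * chain_sum (\<lambda>s d. a (n + s) ^ d * \<nu> d / fact d) m' k"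
  using assms(1,3)
proof (induction m' arbitrary: k)
  case 0
  show ?case
    using base[of k] by (cases k) (simp_all add: chain_sum_0 chain_sum_no_index del: hpoly.simps)
next
  case (Suc j)
  let ?c = "\<lambda>s d. a (n + s) ^ d * \<nu> d / fact d"
  let ?f = "\<lambda>l. ?c j l * chain_sum ?c j (k - l)"
  have \<nu>0: "\<nu> 0 = 1" and \<nu>1: "\<nu> 1 = 0"
    using Suc.prems(2)[of j 0] Suc.prems(2)[of j 1] mean_0[of "n + j"] Suc.prems(1)
    by (simp_all add: prob_space)
  have "expectation (\<lambda>x. hpoly v (\<Sum>s<n + Suc j. a s * \<xi> s x) k)
      = binomial_conv (\<lambda>l. a (n + j) ^ l * \<nu> l)
          (\<lambda>l. expectation (\<lambda>x. hpoly v (\<Sum>s<n + j. a s * \<xi> s x) l)) k"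
    using expectation_hpoly_insert[of "{..<n + j}" "n + j" v a k] Suc.prems
    by (simp only: lessThan_Suc add_Suc_right) auto
  also have "\<dots> = binomial_conv (\<lambda>l. a (n + j) ^ l * \<nu> l) (\<lambda>l. fact l * chain_sum ?c j l) k"
    using Suc by simp
  also have "\<dots> = (\<Sum>l\<le>k. fact k * ?f l)"
    unfolding binomial_conv_def
  proof (rule sum.cong[OF refl])
    fix l assume "l \<in> {..k}"
    then have "fact k = fact l * fact (k - l) * real (k choose l)"
      using binomial_fact_lemma[of l k] by (metis atMost_iff of_nat_fact of_nat_mult)
    then show "real (k choose l) * (a (n + j) ^ l * \<nu> l) * (fact (k - l) * chain_sum ?c j (k - l)) = fact k * ?f l"
      by simp
  qed
  also have "\<dots> = fact k * (\<Sum>l\<le>k. ?f l)"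
    by (rule sum_distrib_left[symmetric])
  also have "(\<Sum>l\<le>k. ?f l) = (\<Sum>l\<in>insert 0 {2..k}. ?f l)"
  proof (rule sum.mono_neutral_right)
    have "l = 1" if "l \<in> {..k} - insert 0 {2..k}" for l
      using that by auto
    then show "\<forall>l\<in>{..k} - insert 0 {2..k}. ?f l = 0"
      using \<nu>1 by fastforce
  qed auto
  also have "\<dots> = chain_sum ?c (Suc j) k"
    by (cases k) (simp_all add: \<nu>0 chain_sum_Suc chain_sum_0)
  finally show ?case .
qed

end

section \<open>Operator norm and Gram matrix\<close>

lemma mat_vec_scale: "mat_vec p X (\<lambda>j. c * v j) = (\<lambda>l. c * mat_vec p X v l)"
  by (simp add: mat_vec_def sum_distrib_left mult_ac)

text \<open>Makes the set under the \<open>SUP\<close> of \<open>op_norm\<close> bounded, without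
  which a real supremum says nothing; the bound itself is crude.\<close>

lemma mat_vec_bounded: "L2_set v {..<p} \<le> 1 \<Longrightarrow> L2_set (mat_vec p X v) {..<n} \<le> (\<Sum>l<n. L2_set (X l) {..<p})"
proof -
  assume v: "L2_set v {..<p} \<le> 1"
  have "L2_set (mat_vec p X v) {..<n} \<le> (\<Sum>l<n. \<bar>mat_vec p X v l\<bar>)"
    by (rule L2_set_le_sum_abs)
  also have "\<dots> \<le> (\<Sum>l<n. L2_set (X l) {..<p})"
  proof (rule sum_mono)
    fix l
    have "\<bar>mat_vec p X v l\<bar> \<le> (\<Sum>j<p. \<bar>X l j\<bar> * \<bar>v j\<bar>)"
      unfolding mat_vec_def by (rule order_trans[OF sum_abs]) (simp add: abs_mult)
    also have "\<dots> \<le> L2_set (X l) {..<p} * L2_set v {..<p}"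
      by (rule L2_set_mult_ineq)
    also have "\<dots> \<le> L2_set (X l) {..<p}"
      using v mult_left_mono[OF v, of "L2_set (X l) {..<p}"] by (simp add: L2_set_nonneg)
    finally show "\<bar>mat_vec p X v l\<bar> \<le> L2_set (X l) {..<p}" .
  qed
  finally show ?thesis .
qed

lemma op_norm_bound: "L2_set (mat_vec p X v) {..<n} \<le> op_norm n p X * L2_set v {..<p}"
proof -
  have bdd: "bdd_above ((\<lambda>v. L2_set (mat_vec p X v) {..<n}) ` {v. L2_set v {..<p} \<le> 1})"
    using mat_vec_bounded by (intro bdd_aboveI2) blast
  show ?thesis
  proof (cases "L2_set v {..<p} = 0")
    case True
    then have "\<forall>j<p. v j = 0" by (simp add: L2_set_eq_0_iff)
    then have "L2_set (mat_vec p X v) {..<n} = 0"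
      by (simp add: mat_vec_def L2_set_def)
    then show ?thesis using True by simp
  next
    case False
    define a where "a = L2_set v {..<p}"
    have a: "0 < a" using False L2_set_nonneg[of v] by (simp add: a_def less_le)
    let ?w = "\<lambda>j. (1 / a) * v j"
    have "L2_set ?w {..<p} = (1 / a) * L2_set v {..<p}"
      using a by (subst L2_set_right_distrib) auto
    then have "L2_set ?w {..<p} \<le> 1" using a by (simp add: a_def)
    then have "L2_set (mat_vec p X ?w) {..<n} \<le> op_norm n p X"
      unfolding op_norm_def using bdd by (intro cSUP_upper) auto
    moreover have "L2_set (mat_vec p X ?w) {..<n} = (1 / a) * L2_set (mat_vec p X v) {..<n}"
      unfolding mat_vec_scale using a by (subst L2_set_right_distrib) auto
    ultimately show ?thesis using a by (simp add: a_def field_simps)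
  qed
qed

lemma op_norm_nonneg: "0 \<le> op_norm n p X"
proof -
  have "L2_set (mat_vec p X (\<lambda>_. 0)) {..<n} \<le> op_norm n p X"
    unfolding op_norm_def using mat_vec_bounded
    by (intro cSUP_upper bdd_aboveI2) (auto simp: L2_set_def)
  then show ?thesis using L2_set_nonneg[of "mat_vec p X (\<lambda>_. 0)" "{..<n}"] by linarith
qed

lemma L2_set_power2: "(L2_set f A)\<^sup>2 = (\<Sum>i\<in>A. (f i)\<^sup>2)"
  by (simp add: L2_set_def sum_nonneg)

lemma mat_vec_square_le:
  "(\<Sum>l<n. (mat_vec p X w l)\<^sup>2) \<le> (op_norm n p X)\<^sup>2 * (\<Sum>j<p. (w j)\<^sup>2)"
  using power_mono[OF op_norm_bound, of p X w n 2]
  by (simp add: L2_set_nonneg power_mult_distrib L2_set_power2)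

text \<open>Duality: with t = X^T w, the squared norm of t is the inner product of w and X t, at
  most |w| B |t|; one factor |t| cancels.\<close>

lemma transpose_square_le:
  "(\<Sum>j<p. (\<Sum>l<n. X l j * w l)\<^sup>2) \<le> (op_norm n p X)\<^sup>2 * (\<Sum>l<n. (w l)\<^sup>2)"
proof -
  define t where "t j = (\<Sum>l<n. X l j * w l)" for j
  let ?t = "L2_set t {..<p}" and ?w = "L2_set w {..<n}"
  have "?t\<^sup>2 = (\<Sum>j<p. \<Sum>l<n. t j * (X l j * w l))"
    by (simp only: L2_set_power2) (simp only: power2_eq_square sum_distrib_left[symmetric] t_def[symmetric])
  also have "\<dots> = (\<Sum>l<n. w l * mat_vec p X t l)"
    unfolding mat_vec_def by (subst sum.swap) (simp add: sum_distrib_left mult_ac)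
  also have "\<dots> \<le> (\<Sum>l<n. \<bar>w l\<bar> * \<bar>mat_vec p X t l\<bar>)"
    by (intro sum_mono) (metis abs_ge_self abs_mult)
  also have "\<dots> \<le> ?w * L2_set (mat_vec p X t) {..<n}"
    by (rule L2_set_mult_ineq)
  also have "\<dots> \<le> ?w * (op_norm n p X * ?t)"
    by (intro mult_left_mono op_norm_bound L2_set_nonneg)
  finally have "?t * ?t \<le> (op_norm n p X * ?w) * ?t"
    by (simp add: power2_eq_square mult_ac)
  then have "?t \<le> op_norm n p X * ?w"
    using L2_set_nonneg[of t "{..<p}"] L2_set_nonneg[of w "{..<n}"] op_norm_nonneg[of n p X]
    by (cases "?t = 0") (auto simp: mult_le_cancel_right)
  then have "?t\<^sup>2 \<le> (op_norm n p X * ?w)\<^sup>2"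
    by (intro power_mono L2_set_nonneg)
  then show ?thesis by (simp add: L2_set_power2 power_mult_distrib t_def)
qed

lemma gram_commute: "gram n X i j = gram n X j i"
  by (simp add: gram_def mult.commute)

lemma gram_vec: "(\<Sum>j<p. gram n X i j * w j) = (\<Sum>l<n. X l i * mat_vec p X w l)"
  unfolding gram_def mat_vec_def sum_distrib_left sum_distrib_right
  by (subst sum.swap) (simp add: mult_ac)

text \<open>Only one of the two factors of the Gram matrix is estimated. For \<open>w\<close> the
  all-ones vector the other one leaves \<open>A_sum n p X 1\<close>, which later cancels against the
  denominator of \<open>m1_hat\<close>.\<close>

lemma gram_square_le:
  "(\<Sum>i<p. (\<Sum>j<p. gram n X i j * w j)\<^sup>2) \<le> (op_norm n p X)\<^sup>2 * (\<Sum>l<n. (mat_vec p X w l)\<^sup>2)"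
  unfolding gram_vec by (rule transpose_square_le)

lemma gram_square_le':
  "(\<Sum>i<p. (\<Sum>j<p. gram n X i j * w j)\<^sup>2) \<le> op_norm n p X ^ 4 * (\<Sum>j<p. (w j)\<^sup>2)"
proof -
  have "(\<Sum>i<p. (\<Sum>j<p. gram n X i j * w j)\<^sup>2)
      \<le> (op_norm n p X)\<^sup>2 * ((op_norm n p X)\<^sup>2 * (\<Sum>j<p. (w j)\<^sup>2))"
    by (rule order_trans[OF gram_square_le mult_left_mono[OF mat_vec_square_le]]) simp
  then show ?thesis by (simp add: power2_eq_square power4_eq_xxxx mult.assoc)
qed

lemma gram_row_le: "j < p \<Longrightarrow> (\<Sum>s<p. (gram n X j s)\<^sup>2) \<le> op_norm n p X ^ 4"
  using gram_square_le'[where p=p and n=n and X=X and w="\<lambda>i. if i = j then 1 else 0"]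
  by (simp add: if_distrib[of "\<lambda>x. _ * x"] if_distrib[of "\<lambda>x. x\<^sup>2"] sum.delta gram_commute[of n X j] cong: if_cong)

lemma A_sum_1: "A_sum n p X 1 = (\<Sum>l<n. (mat_vec p X (\<lambda>_. 1) l)\<^sup>2)"
proof -
  have "A_sum n p X 1 = (\<Sum>i<p. \<Sum>l<n. X l i * mat_vec p X (\<lambda>_. 1) l)"
    using gram_vec[of n X _ "\<lambda>_. 1" p] by (simp add: A_sum_def)
  also have "\<dots> = (\<Sum>l<n. (mat_vec p X (\<lambda>_. 1) l)\<^sup>2)"
    by (subst sum.swap) (simp add: mat_vec_def power2_eq_square sum_distrib_right)
  finally show ?thesis .
qed

text \<open>The entries of a row are at most its Euclidean norm, which is at most the square of the
  operator norm; this bounds all but two of the \<open>d\<close> factors.\<close>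

lemma sum_gram_power_le:
  assumes "j < p" "2 \<le> d"
  shows "(\<Sum>s<p. \<bar>gram n X j s\<bar> ^ d) \<le> ((op_norm n p X)\<^sup>2) ^ d"
proof -
  let ?B = "(op_norm n p X)\<^sup>2"
  have "\<bar>gram n X j s\<bar> \<le> ?B" if "s < p" for s
  proof -
    have "(gram n X j s)\<^sup>2 \<le> (\<Sum>s<p. (gram n X j s)\<^sup>2)"
      using that by (intro member_le_sum) auto
    also have "\<dots> \<le> op_norm n p X ^ 4" by (rule gram_row_le[OF assms(1)])
    finally have "\<bar>gram n X j s\<bar>\<^sup>2 \<le> ?B\<^sup>2" by (simp add: power_mult[symmetric])
    then show ?thesis by (rule power2_le_imp_le) simp
  qed
  then have pw: "\<bar>gram n X j s\<bar> ^ d \<le> (gram n X j s)\<^sup>2 * ?B ^ (d - 2)" if "s < p" for s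
    using that power_split[OF assms(2), of "\<bar>gram n X j s\<bar>"] power_mono[of "\<bar>gram n X j s\<bar>" ?B "d - 2"]
    by (simp add: mult_left_mono)
  have "(\<Sum>s<p. \<bar>gram n X j s\<bar> ^ d) \<le> (\<Sum>s<p. (gram n X j s)\<^sup>2) * ?B ^ (d - 2)"
    unfolding sum_distrib_right by (intro sum_mono pw) simp
  also have "\<dots> \<le> ?B\<^sup>2 * ?B ^ (d - 2)"
    using gram_row_le[OF assms(1)] by (intro mult_right_mono) (auto simp: power_mult[symmetric])
  also have "\<dots> = ?B ^ d" using power_split[OF assms(2), of ?B] by simp
  finally show ?thesis .
qed

lemma sum_lists_prod:
  fixes c :: "nat \<Rightarrow> nat \<Rightarrow> real"
  shows "(\<Sum>ss\<in>{ss. set ss \<subseteq> {..<m} \<and> length ss = length ds}. \<Prod>i<length ds. c (ss ! i) (ds ! i))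
    = prod_list (map (\<lambda>d. \<Sum>s<m. c s d) ds)"
proof (induction ds)
  case Nil
  have "{ss. set ss \<subseteq> {..<m} \<and> ss = []} = {[]}" by auto
  then show ?case by simp
next
  case (Cons d ds)
  let ?L = "\<lambda>t. {ss. set ss \<subseteq> {..<m} \<and> length ss = t}"
  have "?L (Suc (length ds)) = (\<lambda>(ss, s). s # ss) ` (?L (length ds) \<times> {..<m})"
    by (rule lists_length_Suc_eq)
  then have "(\<Sum>ss\<in>?L (length (d # ds)). \<Prod>i<length (d # ds). c (ss ! i) ((d # ds) ! i))
      = (\<Sum>(ss, s)\<in>?L (length ds) \<times> {..<m}. c s d * (\<Prod>i<length ds. c (ss ! i) (ds ! i)))"
    by (simp add: sum.reindex inj_on_def prod.lessThan_Suc_shift split_beta del: prod.lessThan_Suc)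
  also have "\<dots> = (\<Sum>s<m. c s d) * (\<Sum>ss\<in>?L (length ds). \<Prod>i<length ds. c (ss ! i) (ds ! i))"
    by (simp add: sum.cartesian_product[symmetric] sum_distrib_left sum_distrib_right sum_product)
  finally show ?case using Cons by simp
qed

text \<open>After passing to absolute values and dropping the order constraint, the tuples run over
  a full product and the sum factors into row sums of the Gram matrix, one for each part. Parts are
  at least 2, so \<open>sum_gram_power_le\<close> bounds them without a factor \<open>p\<close>; the
  only such factor comes from the sum over \<open>j\<close>.\<close>

lemma gamma_coeff_le:
  assumes "ds \<in> comps k"
  shows "\<bar>gamma_coeff n p X ds\<bar> \<le> fact k * (real p * op_norm n p X ^ (2 * k))"
proof -
  let ?B = "(op_norm n p X)\<^sup>2" and ?L = "{ss. set ss \<subseteq> {..<p} \<and> length ss = length ds}"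
  have sum_ds: "sum_list ds = k" and ds2: "\<And>d. d \<in> set ds \<Longrightarrow> 2 \<le> d"
    using assms by (auto simp: comps_def)
  have "(\<Sum>ss\<in>chains (length ds) p. \<Prod>i<length ds. \<bar>gram n X j (ss ! i)\<bar> ^ (ds ! i)) \<le> ?B ^ k" if "j < p" for j
  proof -
    have "(\<Sum>ss\<in>chains (length ds) p. \<Prod>i<length ds. \<bar>gram n X j (ss ! i)\<bar> ^ (ds ! i))
        \<le> (\<Sum>ss\<in>?L. \<Prod>i<length ds. \<bar>gram n X j (ss ! i)\<bar> ^ (ds ! i))"
      by (intro sum_mono2 finite_lists_length_eq) (auto simp: chains_def intro!: prod_nonneg)
    also have "\<dots> = prod_list (map (\<lambda>d. \<Sum>s<p. \<bar>gram n X j s\<bar> ^ d) ds)"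
      by (rule sum_lists_prod)
    also have "\<dots> \<le> ?B ^ sum_list ds"
      using ds2
    proof (induction ds)
      case (Cons d ds)
      then show ?case
        using sum_gram_power_le[OF that, where d=d and n=n and X=X]
        by (auto simp: power_add intro!: mult_mono prod_list_nonneg sum_nonneg)
    qed simp
    finally show ?thesis by (simp add: sum_ds)
  qed
  then have "(\<Sum>j<p. \<Sum>ss\<in>chains (length ds) p. \<Prod>i<length ds. \<bar>gram n X j (ss ! i)\<bar> ^ (ds ! i))
      \<le> real (card {..<p}) * ?B ^ k"
    by (intro sum_bounded_above) auto
  moreover have "\<bar>\<Sum>ss\<in>chains (length ds) p. \<Sum>j<p. \<Prod>i<length ds. gram n X j (ss ! i) ^ (ds ! i)\<bar>
      \<le> (\<Sum>j<p. \<Sum>ss\<in>chains (length ds) p. \<Prod>i<length ds. \<bar>gram n X j (ss ! i)\<bar> ^ (ds ! i))"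
    by (subst sum.swap) (intro order_trans[OF sum_abs sum_mono], simp add: abs_prod power_abs)
  ultimately have S: "\<bar>\<Sum>ss\<in>chains (length ds) p. \<Sum>j<p. \<Prod>i<length ds. gram n X j (ss ! i) ^ (ds ! i)\<bar>
      \<le> real p * op_norm n p X ^ (2 * k)"
    by (simp add: power_mult)
  have D: "\<bar>fact k / (\<Prod>i<length ds. fact (ds ! i))\<bar> \<le> (fact k :: real)"
  proof -
    have "(1::real) \<le> (\<Prod>i<length ds. fact (ds ! i))" by (rule prod_ge_1) simp
    then have "fact k / (\<Prod>i<length ds. fact (ds ! i)) \<le> (fact k / 1 :: real)"
      by (intro divide_left_mono) auto
    then show ?thesis by (simp add: prod_nonneg)
  qed
  show ?thesis
    unfolding gamma_coeff_def sum_ds chains_def[symmetric] abs_mult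
    by (rule mult_mono[OF D S]) auto
qed

section \<open>The regression model\<close>

lemma sum_lessThan_add: "(\<Sum>s<n + p. f s) = (\<Sum>s<n. f s) + (\<Sum>j<p. f (n + j))" for f :: "nat \<Rightarrow> 'a :: comm_monoid_add"
  by (induction p) (auto simp: add.assoc)

lemma prod_lessThan_add: "(\<Prod>s<n + p. f s) = (\<Prod>s<n. f s) * (\<Prod>j<p. f (n + j))" for f :: "nat \<Rightarrow> 'a :: comm_monoid_mult"
  by (induction p) (auto simp: mult.assoc)

text \<open>Squared, this is d^d <= (d!)^2: pair i with d + 1 - i and use i (d + 1 - i) >= d. It
  turns subgaussian growth of moments into the factorial bound of
  \<open>indep_system\<close>.\<close>

lemma sqrt_power_le_fact: "sqrt (real d) ^ d \<le> fact d"
proof -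
  have "real d ^ d = (\<Prod>i\<in>{1..d}. real d)" by simp
  also have "\<dots> \<le> (\<Prod>i\<in>{1..d}. real i * real (d + 1 - i))"
  proof (rule prod_mono)
    fix i assume i: "i \<in> {1..d}"
    then have "0 \<le> (real i - 1) * (real d - real i)" by (intro mult_nonneg_nonneg) auto
    then show "0 \<le> real d \<and> real d \<le> real i * real (d + 1 - i)"
      using i by (simp add: of_nat_diff algebra_simps)
  qed
  also have "\<dots> = (\<Prod>i\<in>{1..d}. real i) * (\<Prod>i\<in>{1..d}. real (d + 1 - i))"
    by (rule prod.distrib)
  also have "(\<Prod>i\<in>{1..d}. real (d + 1 - i)) = (\<Prod>i\<in>{1..d}. real i)"
    by (rule prod.atLeastAtMost_rev[symmetric])
  also have "(\<Prod>i\<in>{1..d}. real i) = fact d"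
    by (simp add: fact_prod)
  finally have "real d ^ d \<le> (fact d)\<^sup>2" by (simp add: power2_eq_square)
  moreover have "(sqrt (real d) ^ d)\<^sup>2 = real d ^ d"
    by (metis of_nat_0_le_iff power_commutes power_mult mult.commute real_sqrt_pow2)
  ultimately show ?thesis
    by (intro power2_le_imp_le[of "sqrt (real d) ^ d" "fact d"]) simp_all
qed

locale regression =
  fixes n p :: nat and X :: rmat and \<sigma> c0 M0 :: real and g :: "real measure"
  assumes n_ge: "1 \<le> n" and p_ge: "1 \<le> p" and \<sigma>_pos: "0 < \<sigma>" and c0_pos: "0 < c0"
    and op_ge: "op_norm n p X / \<sigma> \<ge> c0"
    and A1_ge: "A_sum n p X 1 \<ge> c0 * min (real n) (real p) * op_norm n p X ^ 2"
    and g: "real_distribution g" and subg: "subgaussian M0 g"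
begin

abbreviation "\<Omega> \<equiv> model n p \<sigma> g"
abbreviation "B \<equiv> op_norm n p X"
abbreviation "m1 \<equiv> prior_mean g"

definition r :: real where "r = min (real n) (real p)"

definition L :: "nat \<Rightarrow> real measure" where
  "L s = (if s < n then density lborel (\<lambda>x. ennreal (normal_density 0 \<sigma> x)) else g)"

definition coord :: "nat \<Rightarrow> rvec \<times> rvec \<Rightarrow> real" where
  "coord s \<omega> = (if s < n then snd \<omega> s else fst \<omega> (s - n))"

definition \<xi> :: "nat \<Rightarrow> rvec \<times> rvec \<Rightarrow> real" where
  "\<xi> s \<omega> = (if s < n then coord s \<omega> / \<sigma> else coord s \<omega> - m1)"

lemma prob_L: "prob_space (L s)"
  using prob_space_normal_density[OF \<sigma>_pos, of 0] real_distribution.axioms(1)[OF g] by (simp add: L_def)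

lemma space_L: "space (L s) = UNIV" and sets_L: "sets (L s) = sets borel"
proof -
  show sets: "sets (L s) = sets borel"
    using real_distribution.events_eq_borel[OF g] by (simp add: L_def)
  then show "space (L s) = UNIV" using sets_eq_imp_space_eq by force
qed

lemma model_eq: "\<Omega> = (\<Pi>\<^sub>M j\<in>{..<p}. L (n + j)) \<Otimes>\<^sub>M (\<Pi>\<^sub>M l\<in>{..<n}. L l)"
proof -
  have "(\<Pi>\<^sub>M j\<in>{..<p}. g) = (\<Pi>\<^sub>M j\<in>{..<p}. L (n + j))"
    by (rule PiM_cong) (auto simp: L_def)
  moreover have "gaussian_noise n \<sigma> = (\<Pi>\<^sub>M l\<in>{..<n}. L l)"
    unfolding gaussian_noise_def by (rule PiM_cong) (auto simp: L_def)
  ultimately show ?thesis by (simp add: model_def)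
qed

lemma prob_model: "prob_space \<Omega>"
proof -
  interpret A: prob_space "\<Pi>\<^sub>M j\<in>{..<p}. L (n + j)" by (intro prob_space_PiM prob_L)
  interpret B: prob_space "\<Pi>\<^sub>M l\<in>{..<n}. L l" by (intro prob_space_PiM prob_L)
  interpret AB: pair_prob_space "\<Pi>\<^sub>M j\<in>{..<p}. L (n + j)" "\<Pi>\<^sub>M l\<in>{..<n}. L l" ..
  show ?thesis unfolding model_eq by (rule AB.prob_space_axioms)
qed

lemma space_model: "space \<Omega> = (\<Pi>\<^sub>E j\<in>{..<p}. UNIV) \<times> (\<Pi>\<^sub>E l\<in>{..<n}. UNIV)"
  by (simp add: model_eq space_pair_measure space_PiM space_L)

lemma coord_measurable [measurable]:
  assumes "s < n + p" shows "coord s \<in> borel_measurable \<Omega>"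
proof -
  have "(\<lambda>x. x s) \<in> measurable (\<Pi>\<^sub>M l\<in>{..<n}. L l) borel" if "s < n"
    using measurable_component_singleton[of s "{..<n}" L] that
    by (simp add: measurable_cong_sets[OF refl sets_L])
  moreover have "(\<lambda>x. x (s - n)) \<in> measurable (\<Pi>\<^sub>M j\<in>{..<p}. L (n + j)) borel" if "\<not> s < n"
    using measurable_component_singleton[of "s - n" "{..<p}" "\<lambda>j. L (n + j)"] that assms
    by (simp add: measurable_cong_sets[OF refl sets_L])
  ultimately show ?thesis
    unfolding coord_def[abs_def] model_eq
    by (cases "s < n") (auto intro: measurable_compose[OF measurable_snd] measurable_compose[OF measurable_fst])
qed

text \<open>Merges the two blocks of \<open>model\<close> into one product over
  \<open>{..<n + p}\<close>, noise first. Boxes determine a product measure, and a box splits into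
  its two blocks.\<close>

lemma distr_coords:
  "distr \<Omega> (\<Pi>\<^sub>M s\<in>{..<n + p}. borel) (\<lambda>\<omega>. \<lambda>s\<in>{..<n + p}. coord s \<omega>) = Pi\<^sub>M {..<n + p} L" (is "?D = _")
proof -
  interpret A: prob_space "\<Pi>\<^sub>M j\<in>{..<p}. L (n + j)" by (intro prob_space_PiM prob_L)
  interpret Bm: prob_space "\<Pi>\<^sub>M l\<in>{..<n}. L l" by (intro prob_space_PiM prob_L)
  interpret PL: product_sigma_finite L
    by (simp add: product_sigma_finite_def prob_L prob_space_imp_sigma_finite)
  interpret PG: product_sigma_finite "\<lambda>j. L (n + j)"
    by (simp add: product_sigma_finite_def prob_L prob_space_imp_sigma_finite)
  show ?thesis
  proof (rule PL.PiM_eqI)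
    show "sets ?D = sets (Pi\<^sub>M {..<n + p} L)"
      by (simp, rule sets_PiM_cong) (auto simp: sets_L)
    fix A assume A: "\<And>s. s \<in> {..<n + p} \<Longrightarrow> A s \<in> sets (L s)"
    have "emeasure ?D (Pi\<^sub>E {..<n + p} A)
        = emeasure \<Omega> ((\<lambda>\<omega>. \<lambda>s\<in>{..<n + p}. coord s \<omega>) -` Pi\<^sub>E {..<n + p} A \<inter> space \<Omega>)"
      using A by (intro emeasure_distr) (auto intro!: measurable_restrict sets_PiM_I_finite simp: sets_L)
    also have "(\<lambda>\<omega>. \<lambda>s\<in>{..<n + p}. coord s \<omega>) -` Pi\<^sub>E {..<n + p} A \<inter> space \<Omega>
        = (\<Pi>\<^sub>E j\<in>{..<p}. A (n + j)) \<times> (\<Pi>\<^sub>E l\<in>{..<n}. A l)"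
    proof (intro equalityI subsetI)
      fix \<omega> assume "\<omega> \<in> (\<lambda>\<omega>. \<lambda>s\<in>{..<n + p}. coord s \<omega>) -` Pi\<^sub>E {..<n + p} A \<inter> space \<Omega>"
      then have sp: "\<omega> \<in> space \<Omega>" and co: "\<And>s. s < n + p \<Longrightarrow> coord s \<omega> \<in> A s"
        by (auto simp: PiE_iff)
      have "fst \<omega> j \<in> A (n + j)" if "j < p" for j using co[of "n + j"] that by (simp add: coord_def)
      moreover have "snd \<omega> l \<in> A l" if "l < n" for l using co[of l] that by (simp add: coord_def)
      ultimately show "\<omega> \<in> (\<Pi>\<^sub>E j\<in>{..<p}. A (n + j)) \<times> (\<Pi>\<^sub>E l\<in>{..<n}. A l)"
        using sp by (auto simp: space_model PiE_iff mem_Times_iff)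
    next
      fix \<omega> assume \<omega>: "\<omega> \<in> (\<Pi>\<^sub>E j\<in>{..<p}. A (n + j)) \<times> (\<Pi>\<^sub>E l\<in>{..<n}. A l)"
      have "coord s \<omega> \<in> A s" if "s < n + p" for s
      proof (cases "s < n")
        case False
        have "fst \<omega> j \<in> A (n + j)" if "j < p" for j
          using \<omega> that by (auto simp: PiE_iff mem_Times_iff)
        from this[of "s - n"] show ?thesis using False that by (simp add: coord_def)
      qed (use \<omega> in \<open>auto simp: coord_def PiE_iff mem_Times_iff\<close>)
      then show "\<omega> \<in> (\<lambda>\<omega>. \<lambda>s\<in>{..<n + p}. coord s \<omega>) -` Pi\<^sub>E {..<n + p} A \<inter> space \<Omega>"
        using \<omega> by (auto simp: space_model PiE_iff mem_Times_iff)
    qed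
    also have "emeasure \<Omega> \<dots> = emeasure (\<Pi>\<^sub>M j\<in>{..<p}. L (n + j)) (\<Pi>\<^sub>E j\<in>{..<p}. A (n + j))
        * emeasure (\<Pi>\<^sub>M l\<in>{..<n}. L l) (\<Pi>\<^sub>E l\<in>{..<n}. A l)"
      unfolding model_eq using A
      by (intro Bm.emeasure_pair_measure_Times sets_PiM_I_finite) auto
    also have "\<dots> = (\<Prod>j<p. emeasure (L (n + j)) (A (n + j))) * (\<Prod>l<n. emeasure (L l) (A l))"
      using A by (subst PG.emeasure_PiM, simp, simp, subst PL.emeasure_PiM) auto
    also have "\<dots> = (\<Prod>s<n + p. emeasure (L s) (A s))"
      unfolding prod_lessThan_add by (rule mult.commute)
    finally show "emeasure ?D (Pi\<^sub>E {..<n + p} A) = (\<Prod>s\<in>{..<n + p}. emeasure (L s) (A s))" .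
  qed simp
qed

lemma distr_coord: assumes "s < n + p" shows "distr \<Omega> borel (coord s) = L s"
proof -
  have "distr \<Omega> borel (coord s)
      = distr (distr \<Omega> (\<Pi>\<^sub>M s\<in>{..<n + p}. borel) (\<lambda>\<omega>. \<lambda>s\<in>{..<n + p}. coord s \<omega>)) borel (\<lambda>x. x s)"
    using assms by (subst distr_distr) (auto intro!: measurable_restrict simp: comp_def)
  also have "\<dots> = distr (Pi\<^sub>M {..<n + p} L) (L s) (\<lambda>x. x s)"
    unfolding distr_coords by (rule distr_cong) (auto simp: sets_L)
  also have "\<dots> = L s"
    using assms prob_L by (intro distr_PiM_component) auto
  finally show ?thesis .
qed

lemma indep_coord: "prob_space.indep_vars \<Omega> (\<lambda>_. borel) coord {..<n + p}"
proof -
  interpret prob_space \<Omega> by (rule prob_model)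
  have "(\<Pi>\<^sub>M s\<in>{..<n + p}. distr \<Omega> borel (coord s)) = Pi\<^sub>M {..<n + p} L"
    by (rule PiM_cong) (auto simp: distr_coord)
  then show ?thesis
    using n_ge by (subst indep_vars_iff_distr_eq_PiM') (auto simp: distr_coords)
qed

lemma coord_integral:
  assumes "s < n + p" "h \<in> borel_measurable borel"
  shows "integrable \<Omega> (\<lambda>\<omega>. h (coord s \<omega>)) \<longleftrightarrow> integrable (L s) h"
    and "(\<integral>\<omega>. h (coord s \<omega>) \<partial>\<Omega>) = (\<integral>x. (h x :: real) \<partial>L s)"
  using assms integrable_distr_eq[of "coord s" \<Omega> borel h] integral_distr[of "coord s" \<Omega> borel h]
  by (auto simp: distr_coord)

lemma xi_moment:
  assumes s: "s < n + p"
  shows "(\<integral>\<omega>. \<xi> s \<omega> ^ d \<partial>\<Omega>) = (if s < n then hpoly (-1) 0 d else central_moment g d)"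
proof (cases "s < n")
  case True
  then show ?thesis
    using coord_integral(2)[OF s, of "\<lambda>x. (x / \<sigma>) ^ d"] gauss_moments(2)[OF \<sigma>_pos, of d]
    by (simp add: \<xi>_def L_def)
next
  case False
  then show ?thesis
    using coord_integral(2)[OF s, of "\<lambda>x. (x - m1) ^ d"]
    by (simp add: \<xi>_def L_def central_moment_def)
qed

text \<open>The maximum with \<open>1\<close> makes one constant valid for the standardised noise
  and for the prior. For the latter, a moment of order d is at most M^d (sqrt d)^d, and
  \<open>sqrt_power_le_fact\<close> applies.\<close>

lemma indep_system: "indep_system \<Omega> \<xi> (n + p) (max 1 M0)"
proof -
  interpret prob_space \<Omega> by (rule prob_model)
  have meas: "(\<lambda>x. x / \<sigma>) \<in> borel_measurable borel" "(\<lambda>x. x - m1) \<in> borel_measurable borel" by auto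
  have \<xi>_eq: "\<xi> s = (\<lambda>\<omega>. (if s < n then \<lambda>x. x / \<sigma> else (\<lambda>x. x - m1)) (coord s \<omega>))" for s
    by (auto simp: \<xi>_def)
  interpret g: prob_space g using real_distribution.axioms(1)[OF g] .
  have int_g: "integrable g (\<lambda>b. \<bar>b - m1\<bar> ^ d)" for d
    using subg by (cases "d = 0") (auto simp: subgaussian_def)
  have Lg: "L s = g" if "\<not> s < n" for s using that by (simp add: L_def)
  show ?thesis
  proof
    show "indep_vars (\<lambda>_. borel) \<xi> {..<n + p}"
      unfolding \<xi>_eq[abs_def] by (rule indep_vars_compose2[OF indep_coord]) auto
    show mom: "all_moments \<Omega> (\<xi> s)" if s: "s < n + p" for s
      unfolding all_moments_def
    proof (intro conjI allI)
      show "random_variable borel (\<xi> s)"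
        unfolding \<xi>_eq using coord_measurable[OF s] by auto
      fix d
      show "integrable \<Omega> (\<lambda>x. \<bar>\<xi> s x\<bar> ^ d)"
      proof (cases "s < n")
        case True
        then show ?thesis
          using coord_integral(1)[OF s, of "\<lambda>x. \<bar>x / \<sigma>\<bar> ^ d"] gauss_moments(1)[OF \<sigma>_pos, of d]
          by (simp add: \<xi>_def L_def)
      next
        case False
        then show ?thesis
          using coord_integral(1)[OF s, of "\<lambda>x. \<bar>x - m1\<bar> ^ d"] int_g[of d]
          by (simp add: \<xi>_def Lg)
      qed
    qed
    note E = xi_moment
    have "central_moment g 1 = 0"
      using subg by (simp add: central_moment_def subgaussian_def prior_mean_def g.prob_space)
    then show "expectation (\<xi> s) = 0" if "s < n + p" for s
      using E[OF that, of 1] by simp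
    show "\<bar>expectation (\<lambda>x. \<xi> s x ^ d)\<bar> \<le> fact d * max 1 M0 ^ d" if s: "s < n + p" for s d
    proof (cases "s < n")
      case True
      have "\<bar>hpoly (-1) 0 d\<bar> \<le> fact d * 1" using abs_hpoly_gauss_le[of d] by simp
      also have "\<dots> \<le> fact d * max 1 M0 ^ d" by (intro mult_left_mono one_le_power) auto
      finally show ?thesis using E[OF s, of d] True by simp
    next
      case False
      have "\<bar>central_moment g d\<bar> \<le> fact d * max 1 M0 ^ d"
      proof (cases "d = 0")
        case False
        let ?I = "\<integral>b. \<bar>b - m1\<bar> ^ d \<partial>g"
        have I0: "0 \<le> ?I" by (rule Bochner_Integration.integral_nonneg) simp
        have "root d ?I \<le> M0 * sqrt (real d)"
          using subg False by (simp add: subgaussian_def)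
        also have "\<dots> \<le> max 1 M0 * sqrt (real d)"
          by (intro mult_right_mono) auto
        finally have "root d ?I ^ d \<le> (max 1 M0 * sqrt (real d)) ^ d"
          using I0 False by (intro power_mono) auto
        then have "?I \<le> max 1 M0 ^ d * sqrt (real d) ^ d"
          using I0 False by (simp add: power_mult_distrib)
        also have "\<dots> \<le> max 1 M0 ^ d * fact d"
          using sqrt_power_le_fact[of d] by (intro mult_left_mono) auto
        finally have "?I \<le> fact d * max 1 M0 ^ d" by (simp add: mult.commute)
        moreover have "\<bar>central_moment g d\<bar> \<le> ?I"
          unfolding central_moment_def using integral_norm_bound[of g "\<lambda>b. (b - m1) ^ d"]
          by (simp add: power_abs)
        ultimately show ?thesis by simp
      qed (simp add: central_moment_def g.prob_space)
      then show ?thesis using E[OF s, of d] False by simp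
    qed
  qed simp
qed

end

section \<open>Scores and the mean error as linear forms\<close>

context regression
begin

text \<open>
  The indices \<open>s < n\<close> belong to the noise, the index \<open>n + i\<close> to the \<open>i\<close>-th coefficient.
\<close>

definition loading :: "nat \<Rightarrow> nat \<Rightarrow> real" where
  "loading j s = (if s < n then \<sigma> * X s j else gram n X j (s - n))"

definition noise_var :: "nat \<Rightarrow> real" where
  "noise_var j = (\<Sum>s<n. (\<sigma> * X s j)\<^sup>2)"

text \<open>From c0 \<sigma> <= B: the noise block of \<open>loading\<close> has squared norm at
  most \<sigma>^2 B^2 and the Gram block at most B^4, together at most B^4 \<tau>^2, which is
  \<open>T\<^sup>2\<close>.\<close>

definition \<tau> :: real where "\<tau> = sqrt (1 + 1 / c0\<^sup>2)"

definition T :: real where "T = B\<^sup>2 * \<tau>"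

text \<open>\<open>\<kappa> / sqrt r\<close> bounds the coefficient norm of the mean error; the
  maximum with \<open>1\<close> makes \<open>Q \<kappa>\<close> dominate \<open>Q 1\<close>.\<close>

definition \<kappa> :: real where "\<kappa> = max 1 (\<tau> / sqrt c0)"

definition score :: "nat \<Rightarrow> rvec \<times> rvec \<Rightarrow> real" where
  "score j \<omega> = (\<Sum>s<n + p. loading j s * \<xi> s \<omega>)"

definition mean_err :: "rvec \<times> rvec \<Rightarrow> real" where
  "mean_err \<omega> = m1 - m1_hat n p X (response n p X \<omega>)"

definition row_sum :: "nat \<Rightarrow> real" where
  "row_sum j = (\<Sum>i<p. gram n X j i)"

lemma B_pos: "0 < B"
proof -
  have "0 < c0 * \<sigma>" using c0_pos \<sigma>_pos by simp
  also have "c0 * \<sigma> \<le> B" using op_ge \<sigma>_pos by (simp add: field_simps)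
  finally show ?thesis .
qed

lemma \<sigma>2_le: "\<sigma>\<^sup>2 \<le> B\<^sup>2 / c0\<^sup>2"
proof -
  have "c0 * \<sigma> \<le> B" using op_ge \<sigma>_pos by (simp add: field_simps)
  then have "(c0 * \<sigma>)\<^sup>2 \<le> B\<^sup>2" using c0_pos \<sigma>_pos by (intro power_mono) auto
  then show ?thesis using c0_pos by (simp add: power_mult_distrib field_simps)
qed

lemma \<tau>_ge: "1 \<le> \<tau>" and \<tau>2: "\<tau>\<^sup>2 = 1 + 1 / c0\<^sup>2"
  by (simp_all add: \<tau>_def add_nonneg_nonneg)

lemma noise_plus_le: "\<sigma>\<^sup>2 + B\<^sup>2 \<le> B\<^sup>2 * \<tau>\<^sup>2"
  using \<sigma>2_le by (simp add: \<tau>2 algebra_simps)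

lemma T_pos: "0 < T" and T2: "T\<^sup>2 = B ^ 4 * \<tau>\<^sup>2"
  using B_pos \<tau>_ge by (auto simp: T_def power_mult_distrib power_mult[symmetric])

lemma r_props: "1 \<le> r" "r \<le> real p" "r \<le> real n"
  using n_ge p_ge by (auto simp: r_def)

lemma A1_pos: "0 < A_sum n p X 1" and A1_ge': "c0 * r * B\<^sup>2 \<le> A_sum n p X 1"
proof -
  have "0 < c0 * r * B\<^sup>2" using c0_pos r_props B_pos by simp
  moreover show "c0 * r * B\<^sup>2 \<le> A_sum n p X 1" using A1_ge by (simp add: r_def)
  ultimately show "0 < A_sum n p X 1" by linarith
qed

lemma loading_square: "(\<Sum>s<n + p. (\<Sum>j<p. loading j s * w j)\<^sup>2)
    = \<sigma>\<^sup>2 * (\<Sum>l<n. (mat_vec p X w l)\<^sup>2) + (\<Sum>i<p. (\<Sum>j<p. gram n X i j * w j)\<^sup>2)"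
proof -
  have "(\<Sum>s<n. (\<Sum>j<p. loading j s * w j)\<^sup>2) = \<sigma>\<^sup>2 * (\<Sum>l<n. (mat_vec p X w l)\<^sup>2)"
    unfolding sum_distrib_left power_mult_distrib[symmetric]
    by (intro sum.cong) (auto simp: loading_def mat_vec_def sum_distrib_left mult.assoc)
  moreover have "(\<Sum>i<p. (\<Sum>j<p. loading j (n + i) * w j)\<^sup>2) = (\<Sum>i<p. (\<Sum>j<p. gram n X i j * w j)\<^sup>2)"
    by (simp add: loading_def gram_commute[of n X])
  ultimately show ?thesis by (simp only: sum_lessThan_add)
qed

lemma loading_op_le: "(\<Sum>s<n + p. (\<Sum>j<p. loading j s * w j)\<^sup>2) \<le> T\<^sup>2 * (\<Sum>j<p. (w j)\<^sup>2)"
proof -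
  let ?w = "\<Sum>j<p. (w j)\<^sup>2"
  have "(\<Sum>s<n + p. (\<Sum>j<p. loading j s * w j)\<^sup>2) \<le> \<sigma>\<^sup>2 * (B\<^sup>2 * ?w) + B ^ 4 * ?w"
    unfolding loading_square by (intro add_mono mult_left_mono mat_vec_square_le gram_square_le') auto
  also have "\<dots> = (\<sigma>\<^sup>2 + B\<^sup>2) * (B\<^sup>2 * ?w)"
    by (simp add: algebra_simps power2_eq_square power4_eq_xxxx)
  also have "\<dots> \<le> (B\<^sup>2 * \<tau>\<^sup>2) * (B\<^sup>2 * ?w)"
    by (intro mult_right_mono noise_plus_le) (auto intro!: mult_nonneg_nonneg sum_nonneg)
  also have "\<dots> = T\<^sup>2 * ?w"
    unfolding T2 by (simp add: power2_eq_square power4_eq_xxxx mult_ac)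
  finally show ?thesis .
qed

lemma hermite_sum: assumes "2 \<le> k" shows "hermite_sum \<Omega> \<xi> (n + p) (max 1 M0) loading noise_var p k T"
proof -
  have v_le: "noise_var j \<le> T\<^sup>2" if "j < p" for j
  proof -
    let ?w = "\<lambda>i. if i = j then 1 else (0::real)"
    have "noise_var j \<le> (\<Sum>s<n + p. (loading j s)\<^sup>2)"
      unfolding sum_lessThan_add noise_var_def by (simp add: loading_def sum_nonneg)
    also have "\<dots> = (\<Sum>s<n + p. (\<Sum>i<p. loading i s * ?w i)\<^sup>2)"
      using that by (simp add: if_distrib[of "\<lambda>x. _ * x"] sum.delta cong: if_cong)
    also have "\<dots> \<le> T\<^sup>2 * (\<Sum>i<p. (?w i)\<^sup>2)" by (rule loading_op_le)
    also have "\<dots> = T\<^sup>2"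
      using that by (simp add: if_distrib[of "\<lambda>x. x\<^sup>2"] sum.delta cong: if_cong)
    finally show ?thesis .
  qed
  show ?thesis
    using assms n_ge T_pos loading_op_le v_le
    by (intro hermite_sum.intro indep_system hermite_sum_axioms.intro) (auto simp: noise_var_def sum_nonneg)
qed

lemma score_eq:
  "score j \<omega> = (\<Sum>l<n. X l j * (response n p X \<omega> l - m1 * mat_vec p X (\<lambda>_. 1) l))"
proof -
  have "score j \<omega> = (\<Sum>l<n. X l j * snd \<omega> l) + (\<Sum>i<p. gram n X j i * (fst \<omega> i - m1))"
    unfolding score_def sum_lessThan_add using \<sigma>_pos by (simp add: loading_def \<xi>_def coord_def)
  also have "(\<Sum>i<p. gram n X j i * (fst \<omega> i - m1)) = (\<Sum>l<n. X l j * mat_vec p X (\<lambda>i. fst \<omega> i - m1) l)"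
    by (rule gram_vec)
  also have "mat_vec p X (\<lambda>i. fst \<omega> i - m1) = (\<lambda>l. mat_vec p X (fst \<omega>) l - m1 * mat_vec p X (\<lambda>_. 1) l)"
    by (simp add: mat_vec_def right_diff_distrib sum_subtractf sum_distrib_left mult.commute)
  finally show ?thesis
    by (simp add: response_def split_beta sum.distrib[symmetric] algebra_simps)
qed

lemma row_sum_eq: "row_sum j = (\<Sum>l<n. X l j * mat_vec p X (\<lambda>_. 1) l)"
  using gram_vec[of n X j "\<lambda>_. 1" p] by (simp add: row_sum_def)

lemma y_hat_score:
  "(\<Sum>l<n. X l j * y_hat n p X (response n p X \<omega>) l) = score j \<omega> + mean_err \<omega> * row_sum j"
  unfolding score_eq row_sum_eq mean_err_def y_hat_def sum_distrib_left sum.distrib[symmetric]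
  by (intro sum.cong) (auto simp: algebra_simps)

text \<open>\<open>A_sum n p X 1\<close> is both the denominator of \<open>m1_hat\<close> and the
  total of the row sums, so \<open>m1\<close> cancels and what is left is minus the sum of the
  scores over that number, again a centred linear form.\<close>

lemma mean_err_eq: "mean_err \<omega> = (\<Sum>s<n + p. (- (\<Sum>j<p. loading j s) / A_sum n p X 1) * \<xi> s \<omega>)"
proof -
  let ?A = "A_sum n p X 1"
  have rs: "(\<Sum>j<p. row_sum j) = ?A" by (simp add: row_sum_def A_sum_def)
  have "(\<Sum>j<p. \<Sum>l<n. X l j * response n p X \<omega> l) = (\<Sum>j<p. score j \<omega> + m1 * row_sum j)"
    unfolding score_eq row_sum_eq sum_distrib_left sum.distrib[symmetric]
    by (intro sum.cong) (auto simp: algebra_simps)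
  also have "\<dots> = (\<Sum>j<p. score j \<omega>) + m1 * ?A"
    by (simp add: sum.distrib sum_distrib_left[symmetric] rs)
  finally have "m1_hat n p X (response n p X \<omega>) = ((\<Sum>j<p. score j \<omega>) + m1 * ?A) / ?A"
    unfolding m1_hat_def L2_set_power2 A_sum_1[symmetric] by simp
  then have "mean_err \<omega> = - (\<Sum>j<p. score j \<omega>) / ?A"
    unfolding mean_err_def using A1_pos by (simp add: field_simps)
  also have "(\<Sum>j<p. score j \<omega>) = (\<Sum>s<n + p. (\<Sum>j<p. loading j s) * \<xi> s \<omega>)"
    unfolding score_def sum_distrib_right by (rule sum.swap)
  also have "- \<dots> / ?A = (\<Sum>s<n + p. (- (\<Sum>j<p. loading j s) / ?A) * \<xi> s \<omega>)"
  proof -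
    have "- (\<Sum>s<n + p. b s * x s) / a = (\<Sum>s<n + p. (- b s / a) * x s)" for a and b x :: "nat \<Rightarrow> real"
      by (simp add: sum_divide_distrib sum_negf)
    then show ?thesis .
  qed
  finally show ?thesis .
qed

text \<open>The sums of \<open>loading\<close> over \<open>j\<close> have squared norm at most B^2
  \<tau>^2 A_1. Dividing by A_1^2 leaves one A_1 in the denominator, and the hypothesis A_1 >= c0 r
  B^2 turns it into the rate 1 / r.\<close>

lemma mean_err_coeff_le:
  "L2_set (\<lambda>s. - (\<Sum>j<p. loading j s) / A_sum n p X 1) {..<n + p} \<le> \<kappa> / sqrt r"
proof -
  let ?A = "A_sum n p X 1"
  have "(\<Sum>s<n + p. (\<Sum>j<p. loading j s)\<^sup>2) \<le> \<sigma>\<^sup>2 * ?A + B\<^sup>2 * ?A"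
    using loading_square[of "\<lambda>_. 1"] gram_square_le[where w="\<lambda>_. 1" and p=p and n=n and X=X]
    unfolding A_sum_1 by simp
  also have "\<dots> \<le> (B\<^sup>2 * \<tau>\<^sup>2) * ?A"
    using noise_plus_le A1_pos by (simp add: distrib_right[symmetric] mult_right_mono)
  finally have S: "(\<Sum>s<n + p. (\<Sum>j<p. loading j s)\<^sup>2) \<le> (B\<^sup>2 * \<tau>\<^sup>2) * ?A" .
  have "(\<Sum>s<n + p. (- (\<Sum>j<p. loading j s) / ?A)\<^sup>2) = (\<Sum>s<n + p. (\<Sum>j<p. loading j s)\<^sup>2) / ?A\<^sup>2"
  proof -
    have "(\<Sum>s<n + p. (- b s / a)\<^sup>2) = (\<Sum>s<n + p. (b s)\<^sup>2) / a\<^sup>2" for a and b :: "nat \<Rightarrow> real"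
      by (simp add: power_divide sum_divide_distrib)
    then show ?thesis .
  qed
  also have "\<dots> \<le> (B\<^sup>2 * \<tau>\<^sup>2) * ?A / ?A\<^sup>2"
    by (intro divide_right_mono S) simp
  also have "\<dots> = (B\<^sup>2 * \<tau>\<^sup>2) / ?A"
    using A1_pos by (simp add: power2_eq_square)
  also have "\<dots> \<le> (B\<^sup>2 * \<tau>\<^sup>2) / (c0 * r * B\<^sup>2)"
    using A1_ge' A1_pos c0_pos r_props B_pos by (intro divide_left_mono) auto
  also have "\<dots> = (\<tau> / sqrt c0)\<^sup>2 / r"
    using B_pos c0_pos by (simp add: power_divide)
  also have "\<dots> \<le> \<kappa>\<^sup>2 / r"
    using r_props \<tau>_ge c0_pos by (intro divide_right_mono power_mono) (auto simp: \<kappa>_def)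
  also have "\<dots> = (\<kappa> / sqrt r)\<^sup>2"
    using r_props by (simp add: power_divide)
  finally show ?thesis
    unfolding L2_set_def using r_props by (intro real_le_lsqrt) (auto simp: \<kappa>_def sum_nonneg)
qed

lemma row_sum_square_le: "(\<Sum>j<p. (row_sum j)\<^sup>2) \<le> real p * T\<^sup>2"
proof -
  have "(\<Sum>j<p. (row_sum j)\<^sup>2) \<le> B ^ 4 * real p"
    using gram_square_le'[where w="\<lambda>_. 1" and p=p and n=n and X=X] by (simp add: row_sum_def)
  also have "\<dots> \<le> T\<^sup>2 * real p"
    unfolding T2 using one_le_power[OF \<tau>_ge, of 2] mult_left_mono[of 1 "\<tau>\<^sup>2" "B ^ 4"]
    by (intro mult_right_mono) auto
  finally show ?thesis by (simp add: mult.commute)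
qed

lemma F_stat_eq:
  assumes "1 \<le> k"
  shows "F_stat n p X \<sigma> k z = (\<Sum>j<p. hpoly (noise_var j) (\<Sum>l<n. X l j * z l) k)"
  unfolding F_stat_def
proof (rule sum.cong[OF refl])
  fix j
  let ?u = "\<Sum>l<n. X l j * z l" and ?s = "\<sigma> * col_norm n X j"
  show "(if col_norm n X j = 0 then 0 else ?s ^ k * hermite k (?u / ?s)) = hpoly (noise_var j) ?u k"
  proof (cases "col_norm n X j = 0")
    case True
    then have "\<forall>l<n. X l j = 0" by (simp add: col_norm_def L2_set_eq_0_iff)
    then have "noise_var j = 0" "?u = 0" by (auto simp: noise_var_def)
    \<comment> \<open>The default value \<open>0\<close> of the summand agrees with
      \<open>0 ^ k\<close> only at a positive order.\<close>
    then show ?thesis using True assms by (simp add: power_0_left)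
  next
    case False
    then have s: "?s \<noteq> 0" using \<sigma>_pos by simp
    have "?s ^ k * hermite k (?u / ?s) = hpoly (?s\<^sup>2 * 1) (?s * (?u / ?s)) k"
      unfolding hermite_eq_hpoly hpoly_scale ..
    also have "?s * (?u / ?s) = ?u" using s by simp
    also have "?s\<^sup>2 * 1 = noise_var j"
      by (simp add: noise_var_def col_norm_def power_mult_distrib L2_set_power2 sum_distrib_left)
    finally show ?thesis using False by simp
  qed
qed

section \<open>The statistics, their means and their mean squared errors\<close>

definition stat :: "nat \<Rightarrow> rvec \<times> rvec \<Rightarrow> real" where
  "stat k \<omega> = F_stat n p X \<sigma> k (y_hat n p X (response n p X \<omega>))"

text \<open>The expansion with the true moments. Its \<open>[k]\<close> term is the
  \<open>k\<close>-th moment times \<open>A_sum n p X k\<close>; the recursion in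
  \<open>mu_hat\<close> solves the same identity for that term, with estimates inserted.\<close>

definition mean_stat :: "nat \<Rightarrow> real" where
  "mean_stat k = (\<Sum>ds\<in>comps k. prod_list (map (central_moment g) ds) * gamma_coeff n p X ds)"

lemma stat_eq:
  "1 \<le> k \<Longrightarrow> stat k \<omega> = (\<Sum>j<p. hpoly (noise_var j) (score j \<omega> + mean_err \<omega> * row_sum j) k)"
  unfolding stat_def by (simp add: F_stat_eq y_hat_score)

text \<open>\<open>noise_var j\<close> equals the sum of the squared noise loadings, so the noise
  drops out and \<open>expectation_hpoly_chain\<close> expands the rest. Its factorials assemble
  into the multinomial coefficients of \<open>gamma_coeff\<close>.\<close>

lemma expectation_score:
  "(\<integral>\<omega>. (\<Sum>j<p. hpoly (noise_var j) (score j \<omega>) k) \<partial>\<Omega>) = mean_stat k"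
proof -
  interpret indep_system \<Omega> \<xi> "n + p" "max 1 M0" by (rule indep_system)
  let ?\<mu> = "central_moment g"
  have mom: "all_moments \<Omega> (score j)" for j
    unfolding score_def by auto
  have "expectation (\<lambda>\<omega>. hpoly (noise_var j) (score j \<omega>) k)
      = fact k * chain_sum (\<lambda>s d. gram n X j s ^ d * ?\<mu> d / fact d) p k" for j
  proof -
    have "expectation (\<lambda>\<omega>. hpoly (noise_var j) (\<Sum>s<n. loading j s * \<xi> s \<omega>) k) = 0 ^ k" for k
    proof -
      have "noise_var j - (\<Sum>s<n. (loading j s)\<^sup>2) = 0"
        by (simp add: noise_var_def loading_def)
      then show ?thesis
        using expectation_hpoly_gauss[of n "noise_var j" "loading j" k] by (simp add: xi_moment)
    qed
    from expectation_hpoly_chain[OF order_refl this, of ?\<mu>] show ?thesis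
      unfolding score_def by (simp add: xi_moment loading_def)
  qed
  then have "(\<integral>\<omega>. (\<Sum>j<p. hpoly (noise_var j) (score j \<omega>) k) \<partial>\<Omega>)
      = (\<Sum>j<p. fact k * chain_sum (\<lambda>s d. gram n X j s ^ d * ?\<mu> d / fact d) p k)"
    using mom by (subst Bochner_Integration.integral_sum) (auto intro!: all_moments_integrable)
  also have "\<dots> = (\<Sum>j<p. \<Sum>ds\<in>comps k. \<Sum>ss\<in>chains (length ds) p.
      fact k * (\<Prod>i<length ds. gram n X j (ss ! i) ^ (ds ! i) * ?\<mu> (ds ! i) / fact (ds ! i)))"
    unfolding chain_sum_def by (simp add: sum_distrib_left)
  also have "\<dots> = (\<Sum>ds\<in>comps k. \<Sum>j<p. \<Sum>ss\<in>chains (length ds) p.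
      fact k * (\<Prod>i<length ds. gram n X j (ss ! i) ^ (ds ! i) * ?\<mu> (ds ! i) / fact (ds ! i)))"
    by (rule sum.swap)
  also have "\<dots> = mean_stat k"
    unfolding mean_stat_def
  proof (rule sum.cong[OF refl])
    fix ds assume "ds \<in> comps k"
    then have k: "sum_list ds = k" by (simp add: comps_def)
    have pl: "prod_list (map ?\<mu> ds) = (\<Prod>i<length ds. ?\<mu> (ds ! i))"
      by (simp add: prod.list_conv_set_nth atLeast0LessThan)
    have "(\<Sum>j<p. \<Sum>ss\<in>chains (length ds) p.
        fact k * (\<Prod>i<length ds. gram n X j (ss ! i) ^ (ds ! i) * ?\<mu> (ds ! i) / fact (ds ! i)))
      = (\<Sum>j<p. \<Sum>ss\<in>chains (length ds) p. prod_list (map ?\<mu> ds) *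
          (fact k / (\<Prod>i<length ds. fact (ds ! i)) * (\<Prod>i<length ds. gram n X j (ss ! i) ^ (ds ! i))))"
      by (simp add: prod.distrib prod_dividef pl mult_ac)
    also have "\<dots> = (\<Sum>ss\<in>chains (length ds) p. \<Sum>j<p. prod_list (map ?\<mu> ds) *
          (fact k / (\<Prod>i<length ds. fact (ds ! i)) * (\<Prod>i<length ds. gram n X j (ss ! i) ^ (ds ! i))))"
      by (rule sum.swap)
    also have "\<dots> = prod_list (map ?\<mu> ds) * gamma_coeff n p X ds"
      unfolding gamma_coeff_def chains_def[symmetric] k by (simp only: sum_distrib_left)
    finally show "(\<Sum>j<p. \<Sum>ss\<in>chains (length ds) p.
        fact k * (\<Prod>i<length ds. gram n X j (ss ! i) ^ (ds ! i) * ?\<mu> (ds ! i) / fact (ds ! i)))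
      = prod_list (map ?\<mu> ds) * gamma_coeff n p X ds" .
  qed
  finally show ?thesis .
qed

text \<open>The error splits into the fluctuation at the exact mean, of order p T^(2 k), and the
  effect of the shift by \<open>mean_err\<close>, of order (p^2 / r + (p / r)^k) T^(2 k).\<close>

lemma stat_error:
  assumes k: "2 \<le> k"
  shows "all_moments \<Omega> (stat k)"
    and "(\<integral>\<omega>. (stat k \<omega> - mean_stat k)\<^sup>2 \<partial>\<Omega>)
      \<le> (10 * (max 1 M0)\<^sup>2 * real k ^ 4 + 4 * (real k)\<^sup>2 * 4 ^ k) * ((real p)\<^sup>2 / r * (real p / r) ^ k)
        * (3 * (24 * (real k)\<^sup>2 * max 1 M0 * (\<kappa> * T)) ^ (2 * k))"
proof -
  interpret H: hermite_sum \<Omega> \<xi> "n + p" "max 1 M0" loading noise_var p k T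
    by (rule hermite_sum[OF k])
  let ?m = "max 1 M0"
  have u: "H.u j \<omega> = score j \<omega>" for j \<omega>
    by (simp add: H.u_def score_def)
  have mom_err: "all_moments \<Omega> mean_err"
    unfolding mean_err_eq[abs_def] by (rule H.all_moments_linear) simp
  have mom_score: "all_moments \<Omega> (score j)" for j
    using H.moments_u(1)[of j] by (simp add: u[abs_def])
  show mom: "all_moments \<Omega> (stat k)"
    using k unfolding stat_eq[OF order_trans[OF one_le_numeral k], abs_def]
    by (intro H.all_moments_sum H.all_moments_hpoly H.all_moments_add H.all_moments_mult
        H.all_moments_const mom_err mom_score)
  have EF: "H.expectation H.F = mean_stat k"
    using expectation_score[of k] by (simp add: H.F_def[abs_def] u)
  have var: "H.expectation (\<lambda>\<omega>. (H.F \<omega> - mean_stat k)\<^sup>2) \<le> 5 * ?m\<^sup>2 * real k ^ 4 * real p * H.Q 1"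
    using H.variance_F_le
      H.variance_eq[OF all_moments_integrable[OF H.moments_F(1)] H.all_moments_integrable_square[OF H.moments_F(1)]]
    by (simp add: EF)
  let ?S = "\<lambda>\<omega>. \<Sum>j<p. hpoly (noise_var j) (score j \<omega> + mean_err \<omega> * row_sum j) k - hpoly (noise_var j) (score j \<omega>) k"
  have shift: "H.expectation (\<lambda>\<omega>. (?S \<omega>)\<^sup>2) \<le> (real k)\<^sup>2 * 4 ^ k * ((real p)\<^sup>2 / r + (real p / r) ^ k) * H.Q \<kappa>"
    using H.expectation_shift_square_le[OF _ _ row_sum_square_le _ mean_err_coeff_le] r_props p_ge
    unfolding u mean_err_eq[symmetric] by (simp add: \<kappa>_def)
  have mom_S: "all_moments \<Omega> ?S"
    by (intro H.all_moments_sum H.all_moments_diff H.all_moments_hpoly H.all_moments_add H.all_moments_mult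
        H.all_moments_const mom_err mom_score)
  have dec: "stat k \<omega> - mean_stat k = (H.F \<omega> - mean_stat k) + ?S \<omega>" for \<omega>
    using k by (simp add: stat_eq H.F_def u sum_subtractf)
  have "(stat k \<omega> - mean_stat k)\<^sup>2 \<le> 2 * (H.F \<omega> - mean_stat k)\<^sup>2 + 2 * (?S \<omega>)\<^sup>2" for \<omega>
    unfolding dec by (rule square_add_le)
  then have "H.expectation (\<lambda>\<omega>. (stat k \<omega> - mean_stat k)\<^sup>2)
      \<le> H.expectation (\<lambda>\<omega>. 2 * (H.F \<omega> - mean_stat k)\<^sup>2 + 2 * (?S \<omega>)\<^sup>2)"
    by (intro integral_mono all_moments_integrable H.all_moments_power H.all_moments_add H.all_moments_diff
        H.all_moments_mult H.all_moments_const H.moments_F mom mom_S)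
  also have "\<dots> = 2 * H.expectation (\<lambda>\<omega>. (H.F \<omega> - mean_stat k)\<^sup>2) + 2 * H.expectation (\<lambda>\<omega>. (?S \<omega>)\<^sup>2)"
    using H.all_moments_integrable_square[OF mom_S] H.all_moments_integrable_square[OF H.all_moments_diff[OF H.moments_F(1) H.all_moments_const]]
    by simp
  also have "\<dots> \<le> 2 * (5 * ?m\<^sup>2 * real k ^ 4 * real p * H.Q 1)
      + 2 * ((real k)\<^sup>2 * 4 ^ k * ((real p)\<^sup>2 / r + (real p / r) ^ k) * H.Q \<kappa>)"
    by (intro add_mono mult_left_mono var shift) auto
  also have "\<dots> \<le> 2 * (5 * ?m\<^sup>2 * real k ^ 4 * ((real p)\<^sup>2 / r * (real p / r) ^ k) * H.Q \<kappa>)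
      + 2 * ((real k)\<^sup>2 * 4 ^ k * (2 * ((real p)\<^sup>2 / r * (real p / r) ^ k)) * H.Q \<kappa>)"
  proof -
    \<comment> \<open>Since r <= p, each of p, p^2 / r and (p / r)^k is at most the product of the
      last two, so one term bounds both errors.\<close>
    have \<rho>: "1 \<le> real p / r" using r_props by simp
    then have \<rho>k: "1 \<le> (real p / r) ^ k" by (rule one_le_power)
    have p2: "real p \<le> (real p)\<^sup>2 / r"
      using r_props by (simp add: field_simps power2_eq_square mult_right_mono)
    have p1: "1 \<le> (real p)\<^sup>2 / r" using p2 p_ge by linarith
    have a: "(real p)\<^sup>2 / r \<le> (real p)\<^sup>2 / r * (real p / r) ^ k"
      using mult_left_mono[OF \<rho>k, of "(real p)\<^sup>2 / r"] p1 by simp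
    have b: "(real p / r) ^ k \<le> (real p)\<^sup>2 / r * (real p / r) ^ k"
      using mult_right_mono[OF p1, of "(real p / r) ^ k"] \<rho>k by simp
    have Q: "H.Q 1 \<le> H.Q \<kappa>"
      unfolding H.Q_def using T_pos by (intro mult_left_mono power_mono mult_right_mono) (auto simp: \<kappa>_def)
    show ?thesis
      using a b p2 Q H.Q_nonneg r_props
      by (intro add_mono mult_left_mono mult_mono) auto
  qed
  also have "\<dots> = (10 * ?m\<^sup>2 * real k ^ 4 + 4 * (real k)\<^sup>2 * 4 ^ k) * ((real p)\<^sup>2 / r * (real p / r) ^ k) * H.Q \<kappa>"
    by (simp add: algebra_simps)
  finally show "(\<integral>\<omega>. (stat k \<omega> - mean_stat k)\<^sup>2 \<partial>\<Omega>)
      \<le> (10 * (max 1 M0)\<^sup>2 * real k ^ 4 + 4 * (real k)\<^sup>2 * 4 ^ k) * ((real p)\<^sup>2 / r * (real p / r) ^ k)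
        * (3 * (24 * (real k)\<^sup>2 * max 1 M0 * (\<kappa> * T)) ^ (2 * k))"
    by (simp only: H.Q_def)
qed

end

section \<open>Propagation of errors through the recursion\<close>

text \<open>Deleting the last part \<open>d\<close> leaves a composition of \<open>k - d\<close>,
  and the powers of 2 below 2^k add up to less than 2^k.\<close>

lemma card_comps_le: "card (comps k) \<le> 2 ^ k"
proof (induction k rule: less_induct)
  case (less k)
  show ?case
  proof (cases "k = 0")
    case False
    then have "comps k = {ds \<in> comps k. ds \<noteq> []}" by (auto simp: comps_def)
    then have "card (comps k) = card (\<Union>d\<in>{2..k}. (\<lambda>ds. ds @ [d]) ` comps (k - d))"
      unfolding comps_snoc[symmetric] by (rule arg_cong)
    also have "\<dots> \<le> (\<Sum>d\<in>{2..k}. card ((\<lambda>ds. ds @ [d]) ` comps (k - d)))"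
      by (rule card_UN_le) simp
    also have "\<dots> \<le> (\<Sum>d\<in>{2..k}. 2 ^ (k - d))"
    proof (rule sum_mono)
      fix d assume "d \<in> {2..k}"
      then have "card (comps (k - d)) \<le> 2 ^ (k - d)" by (intro less) auto
      then show "card ((\<lambda>ds. ds @ [d]) ` comps (k - d)) \<le> 2 ^ (k - d)"
        using card_image_le[OF finite_comps, of "\<lambda>ds. ds @ [d]" "k - d"] by linarith
    qed
    also have "\<dots> = (\<Sum>i\<in>(\<lambda>d. k - d) ` {2..k}. 2 ^ i)"
      by (subst sum.reindex) (auto simp: inj_on_def)
    also have "\<dots> \<le> (\<Sum>i\<in>{..<k}. 2 ^ i)"
      using False by (intro sum_mono2) auto
    also have "\<dots> \<le> 2 ^ k"
      using sum_power2[of k] by (simp add: atLeast0LessThan)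
    finally show ?thesis .
  qed (simp add: comps_0)
qed

text \<open>Telescoping over the factors. As \<open>1 \<le> b d\<close>, the factor missing from
  each term can be filled in, so that all terms carry the same full product. The second conjunct is
  what the induction needs.\<close>

lemma prod_list_diff_le:
  fixes x y b :: "'a \<Rightarrow> real"
  assumes "\<And>d. d \<in> set ds \<Longrightarrow> \<bar>x d\<bar> \<le> b d \<and> \<bar>y d\<bar> \<le> b d \<and> 1 \<le> b d"
  shows "\<bar>prod_list (map x ds) - prod_list (map y ds)\<bar>
      \<le> sum_list (map (\<lambda>d. \<bar>x d - y d\<bar>) ds) * prod_list (map b ds)
    \<and> \<bar>prod_list (map y ds)\<bar> \<le> prod_list (map b ds)"
  using assms
proof (induction ds)
  case (Cons d ds)
  let ?P = "prod_list (map x ds)" and ?R = "prod_list (map y ds)" and ?b = "prod_list (map b ds)"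
    and ?S = "sum_list (map (\<lambda>d. \<bar>x d - y d\<bar>) ds)"
  have prems: "\<And>d. d \<in> set ds \<Longrightarrow> \<bar>x d\<bar> \<le> b d \<and> \<bar>y d\<bar> \<le> b d \<and> 1 \<le> b d"
    using Cons.prems by simp
  then have IH: "\<bar>?P - ?R\<bar> \<le> ?S * ?b" "\<bar>?R\<bar> \<le> ?b" using Cons.IH by blast+
  have d: "\<bar>x d\<bar> \<le> b d" "\<bar>y d\<bar> \<le> b d" "1 \<le> b d" using Cons.prems[of d] by auto
  have b0: "0 \<le> ?b" using IH(2) by linarith
  have "\<bar>x d * ?P - y d * ?R\<bar> = \<bar>x d * (?P - ?R) + (x d - y d) * ?R\<bar>"
    by (simp add: algebra_simps)
  also have "\<dots> \<le> \<bar>x d\<bar> * \<bar>?P - ?R\<bar> + \<bar>x d - y d\<bar> * \<bar>?R\<bar>"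
    by (rule order_trans[OF abs_triangle_ineq]) (simp add: abs_mult)
  also have "\<dots> \<le> b d * (?S * ?b) + \<bar>x d - y d\<bar> * (b d * ?b)"
  proof (rule add_mono)
    show "\<bar>x d\<bar> * \<bar>?P - ?R\<bar> \<le> b d * (?S * ?b)"
      using d IH by (intro mult_mono) auto
    have "\<bar>?R\<bar> \<le> b d * ?b" using IH(2) mult_right_mono[OF d(3) b0] by simp
    then show "\<bar>x d - y d\<bar> * \<bar>?R\<bar> \<le> \<bar>x d - y d\<bar> * (b d * ?b)" by (rule mult_left_mono) simp
  qed
  finally have "\<bar>prod_list (map x (d # ds)) - prod_list (map y (d # ds))\<bar>
      \<le> sum_list (map (\<lambda>d. \<bar>x d - y d\<bar>) (d # ds)) * prod_list (map b (d # ds))"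
    by (simp add: algebra_simps)
  moreover have "\<bar>prod_list (map y (d # ds))\<bar> \<le> prod_list (map b (d # ds))"
    using d IH b0 by (auto simp: abs_mult intro!: mult_mono)
  ultimately show ?case by blast
qed simp_all

lemma prod_list_measurable:
  fixes f :: "'b \<Rightarrow> 'c \<Rightarrow> real"
  assumes "\<And>d. d \<in> set ds \<Longrightarrow> f d \<in> borel_measurable N"
  shows "(\<lambda>y. prod_list (map (\<lambda>d. f d y) ds)) \<in> borel_measurable N"
  using assms by (induction ds) auto

text \<open>The range of \<open>t\<close> in \<open>mu_hat\<close> leaves out exactly the
  composition with one part.\<close>

lemma comps_diff_singleton:
  assumes "2 \<le> k"
  shows "comps k - {[k]} = (\<Union>t\<in>{2..k}. {ds. length ds = t \<and> sum_list ds = k \<and> (\<forall>d\<in>set ds. 2 \<le> d)})"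
proof -
  have len: "length ds \<in> {2..k}" if "ds \<in> comps k" "ds \<noteq> [k]" for ds
  proof -
    have l0: "length ds \<noteq> 0" and l1: "length ds \<noteq> 1"
      using that assms by (auto simp: comps_def length_Suc_conv)
    have "2 \<le> length ds" using l0 l1 by linarith
    moreover have "length ds \<le> k" using that length_le_sum_list[of ds] by (auto simp: comps_def)
    ultimately show ?thesis by simp
  qed
  have "comps k - {[k]} = {ds \<in> comps k. length ds \<in> {2..k}}"
  proof (intro equalityI subsetI)
    fix ds assume "ds \<in> comps k - {[k]}"
    then show "ds \<in> {ds \<in> comps k. length ds \<in> {2..k}}" using len[of ds] by blast
  qed auto
  then show ?thesis by (auto simp: comps_def)
qed

lemma mu_hat_comps:
  assumes "2 \<le> k"
  shows "mu_hat n p X \<sigma> y k = (F_stat n p X \<sigma> k (y_hat n p X y)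
    - (\<Sum>ds\<in>comps k - {[k]}. prod_list (map (mu_hat n p X \<sigma> y) ds) * gamma_coeff n p X ds)) / A_sum n p X k"
proof -
  have "finite {ds. length ds = t \<and> sum_list ds = k \<and> (\<forall>d\<in>set ds. 2 \<le> d)}" for t
    by (rule finite_subset[OF _ finite_comps[of k]]) (auto simp: comps_def)
  then have "(\<Sum>ds\<in>comps k - {[k]}. prod_list (map (mu_hat n p X \<sigma> y) ds) * gamma_coeff n p X ds)
      = (\<Sum>t=2..k. \<Sum>ds\<in>{ds. length ds = t \<and> sum_list ds = k \<and> (\<forall>d\<in>set ds. 2 \<le> d)}.
          prod_list (map (mu_hat n p X \<sigma> y) ds) * gamma_coeff n p X ds)"
    unfolding comps_diff_singleton[OF assms] by (intro sum.UNION_disjoint) auto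
  then show ?thesis by (subst mu_hat.simps) simp
qed

lemma mem_comps_bound:
  assumes "ds \<in> comps k - {[k]}" "d \<in> set ds"
  shows "2 \<le> d" "d < k"
proof -
  show d2: "2 \<le> d" using assms by (auto simp: comps_def)
  obtain us vs where ds: "ds = us @ d # vs" using assms(2) by (meson split_list)
  have sum: "sum_list us + d + sum_list vs = k" using assms(1) ds by (auto simp: comps_def)
  show "d < k"
  proof (rule ccontr)
    assume "\<not> d < k"
    then have us: "sum_list us = 0" and vs: "sum_list vs = 0" and "d = k" using sum by auto
    have "\<forall>e\<in>set us. 2 \<le> e" "\<forall>e\<in>set vs. 2 \<le> e" using assms(1) ds by (auto simp: comps_def)
    from this[THEN length_le_sum_list] have "length us = 0" "length vs = 0"
      using us vs by linarith+
    then show False using assms(1) ds \<open>d = k\<close> by auto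
  qed
qed

lemma gamma_coeff_singleton: "gamma_coeff n p X [k] = A_sum n p X k"
proof -
  have "{ss. length ss = length [k] \<and> sorted_wrt (<) ss \<and> set ss \<subseteq> {..<p}} = (\<lambda>s. [s]) ` {..<p}"
    by (auto simp: length_Suc_conv)
  then have "gamma_coeff n p X [k] = (\<Sum>s<p. \<Sum>j<p. gram n X j s ^ k)"
    unfolding gamma_coeff_def by (simp add: sum.reindex inj_on_def)
  then show ?thesis by (simp add: A_sum_def gram_commute[of n X])
qed

context regression
begin

abbreviation "\<mu> \<equiv> central_moment g"

lemma mean_stat_eq:
  assumes "2 \<le> k"
  shows "mean_stat k = \<mu> k * A_sum n p X k + (\<Sum>ds\<in>comps k - {[k]}. prod_list (map \<mu> ds) * gamma_coeff n p X ds)"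
proof -
  have "[k] \<in> comps k" using assms by (simp add: comps_def)
  then show ?thesis
    unfolding mean_stat_def
    by (subst sum.remove[OF finite_comps]) (auto simp: gamma_coeff_singleton)
qed

definition est :: "nat \<Rightarrow> rvec \<times> rvec \<Rightarrow> real" where
  "est k \<omega> = mu_hat n p X \<sigma> (response n p X \<omega>) k"

text \<open>\<open>est k\<close> and \<open>\<mu> k\<close> solve the same equation, with estimates
  and with true moments respectively; this is the difference of the two solutions.\<close>

lemma est_error:
  assumes "2 \<le> k" "A_sum n p X k \<noteq> 0"
  shows "est k \<omega> - \<mu> k = (stat k \<omega> - mean_stat k
    - (\<Sum>ds\<in>comps k - {[k]}. (prod_list (map (\<lambda>d. est d \<omega>) ds) - prod_list (map \<mu> ds)) * gamma_coeff n p X ds))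
    / A_sum n p X k"
proof -
  have "est k \<omega> = (stat k \<omega>
    - (\<Sum>ds\<in>comps k - {[k]}. prod_list (map (\<lambda>d. est d \<omega>) ds) * gamma_coeff n p X ds)) / A_sum n p X k"
    unfolding est_def stat_def by (rule mu_hat_comps[OF assms(1)])
  then show ?thesis
    using assms(2) by (simp add: mean_stat_eq[OF assms(1)] field_simps sum_subtractf)
qed

lemma abs_central_moment_le: "\<bar>\<mu> d\<bar> \<le> fact d * max 1 M0 ^ d"
proof -
  interpret indep_system \<Omega> \<xi> "n + p" "max 1 M0" by (rule indep_system)
  show ?thesis using moment_le[of n d] p_ge by (simp add: xi_moment)
qed

text \<open>
  \<open>good k\<close> mentions the unknown moments, but these are constants, so it is an event in the
  sigma-algebra of the response.
\<close>

definition good :: "nat \<Rightarrow> (rvec \<times> rvec) set" where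
  "good k = {\<omega> \<in> space \<Omega>. \<forall>d\<in>{2..<k}. \<bar>est d \<omega> - \<mu> d\<bar> \<le> 1}"

text \<open>On \<open>good k\<close> all factors are bounded, so a product of estimates is Lipschitz
  in them. The error is thus linear in the lower errors, which second moments can handle.\<close>

lemma correction_le:
  assumes k: "2 \<le> k" and \<omega>: "\<omega> \<in> good k" and ds: "ds \<in> comps k - {[k]}"
  shows "\<bar>prod_list (map (\<lambda>d. est d \<omega>) ds) - prod_list (map \<mu> ds)\<bar>
    \<le> real k * (2 * real k * max 1 M0) ^ k * (\<Sum>d\<in>{2..<k}. \<bar>est d \<omega> - \<mu> d\<bar>)"
proof -
  \<comment> \<open>With M = \<open>max 1 M0\<close>, |\<mu>_d| <= d! M^d <= (k M)^d, and an
    estimate at distance at most 1 is below (k M)^d + 1 <= (2 k M)^d.\<close>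
  let ?b = "2 * real k * max 1 M0"
  let ?S = "\<Sum>d\<in>{2..<k}. \<bar>est d \<omega> - \<mu> d\<bar>"
  have b1: "1 \<le> ?b"
    using k mult_mono[of 1 "2 * real k" 1 "max 1 M0"] by simp
  have bd: "\<bar>est d \<omega>\<bar> \<le> ?b ^ d \<and> \<bar>\<mu> d\<bar> \<le> ?b ^ d \<and> 1 \<le> ?b ^ d" if "d \<in> set ds" for d
  proof -
    have d: "2 \<le> d" "d < k" using mem_comps_bound[OF ds that] by auto
    let ?c = "real k * max 1 M0"
    have c1: "1 \<le> ?c" using k mult_mono[of 1 "real k" 1 "max 1 M0"] by simp
    have "\<bar>\<mu> d\<bar> \<le> real k ^ d * max 1 M0 ^ d"
      using d fact_le_power_real[of d k] by (intro order_trans[OF abs_central_moment_le mult_right_mono]) auto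
    then have m: "\<bar>\<mu> d\<bar> \<le> ?c ^ d" by (simp add: power_mult_distrib)
    have "\<bar>est d \<omega> - \<mu> d\<bar> \<le> 1" using \<omega> d by (auto simp: good_def)
    then have "\<bar>est d \<omega>\<bar> \<le> ?c ^ d + 1" using m by linarith
    also have "\<dots> \<le> 2 * ?c ^ d" using one_le_power[OF c1, of d] by simp
    also have "\<dots> \<le> 2 ^ d * ?c ^ d"
      using d c1 self_le_power[of "2::real" d] by (intro mult_right_mono) auto
    also have "\<dots> = (2 * ?c) ^ d" by (rule power_mult_distrib[symmetric])
    also have "2 * ?c = ?b" by simp
    finally have "\<bar>est d \<omega>\<bar> \<le> ?b ^ d" .
    moreover have "\<bar>\<mu> d\<bar> \<le> ?b ^ d"
      using c1 by (intro order_trans[OF m] power_mono) auto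
    moreover have "1 \<le> ?b ^ d" using b1 by (rule one_le_power)
    ultimately show ?thesis by blast
  qed
  have "prod_list (map (\<lambda>d. ?b ^ d) ds) = ?b ^ sum_list ds"
    by (induction ds) (auto simp: power_add)
  then have prod_b: "prod_list (map (\<lambda>d. ?b ^ d) ds) = ?b ^ k"
    using ds by (simp add: comps_def)
  have S0: "0 \<le> ?S" by (rule sum_nonneg) simp
  have "sum_list (map (\<lambda>d. \<bar>est d \<omega> - \<mu> d\<bar>) ds) \<le> sum_list (map (\<lambda>d. ?S) ds)"
  proof (rule sum_list_mono)
    fix d assume "d \<in> set ds"
    then have "2 \<le> d" "d < k" using mem_comps_bound[OF ds] by auto
    then show "\<bar>est d \<omega> - \<mu> d\<bar> \<le> ?S" by (intro member_le_sum) auto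
  qed
  also have "\<dots> = real (length ds) * ?S" by (simp add: sum_list_triv)
  also have "\<dots> \<le> real k * ?S"
    using ds length_le_sum_list[of ds] S0 by (intro mult_right_mono) (auto simp: comps_def)
  finally have S: "sum_list (map (\<lambda>d. \<bar>est d \<omega> - \<mu> d\<bar>) ds) \<le> real k * ?S" .
  have "\<bar>prod_list (map (\<lambda>d. est d \<omega>) ds) - prod_list (map \<mu> ds)\<bar>
      \<le> sum_list (map (\<lambda>d. \<bar>est d \<omega> - \<mu> d\<bar>) ds) * ?b ^ k"
    using prod_list_diff_le[of ds "\<lambda>d. est d \<omega>" "\<lambda>d. ?b ^ d" \<mu>] bd by (simp only: prod_b)
  also have "\<dots> \<le> real k * ?S * ?b ^ k"
    using b1 by (intro mult_right_mono S) auto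
  finally show ?thesis by (simp only: mult_ac)
qed

text \<open>The factor in front of the sum collects at most 2^k compositions, k^k for the factorial
  in \<open>gamma_coeff_le\<close>, k (2 k M)^k from \<open>correction_le\<close>, and a^(-k) from
  the lower bound on \<open>A_sum\<close>; the single k is rounded up to k^k. Later \<open>a\<close>
  will be \<open>c / \<rho>\<close>.\<close>

lemma est_error_le:
  assumes k: "2 \<le> k" and \<omega>: "\<omega> \<in> good k"
    and a: "0 < a" "real p * a ^ k * B ^ (2 * k) \<le> A_sum n p X k"
  shows "\<bar>est k \<omega> - \<mu> k\<bar> \<le> \<bar>stat k \<omega> - mean_stat k\<bar> / A_sum n p X k
    + (4 * max 1 M0 / a) ^ k * real k ^ (3 * k) * (\<Sum>d\<in>{2..<k}. \<bar>est d \<omega> - \<mu> d\<bar>)"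
proof -
  let ?A = "A_sum n p X k" and ?S = "\<Sum>d\<in>{2..<k}. \<bar>est d \<omega> - \<mu> d\<bar>"
  let ?b = "2 * real k * max 1 M0"
  have base_pos: "0 < real p * a ^ k * B ^ (2 * k)" using a p_ge B_pos by simp
  then have A: "0 < ?A" using a(2) by linarith
  have S0: "0 \<le> ?S" by (rule sum_nonneg) simp
  have \<gamma>: "\<bar>gamma_coeff n p X ds\<bar> / ?A \<le> real k ^ k / a ^ k" if "ds \<in> comps k - {[k]}" for ds
  proof -
    have "\<bar>gamma_coeff n p X ds\<bar> \<le> fact k * (real p * B ^ (2 * k))"
      using that by (intro gamma_coeff_le) auto
    also have "\<dots> \<le> real k ^ k * (real p * B ^ (2 * k))"
      by (intro mult_right_mono fact_le_power_real) auto
    also have "\<dots> = real k ^ k / a ^ k * (real p * a ^ k * B ^ (2 * k))" using a by simp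
    also have "\<dots> \<le> real k ^ k / a ^ k * ?A" using a by (intro mult_left_mono) auto
    finally show ?thesis using A by (simp add: divide_le_eq)
  qed
  let ?D = "\<lambda>ds. prod_list (map (\<lambda>d. est d \<omega>) ds) - prod_list (map \<mu> ds)"
  let ?K = "real k * ?b ^ k * ?S * (real k ^ k / a ^ k)"
  have K0: "0 \<le> ?K" using S0 a by (intro mult_nonneg_nonneg) auto
  have "\<bar>\<Sum>ds\<in>comps k - {[k]}. ?D ds * (gamma_coeff n p X ds / ?A)\<bar> \<le> (\<Sum>ds\<in>comps k - {[k]}. ?K)"
  proof (rule order_trans[OF sum_abs sum_mono])
    fix ds assume ds: "ds \<in> comps k - {[k]}"
    have "\<bar>?D ds * (gamma_coeff n p X ds / ?A)\<bar> = \<bar>?D ds\<bar> * (\<bar>gamma_coeff n p X ds\<bar> / ?A)"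
      using A by (simp add: abs_mult)
    also have "\<dots> \<le> ?K"
      using correction_le[OF k \<omega> ds] \<gamma>[OF ds] A S0 by (intro mult_mono) auto
    finally show "\<bar>?D ds * (gamma_coeff n p X ds / ?A)\<bar> \<le> ?K" .
  qed
  also have "\<dots> \<le> 2 ^ k * ?K"
  proof -
    have "card (comps k - {[k]}) \<le> card (comps k)" by (rule card_mono[OF finite_comps]) auto
    then have "card (comps k - {[k]}) \<le> 2 ^ k" using card_comps_le[of k] by linarith
    then have "real (card (comps k - {[k]})) \<le> real (2 ^ k)" by (simp only: of_nat_le_iff)
    then have "real (card (comps k - {[k]})) \<le> 2 ^ k" by simp
    then have "real (card (comps k - {[k]})) * ?K \<le> 2 ^ k * ?K" by (rule mult_right_mono[OF _ K0])
    then show ?thesis by (simp only: sum_constant)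
  qed
  also have "2 ^ k * ?K = real k * ((4 * max 1 M0 / a) ^ k * (real k ^ k * real k ^ k)) * ?S"
  proof -
    have "(4::real) ^ k = 2 ^ k * 2 ^ k" by (simp add: power_mult_distrib[symmetric])
    then have e1: "(4 * max 1 M0 / a) ^ k = 2 ^ k * 2 ^ k * max 1 M0 ^ k / a ^ k"
      by (simp only: power_divide power_mult_distrib)
    have e2: "?b ^ k = 2 ^ k * real k ^ k * max 1 M0 ^ k"
      by (simp only: power_mult_distrib)
    show ?thesis unfolding e1 e2 by (simp add: mult_ac)
  qed
  also have "\<dots> \<le> real k ^ k * ((4 * max 1 M0 / a) ^ k * (real k ^ k * real k ^ k)) * ?S"
    using k a S0 self_le_power[of "real k" k] by (intro mult_right_mono mult_nonneg_nonneg) auto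
  also have "\<dots> = (4 * max 1 M0 / a) ^ k * real k ^ (3 * k) * ?S"
  proof -
    have "3 * k = k + (k + k)" by simp
    then have "real k ^ (3 * k) = real k ^ k * (real k ^ k * real k ^ k)"
      by (simp only: power_add)
    then show ?thesis by simp
  qed
  finally have corr: "\<bar>\<Sum>ds\<in>comps k - {[k]}. ?D ds * (gamma_coeff n p X ds / ?A)\<bar>
      \<le> (4 * max 1 M0 / a) ^ k * real k ^ (3 * k) * ?S" .
  have "est k \<omega> - \<mu> k = (stat k \<omega> - mean_stat k) / ?A - (\<Sum>ds\<in>comps k - {[k]}. ?D ds * (gamma_coeff n p X ds / ?A))"
    using est_error[OF k, of \<omega>] A by (simp add: diff_divide_distrib sum_divide_distrib)
  moreover have "\<bar>(stat k \<omega> - mean_stat k) / ?A\<bar> = \<bar>stat k \<omega> - mean_stat k\<bar> / ?A"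
    using A by simp
  ultimately show ?thesis using corr by linarith
qed

lemma response_measurable: "response n p X \<in> measurable \<Omega> (\<Pi>\<^sub>M l\<in>{..<n}. borel)"
proof -
  have "response n p X = (\<lambda>\<omega>. \<lambda>l\<in>{..<n}. (\<Sum>j<p. X l j * coord (n + j) \<omega>) + coord l \<omega>)"
    by (auto simp: response_def mat_vec_def coord_def fun_eq_iff)
  moreover have "(\<lambda>\<omega>. \<lambda>l\<in>{..<n}. (\<Sum>j<p. X l j * coord (n + j) \<omega>) + coord l \<omega>)
      \<in> measurable \<Omega> (\<Pi>\<^sub>M l\<in>{..<n}. borel)"
    by (intro measurable_restrict borel_measurable_add borel_measurable_sum borel_measurable_times
        coord_measurable borel_measurable_const) auto
  ultimately show ?thesis by simp
qed

lemma mu_hat_measurable: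
  "2 \<le> k \<Longrightarrow> (\<lambda>y. mu_hat n p X \<sigma> y k) \<in> borel_measurable (\<Pi>\<^sub>M l\<in>{..<n}. borel)"
proof (induction k rule: less_induct)
  case (less k)
  have comp [measurable]: "(\<lambda>y. y l) \<in> borel_measurable (\<Pi>\<^sub>M l\<in>{..<n}. borel)" if "l \<in> {..<n}" for l
    using that by simp
  have m1: "m1_hat n p X \<in> borel_measurable (\<Pi>\<^sub>M l\<in>{..<n}. borel)"
    unfolding m1_hat_def[abs_def] by measurable
  have "(\<lambda>y. y_hat n p X y l) \<in> borel_measurable (\<Pi>\<^sub>M l\<in>{..<n}. borel)" if "l \<in> {..<n}" for l
    unfolding y_hat_def
    by (intro borel_measurable_diff borel_measurable_times borel_measurable_const comp[OF that] m1)
  then have "(\<lambda>y. \<Sum>l<n. X l j * y_hat n p X y l) \<in> borel_measurable (\<Pi>\<^sub>M l\<in>{..<n}. borel)" for j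
    by (intro borel_measurable_sum borel_measurable_times borel_measurable_const) auto
  then have F: "(\<lambda>y. F_stat n p X \<sigma> k (y_hat n p X y)) \<in> borel_measurable (\<Pi>\<^sub>M l\<in>{..<n}. borel)"
    using less.prems
    by (subst F_stat_eq) (auto intro!: borel_measurable_sum measurable_compose[OF _ hpoly_measurable])
  have "(\<lambda>y. prod_list (map (mu_hat n p X \<sigma> y) ds)) \<in> borel_measurable (\<Pi>\<^sub>M l\<in>{..<n}. borel)"
    if "ds \<in> comps k - {[k]}" for ds
    using mem_comps_bound[OF that] less.IH by (intro prod_list_measurable) auto
  then show ?case
    unfolding mu_hat_comps[OF less.prems]
    by (intro borel_measurable_divide borel_measurable_diff borel_measurable_sum borel_measurable_times
        borel_measurable_const F) auto
qed

lemma est_measurable: "2 \<le> k \<Longrightarrow> est k \<in> borel_measurable \<Omega>"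
  unfolding est_def[abs_def] by (rule measurable_compose[OF response_measurable mu_hat_measurable])

lemma good_in_response_algebra: "good k \<in> sets (response_algebra n p X \<sigma> g)"
proof -
  let ?N = "\<Pi>\<^sub>M l\<in>{..<n}. borel :: real measure"
  let ?S = "{y \<in> space ?N. \<forall>d\<in>{2..<k}. \<bar>mu_hat n p X \<sigma> y d - \<mu> d\<bar> \<le> 1}"
  have "?S \<in> sets ?N"
  proof (intro sets.sets_Collect_finite_All)
    fix d assume "d \<in> {2..<k}"
    then have [measurable]: "(\<lambda>y. mu_hat n p X \<sigma> y d) \<in> borel_measurable ?N"
      by (intro mu_hat_measurable) auto
    show "{y \<in> space ?N. \<bar>mu_hat n p X \<sigma> y d - \<mu> d\<bar> \<le> 1} \<in> sets ?N" by measurable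
  qed simp
  then have "response n p X -` ?S \<inter> space \<Omega> \<in> sets (response_algebra n p X \<sigma> g)"
    unfolding response_algebra_def by (rule in_vimage_algebra)
  moreover have "response n p X -` ?S \<inter> space \<Omega> = good k"
    using measurable_space[OF response_measurable] by (auto simp: good_def est_def)
  ultimately show ?thesis by simp
qed

lemma good_sets: "good k \<in> sets \<Omega>"
  unfolding good_def
proof (intro sets.sets_Collect_finite_All)
  fix d assume "d \<in> {2..<k}"
  then have [measurable]: "est d \<in> borel_measurable \<Omega>" by (intro est_measurable) auto
  show "{\<omega> \<in> space \<Omega>. \<bar>est d \<omega> - \<mu> d\<bar> \<le> 1} \<in> sets \<Omega>" by measurable
qed simp

end

section \<open>Choice of the constants and the induction over the order\<close>

lemma stat_constant_le:
  fixes m D :: real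
  assumes "1 \<le> m" "1 \<le> D" "2 \<le> k"
  shows "(10 * m\<^sup>2 * real k ^ 4 + 4 * (real k)\<^sup>2 * 4 ^ k) * (3 * (D * (real k)\<^sup>2) ^ (2 * k))
    \<le> (168 * m\<^sup>2 * D\<^sup>2 * real k) ^ (6 * k)"
proof -
  have k1: "1 \<le> real k" using assms by simp
  have m2: "1 \<le> m\<^sup>2" and D2: "1 \<le> D\<^sup>2" using assms by (auto intro: one_le_power)
  have "10 * m\<^sup>2 * real k ^ 4 + 4 * (real k)\<^sup>2 * 4 ^ k \<le> 10 * m\<^sup>2 * real k ^ (2 * k) + 4 * real k ^ (2 * k) * 4 ^ k"
    using assms k1 by (intro add_mono mult_left_mono mult_right_mono power_increasing) auto
  also have "\<dots> = (10 * m\<^sup>2 + 4 * 4 ^ k) * real k ^ (2 * k)" by (simp add: algebra_simps)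
  also have "\<dots> \<le> (14 * m\<^sup>2 * 4 ^ k) * real k ^ (2 * k)"
  proof (rule mult_right_mono)
    have "10 * m\<^sup>2 * 1 \<le> 10 * m\<^sup>2 * 4 ^ k" by (intro mult_left_mono) auto
    moreover have "4 * 1 * 4 ^ k \<le> 4 * m\<^sup>2 * 4 ^ k" using m2 by (intro mult_right_mono mult_left_mono) auto
    ultimately show "10 * m\<^sup>2 + 4 * 4 ^ k \<le> 14 * m\<^sup>2 * 4 ^ k" by linarith
  qed simp
  finally have "(10 * m\<^sup>2 * real k ^ 4 + 4 * (real k)\<^sup>2 * 4 ^ k) * (3 * (D * (real k)\<^sup>2) ^ (2 * k))
      \<le> (14 * m\<^sup>2 * 4 ^ k * real k ^ (2 * k)) * (3 * (D * (real k)\<^sup>2) ^ (2 * k))"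
    using assms by (intro mult_right_mono) auto
  \<comment> \<open>The exponent \<open>6 * k\<close> is \<open>2 * k\<close> from rounding up k^4
    plus \<open>4 * k\<close> from the envelope. The numbers are \<open>42 = 14 * 3\<close> and,
    once everything is under the power \<open>k\<close>, \<open>168 = 42 * 4\<close>.\<close>
  also have "\<dots> = (42 * m\<^sup>2) * (4 ^ k * (D\<^sup>2) ^ k) * real k ^ (6 * k)"
  proof -
    have "(D * (real k)\<^sup>2) ^ (2 * k) = (D\<^sup>2) ^ k * real k ^ (4 * k)"
      by (simp add: power_mult_distrib flip: power_mult)
    moreover have "real k ^ (6 * k) = real k ^ (2 * k) * real k ^ (4 * k)"
      by (simp flip: power_add)
    ultimately show ?thesis by (simp only: mult_ac)
  qed
  also have "\<dots> \<le> (42 * m\<^sup>2) ^ k * (4 ^ k * (D\<^sup>2) ^ k) * real k ^ (6 * k)"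
  proof (intro mult_right_mono)
    have "1 \<le> 42 * m\<^sup>2" using m2 by simp
    then show "42 * m\<^sup>2 \<le> (42 * m\<^sup>2) ^ k" by (rule self_le_power) (use assms in simp)
  qed auto
  also have "(42 * m\<^sup>2) ^ k * (4 ^ k * (D\<^sup>2) ^ k) = ((42 * m\<^sup>2) * (4 * D\<^sup>2)) ^ k"
    by (simp only: power_mult_distrib)
  also have "(42 * m\<^sup>2) * (4 * D\<^sup>2) = 168 * m\<^sup>2 * D\<^sup>2" by simp
  also have "(168 * m\<^sup>2 * D\<^sup>2) ^ k \<le> (168 * m\<^sup>2 * D\<^sup>2) ^ (6 * k)"
    using mult_mono[OF m2 D2] by (intro power_increasing) auto
  finally have "(10 * m\<^sup>2 * real k ^ 4 + 4 * (real k)\<^sup>2 * 4 ^ k) * (3 * (D * (real k)\<^sup>2) ^ (2 * k))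
      \<le> (168 * m\<^sup>2 * D\<^sup>2) ^ (6 * k) * real k ^ (6 * k)"
    by (simp add: mult_right_mono)
  then show ?thesis by (simp only: power_mult_distrib)
qed

text \<open>\<open>W\<close> plays the role of \<open>Delta\<close> at order k - 1, without 1 / r
  and with k in the base. Here the exponents are consumed: 5 k^2 exceeds 5 (k - 1)^2 by 10 k - 5 >=
  6 k + 3, enough for the squared recursion factor and for \<open>4 * (real k)\<^sup>2\<close>; 2
  k^2 exceeds 2 (k - 1)^2 by 4 k - 2 >= 2 k.\<close>

lemma delta_recursion:
  fixes A C \<rho> :: real
  assumes A: "1 \<le> A" and C: "A + 4 \<le> C" and \<rho>: "1 \<le> \<rho>" and k: "2 \<le> k"
  defines "W \<equiv> (C * real k) ^ (5 * (k - 1)\<^sup>2) * \<rho> ^ (2 * (k - 1)\<^sup>2)"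
  shows "2 * ((A * real k) ^ (6 * k) * \<rho> ^ (3 * k)) + 2 * ((A * real k) ^ (6 * k) * \<rho> ^ (2 * k)) * (real k * (real k * W))
      \<le> (C * real k) ^ (5 * k\<^sup>2) * \<rho> ^ (2 * k\<^sup>2)" (is ?rec)
    and "real k * W \<le> (C * real k) ^ (5 * k\<^sup>2) * \<rho> ^ (2 * k\<^sup>2)" (is ?prob)
proof -
  obtain j where j: "k = j + 2" using k by (metis add.commute le_Suc_ex)
  let ?x = "C * real k" and ?y = "A * real k"
  have k2: "2 \<le> real k" using k by simp
  have y1: "1 \<le> ?y" using mult_mono[OF A, of 1 "real k"] A k by simp
  have x1: "1 \<le> ?x" using mult_mono[of 1 C 1 "real k"] A C k by simp
  have x0: "0 \<le> ?x ^ i" for i using x1 by (intro zero_le_power) linarith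
  have yx: "?y ^ (6 * k) \<le> ?x ^ (6 * k)" using A C by (intro power_mono mult_right_mono) auto
  \<comment> \<open>The summand \<open>4\<close> in \<open>A + 4 \<le> C\<close> pays for
    this.\<close>
  have x3: "4 * (real k)\<^sup>2 \<le> ?x ^ 3"
  proof -
    have "4 * (real k)\<^sup>2 * 1 \<le> (C ^ 3) * (real k)\<^sup>2 * real k"
    proof (intro mult_mono)
      have "4 \<le> C" using A C by simp
      also have "C \<le> C ^ 3" using A C by (intro self_le_power) auto
      finally show "4 \<le> C ^ 3" .
    qed (use A C k in auto)
    then show ?thesis by (simp add: power_mult_distrib power2_eq_square power3_eq_cube mult_ac)
  qed
  have key: "4 * (real k)\<^sup>2 * ?y ^ (6 * k) \<le> ?x ^ (10 * k - 5)"
  proof -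
    have "4 * (real k)\<^sup>2 * ?y ^ (6 * k) \<le> ?x ^ 3 * ?x ^ (6 * k)"
      using x3 yx y1 x1 by (intro mult_mono) auto
    also have "\<dots> = ?x ^ (6 * k + 3)" by (simp add: power_add)
    also have "\<dots> \<le> ?x ^ (10 * k - 5)" using x1 k by (intro power_increasing) auto
    finally show ?thesis .
  qed
  have sq: "5 * (k - 1)\<^sup>2 + (10 * k - 5) = 5 * k\<^sup>2" "2 * k + 2 * (k - 1)\<^sup>2 \<le> 2 * k\<^sup>2" "3 * k \<le> 2 * k\<^sup>2" "10 * k - 5 \<le> 5 * k\<^sup>2"
    unfolding j by (auto simp: power2_eq_square algebra_simps)
  have W0: "0 \<le> W" using x1 \<rho> by (simp add: W_def)
  have 1: "4 * (?y ^ (6 * k) * \<rho> ^ (3 * k)) \<le> ?x ^ (5 * k\<^sup>2) * \<rho> ^ (2 * k\<^sup>2)"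
  proof -
    have "4 * ?y ^ (6 * k) \<le> 4 * (real k)\<^sup>2 * ?y ^ (6 * k)"
      using k2 y1 one_le_power[of "real k" 2] by (intro mult_right_mono) auto
    also have "\<dots> \<le> ?x ^ (10 * k - 5)" by (rule key)
    also have "\<dots> \<le> ?x ^ (5 * k\<^sup>2)" using x1 sq by (intro power_increasing) auto
    finally have "4 * ?y ^ (6 * k) \<le> ?x ^ (5 * k\<^sup>2)" .
    then have "4 * ?y ^ (6 * k) * \<rho> ^ (3 * k) \<le> ?x ^ (5 * k\<^sup>2) * \<rho> ^ (2 * k\<^sup>2)"
      by (rule mult_mono[OF _ power_increasing[OF sq(3) \<rho>]]) (use x0 \<rho> in auto)
    then show ?thesis by (simp only: mult.assoc)
  qed
  have 2: "4 * (?y ^ (6 * k) * \<rho> ^ (2 * k)) * (real k * (real k * W)) \<le> ?x ^ (5 * k\<^sup>2) * \<rho> ^ (2 * k\<^sup>2)"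
  proof -
    have "4 * (?y ^ (6 * k) * \<rho> ^ (2 * k)) * (real k * (real k * W))
        = (4 * (real k)\<^sup>2 * ?y ^ (6 * k)) * ?x ^ (5 * (k - 1)\<^sup>2) * (\<rho> ^ (2 * k) * \<rho> ^ (2 * (k - 1)\<^sup>2))"
      by (simp only: W_def power2_eq_square[of "real k"] mult_ac)
    also have "\<dots> = (4 * (real k)\<^sup>2 * ?y ^ (6 * k)) * ?x ^ (5 * (k - 1)\<^sup>2) * \<rho> ^ (2 * k + 2 * (k - 1)\<^sup>2)"
      by (simp only: power_add)
    also have "\<dots> \<le> ?x ^ (10 * k - 5) * ?x ^ (5 * (k - 1)\<^sup>2) * \<rho> ^ (2 * k\<^sup>2)"
      by (rule mult_mono[OF mult_right_mono[OF key x0] power_increasing[OF sq(2) \<rho>] mult_nonneg_nonneg[OF x0 x0]])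
         (use \<rho> in simp)
    also have "?x ^ (10 * k - 5) * ?x ^ (5 * (k - 1)\<^sup>2) = ?x ^ (5 * k\<^sup>2)"
      unfolding power_add[symmetric] sq(1)[symmetric] by (simp only: add.commute)
    finally show ?thesis .
  qed
  show ?rec using 1 2 by linarith
  have "real k * W \<le> 4 * (?y ^ (6 * k) * \<rho> ^ (2 * k)) * (real k * (real k * W))"
  proof -
    have "1 * 1 \<le> ?y ^ (6 * k) * \<rho> ^ (2 * k)"
      using y1 \<rho> by (intro mult_mono one_le_power) auto
    then have "1 * 1 \<le> (4 * (?y ^ (6 * k) * \<rho> ^ (2 * k))) * real k"
      using k2 by (intro mult_mono) auto
    then have "1 * (real k * W) \<le> (4 * (?y ^ (6 * k) * \<rho> ^ (2 * k)) * real k) * (real k * W)"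
      using W0 by (intro mult_right_mono) auto
    then show ?thesis by (simp only: mult_ac mult_1)
  qed
  with 2 show ?prob by linarith
qed

lemma sum_square_le_card:
  fixes x :: "'i \<Rightarrow> real"
  shows "(\<Sum>d\<in>D. x d)\<^sup>2 \<le> real (card D) * (\<Sum>d\<in>D. (x d)\<^sup>2)"
  using Cauchy_Schwarz_ineq_sum[of "\<lambda>_. 1" x D] by simp

context regression
begin

text \<open>Capped at 1 so that c^2 <= c0: at k = 2 the hypothesis has only the first power of
  \<open>c0\<close>, and all orders are to share one lower bound with the factor (c /
  \<rho>)^k.\<close>

definition c :: real where "c = min c0 1"

text \<open>The first summand comes from \<open>stat_constant_le\<close> with D = 24 m \<kappa>
  \<tau> / c, the second from \<open>est_error_le\<close> with \<open>a = c / \<rho>\<close>. Only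
  \<open>c0\<close> and \<open>M0\<close> enter.\<close>

definition growth :: real where
  "growth = 168 * (max 1 M0)\<^sup>2 * (24 * max 1 M0 * \<kappa> * \<tau> / c)\<^sup>2 + 4 * max 1 M0 / c"

definition big_C :: real where "big_C = growth + 4"

abbreviation "\<rho> \<equiv> real p / r"

lemma c_props: "0 < c" "c \<le> 1" "c \<le> c0"
  using c0_pos by (auto simp: c_def)

lemma \<kappa>_ge: "1 \<le> \<kappa>" by (simp add: \<kappa>_def)

lemma \<rho>_ge: "1 \<le> \<rho>" using r_props by simp

lemma \<rho>_eq: "\<rho> = max (real p / real n) 1" "1 / \<rho> = min (real n / real p) 1"
  using n_ge p_ge by (auto simp: r_def min_def max_def field_simps)

lemma Delta_eq: "Delta C n p k = (C * real k) ^ (5 * k\<^sup>2) * \<rho> ^ (2 * k\<^sup>2) * (1 / r)"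
  unfolding Delta_def \<rho>_eq r_def[symmetric] by (simp only: mult_ac)

lemma growth_ge:
  shows "1 \<le> 24 * max 1 M0 * \<kappa> * \<tau> / c" and "1 \<le> 4 * max 1 M0 / c" and "1 \<le> growth"
    and "168 * (max 1 M0)\<^sup>2 * (24 * max 1 M0 * \<kappa> * \<tau> / c)\<^sup>2 \<le> growth" and "4 * max 1 M0 / c \<le> growth"
proof -
  have "1 \<le> max 1 M0 * \<kappa>" using mult_mono[of 1 "max 1 M0" 1 \<kappa>] \<kappa>_ge by simp
  then have "1 \<le> max 1 M0 * \<kappa> * \<tau>" using mult_mono[of 1 "max 1 M0 * \<kappa>" 1 \<tau>] \<tau>_ge by simp
  then show "1 \<le> 24 * max 1 M0 * \<kappa> * \<tau> / c"
    using c_props by (simp add: le_divide_eq)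
  show 1: "1 \<le> 4 * max 1 M0 / c"
    using c_props by (simp add: le_divide_eq)
  show "168 * (max 1 M0)\<^sup>2 * (24 * max 1 M0 * \<kappa> * \<tau> / c)\<^sup>2 \<le> growth"
    using 1 by (simp add: growth_def)
  show "4 * max 1 M0 / c \<le> growth" by (simp add: growth_def)
  with 1 show "1 \<le> growth" by linarith
qed

text \<open>One bound for all lower orders, so that summing over them costs only a factor
  \<open>k\<close>.\<close>

lemma Delta_le:
  assumes "d \<in> {2..<k}"
  shows "Delta big_C n p d \<le> (big_C * real k) ^ (5 * (k - 1)\<^sup>2) * \<rho> ^ (2 * (k - 1)\<^sup>2) * (1 / r)"
  unfolding Delta_eq
proof (intro mult_right_mono mult_mono)
  have C1: "1 \<le> big_C" using growth_ge by (simp add: big_C_def)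
  have sq: "d\<^sup>2 \<le> (k - 1)\<^sup>2" using assms by (intro power_mono) auto
  have "(big_C * real d) ^ (5 * d\<^sup>2) \<le> (big_C * real k) ^ (5 * d\<^sup>2)"
    using C1 assms by (intro power_mono mult_left_mono) auto
  also have "\<dots> \<le> (big_C * real k) ^ (5 * (k - 1)\<^sup>2)"
    using sq C1 assms mult_mono[of 1 big_C 1 "real k"] by (intro power_increasing) auto
  finally show "(big_C * real d) ^ (5 * d\<^sup>2) \<le> (big_C * real k) ^ (5 * (k - 1)\<^sup>2)" .
  show "\<rho> ^ (2 * d\<^sup>2) \<le> \<rho> ^ (2 * (k - 1)\<^sup>2)"
    using sq \<rho>_ge by (intro power_increasing) auto
  show "0 \<le> (big_C * real k) ^ (5 * (k - 1)\<^sup>2)" using C1 by simp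
qed (use r_props in auto)

lemma stat_error_ratio:
  assumes k: "2 \<le> k" and A_ge: "real p * (c / \<rho>) ^ k * B ^ (2 * k) \<le> A_sum n p X k"
  shows "(\<integral>\<omega>. (stat k \<omega> - mean_stat k)\<^sup>2 \<partial>\<Omega>) / (A_sum n p X k)\<^sup>2
    \<le> (growth * real k) ^ (6 * k) * \<rho> ^ (3 * k) * (1 / r)"
proof -
  let ?m = "max 1 M0" and ?D = "24 * max 1 M0 * \<kappa> * \<tau> / c"
  let ?A = "real p * (c / \<rho>) ^ k * B ^ (2 * k)"
  let ?K = "10 * ?m\<^sup>2 * real k ^ 4 + 4 * (real k)\<^sup>2 * 4 ^ k"
  have A0: "0 < ?A" using p_ge c_props r_props B_pos by simp
  have "?A\<^sup>2 \<le> (A_sum n p X k)\<^sup>2" using A0 A_ge by (intro power_mono) auto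
  then have "(\<integral>\<omega>. (stat k \<omega> - mean_stat k)\<^sup>2 \<partial>\<Omega>) / (A_sum n p X k)\<^sup>2 \<le> (\<integral>\<omega>. (stat k \<omega> - mean_stat k)\<^sup>2 \<partial>\<Omega>) / ?A\<^sup>2"
  proof (rule divide_left_mono)
    have "0 < A_sum n p X k" using A0 A_ge by linarith
    then show "0 < (A_sum n p X k)\<^sup>2 * ?A\<^sup>2"
      using A0 by (rule mult_pos_pos[OF zero_less_power zero_less_power])
  qed (auto intro!: Bochner_Integration.integral_nonneg)
  also have "\<dots> \<le> ?K * ((real p)\<^sup>2 / r * \<rho> ^ k) * (3 * (24 * (real k)\<^sup>2 * ?m * (\<kappa> * T)) ^ (2 * k)) / ?A\<^sup>2"
    by (intro divide_right_mono stat_error(2)[OF k]) simp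
  also have "\<dots> = ?K * (3 * (?D * (real k)\<^sup>2) ^ (2 * k)) * \<rho> ^ (3 * k) * (1 / r)"
  proof -
    have "(x * y ^ k * z ^ (2 * k))\<^sup>2 = x\<^sup>2 * (y * z\<^sup>2) ^ (2 * k)" for x y z :: real
      by (simp add: power_mult_distrib ac_simps flip: power_mult)
    then have a: "?A\<^sup>2 = (real p)\<^sup>2 * (c / \<rho> * B\<^sup>2) ^ (2 * k)" .
    \<comment> \<open>\<open>T\<close> is rewritten so that the factor
      \<open>c / \<rho> * B\<^sup>2\<close> of the denominator appears and cancels. What stays is
      \<rho>^(2 k), and together with the \<rho>^k of the numerator \<rho>^(3 k).\<close>
    have b: "24 * (real k)\<^sup>2 * ?m * (\<kappa> * T) = (?D * (real k)\<^sup>2) * \<rho> * (c / \<rho> * B\<^sup>2)"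
      unfolding T_def using c_props r_props p_ge by simp
    have d: "\<rho> ^ (3 * k) = \<rho> ^ (2 * k) * \<rho> ^ k" by (simp flip: power_add)
    have nz: "(c / \<rho> * B\<^sup>2) ^ (2 * k) \<noteq> 0" "(real p)\<^sup>2 \<noteq> 0"
      using c_props r_props p_ge B_pos by auto
    have e: "K * (P / r * x) * (3 * (y * z * w)) / (P * w) = K * (3 * y) * (z * x) * (1 / r)"
      if "w \<noteq> 0" "P \<noteq> 0" for K P x y z w :: real
      using that by simp
    show ?thesis
      unfolding a b d power_mult_distrib[of "?D * (real k)\<^sup>2 * \<rho>"] power_mult_distrib[of "?D * (real k)\<^sup>2" \<rho>]
      by (rule e[OF nz])
  qed
  also have "\<dots> \<le> (growth * real k) ^ (6 * k) * \<rho> ^ (3 * k) * (1 / r)"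
  proof (intro mult_right_mono)
    have "?K * (3 * (?D * (real k)\<^sup>2) ^ (2 * k)) \<le> (168 * ?m\<^sup>2 * ?D\<^sup>2 * real k) ^ (6 * k)"
      using growth_ge k by (intro stat_constant_le) auto
    also have "\<dots> \<le> (growth * real k) ^ (6 * k)"
      by (intro power_mono mult_right_mono growth_ge) auto
    finally show "?K * (3 * (?D * (real k)\<^sup>2) ^ (2 * k)) \<le> (growth * real k) ^ (6 * k)" .
  qed (use r_props in auto)
  finally show ?thesis .
qed

text \<open>\<open>good k\<close> is contained in \<open>good d\<close> for d < k, so each lower
  error comes with its own indicator and the induction hypothesis applies to it. Integrability is
  carried along because the integral of a non-integrable function is \<open>0\<close> by
  convention.\<close>

lemma est_risk_le:
  assumes A_ge: "\<And>k. 2 \<le> k \<Longrightarrow> k \<le> k0 \<Longrightarrow> real p * (c / \<rho>) ^ k * B ^ (2 * k) \<le> A_sum n p X k"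
  shows "2 \<le> k \<Longrightarrow> k \<le> k0 \<Longrightarrow>
      integrable \<Omega> (\<lambda>\<omega>. (est k \<omega> - \<mu> k)\<^sup>2 * indicator (good k) \<omega>)
      \<and> (\<integral>\<omega>. (est k \<omega> - \<mu> k)\<^sup>2 * indicator (good k) \<omega> \<partial>\<Omega>) \<le> Delta big_C n p k"
proof (induction k rule: less_induct)
  case (less k)
  interpret prob_space \<Omega> by (rule prob_model)
  let ?e = "\<lambda>d \<omega>. (est d \<omega> - \<mu> d)\<^sup>2 * indicator (good d) \<omega> :: real"
  let ?A = "A_sum n p X k" and ?g = "growth * real k"
  let ?a = "\<lambda>\<omega>. (stat k \<omega> - mean_stat k)\<^sup>2"
  have k: "2 \<le> k" using less.prems by simp
  have "0 < real p * (c / \<rho>) ^ k * B ^ (2 * k)" using p_ge c_props r_props B_pos by simp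
  with A_ge less.prems have A0: "0 < ?A" by fastforce
  have IH: "integrable \<Omega> (?e d)" "expectation (?e d) \<le> Delta big_C n p d" if "d \<in> {2..<k}" for d
    using less.IH[of d] that less.prems by auto
  have int_a: "integrable \<Omega> ?a"
    by (intro all_moments_integrable all_moments_power all_moments_diff all_moments_const stat_error(1)[OF k])
  let ?R = "?g ^ (6 * k) * \<rho> ^ (2 * k)"
  let ?bound = "\<lambda>\<omega>. 2 * (?a \<omega> / ?A\<^sup>2) + 2 * ?R * (real k * (\<Sum>d\<in>{2..<k}. ?e d \<omega>))"
  have R0: "0 \<le> ?R" using growth_ge r_props by simp
  have pointwise: "?e k \<omega> \<le> ?bound \<omega>" for \<omega>
  proof (cases "\<omega> \<in> good k")
    case True
    let ?S = "\<Sum>d\<in>{2..<k}. \<bar>est d \<omega> - \<mu> d\<bar>" and ?c = "(4 * max 1 M0 / (c / \<rho>)) ^ k * real k ^ (3 * k)"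
    have S0: "0 \<le> ?S" by (rule sum_nonneg) simp
    have c0: "0 \<le> ?c" using c_props r_props by simp
    \<comment> \<open>Squaring \<open>real k ^ (3 * k)\<close> is the source of the exponent
      \<open>6 * k\<close>, and squaring \<rho>^k gives \<rho>^(2 k).\<close>
    have c2: "?c\<^sup>2 \<le> ?R"
    proof -
      have "4 * max 1 M0 / (c / \<rho>) = 4 * max 1 M0 / c * \<rho>" by simp
      then have "?c = (4 * max 1 M0 / c) ^ k * real k ^ (3 * k) * \<rho> ^ k"
        by (simp only: power_mult_distrib mult_ac)
      also have "\<dots> \<le> growth ^ (3 * k) * real k ^ (3 * k) * \<rho> ^ k"
      proof (intro mult_right_mono)
        have "(4 * max 1 M0 / c) ^ k \<le> growth ^ k"
          using growth_ge by (intro power_mono) auto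
        also have "\<dots> \<le> growth ^ (3 * k)" using growth_ge by (intro power_increasing) auto
        finally show "(4 * max 1 M0 / c) ^ k \<le> growth ^ (3 * k)" .
      qed (use r_props in auto)
      finally have "?c\<^sup>2 \<le> (growth ^ (3 * k) * real k ^ (3 * k) * \<rho> ^ k)\<^sup>2"
        using c0 by (intro power_mono) auto
      also have "\<dots> = ?R"
        by (simp add: power_mult_distrib mult.commute flip: power_mult)
      finally show ?thesis .
    qed
    have "\<bar>est k \<omega> - \<mu> k\<bar> \<le> \<bar>stat k \<omega> - mean_stat k\<bar> / ?A + ?c * ?S"
      using c_props r_props p_ge less.prems by (intro est_error_le[OF k True _ A_ge]) auto
    then have "\<bar>est k \<omega> - \<mu> k\<bar>\<^sup>2 \<le> (\<bar>stat k \<omega> - mean_stat k\<bar> / ?A + ?c * ?S)\<^sup>2"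
      by (rule power_mono) simp
    also have "\<dots> \<le> 2 * (\<bar>stat k \<omega> - mean_stat k\<bar> / ?A)\<^sup>2 + 2 * (?c * ?S)\<^sup>2"
      by (rule square_add_le)
    also have "(\<bar>stat k \<omega> - mean_stat k\<bar> / ?A)\<^sup>2 = ?a \<omega> / ?A\<^sup>2"
      by (simp add: power_divide)
    also have "2 * (?c * ?S)\<^sup>2 \<le> 2 * ?R * (real k * (\<Sum>d\<in>{2..<k}. ?e d \<omega>))"
    proof -
      have "?S\<^sup>2 \<le> real (card {2..<k}) * (\<Sum>d\<in>{2..<k}. \<bar>est d \<omega> - \<mu> d\<bar>\<^sup>2)"
        by (rule sum_square_le_card)
      also have "\<dots> \<le> real k * (\<Sum>d\<in>{2..<k}. \<bar>est d \<omega> - \<mu> d\<bar>\<^sup>2)"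
        by (intro mult_right_mono sum_nonneg) auto
      also have "(\<Sum>d\<in>{2..<k}. \<bar>est d \<omega> - \<mu> d\<bar>\<^sup>2) = (\<Sum>d\<in>{2..<k}. ?e d \<omega>)"
      proof (rule sum.cong[OF refl])
        fix d assume "d \<in> {2..<k}"
        then have "\<omega> \<in> good d" using True by (auto simp: good_def)
        then show "\<bar>est d \<omega> - \<mu> d\<bar>\<^sup>2 = ?e d \<omega>" by simp
      qed
      finally have "?S\<^sup>2 \<le> real k * (\<Sum>d\<in>{2..<k}. ?e d \<omega>)" .
      with c2 have "?c\<^sup>2 * ?S\<^sup>2 \<le> ?R * (real k * (\<Sum>d\<in>{2..<k}. ?e d \<omega>))"
        by (rule mult_mono[OF _ _ R0]) simp
      then show ?thesis by (simp only: power_mult_distrib mult.assoc)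
    qed
    finally show ?thesis using True by simp
  next
    case False
    have "0 \<le> 2 * (?a \<omega> / ?A\<^sup>2)" by simp
    moreover have "0 \<le> 2 * ?R * (real k * (\<Sum>d\<in>{2..<k}. ?e d \<omega>))"
    proof -
      have "0 \<le> real k * (\<Sum>d\<in>{2..<k}. ?e d \<omega>)" by (intro mult_nonneg_nonneg sum_nonneg) auto
      then have "0 \<le> 2 * (?R * (real k * (\<Sum>d\<in>{2..<k}. ?e d \<omega>)))"
        using mult_nonneg_nonneg[OF R0] by simp
      then show ?thesis by (simp only: mult.assoc)
    qed
    ultimately show ?thesis using False by simp
  qed
  have int_sum: "integrable \<Omega> (\<lambda>\<omega>. \<Sum>d\<in>{2..<k}. ?e d \<omega>)"
    by (intro Bochner_Integration.integrable_sum IH)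
  have int_bound: "integrable \<Omega> ?bound"
    using int_a int_sum by (intro Bochner_Integration.integrable_add integrable_mult_right integrable_divide)
  have [measurable]: "est k \<in> borel_measurable \<Omega>" "good k \<in> sets \<Omega>"
    using est_measurable[OF k] good_sets by auto
  have e0: "0 \<le> ?e k \<omega>" for \<omega> by simp
  have int_e: "integrable \<Omega> (?e k)"
  proof (rule Bochner_Integration.integrable_bound[OF int_bound])
    show "?e k \<in> borel_measurable \<Omega>" by measurable
    show "AE \<omega> in \<Omega>. norm (?e k \<omega>) \<le> norm (?bound \<omega>)"
    proof (rule AE_I2)
      fix \<omega>
      show "norm (?e k \<omega>) \<le> norm (?bound \<omega>)"
        using pointwise[of \<omega>] e0[of \<omega>] unfolding real_norm_def by linarith
    qed
  qed
  let ?W = "(big_C * real k) ^ (5 * (k - 1)\<^sup>2) * \<rho> ^ (2 * (k - 1)\<^sup>2)"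
  have W0: "0 \<le> ?W * (1 / r)" using growth_ge r_props by (simp add: big_C_def)
  have "(\<Sum>d\<in>{2..<k}. expectation (?e d)) \<le> (\<Sum>d\<in>{2..<k}. ?W * (1 / r))"
    using IH(2) Delta_le[of _ k] by (intro sum_mono) fastforce
  also have "\<dots> = real (card {2..<k}) * (?W * (1 / r))" by (simp only: sum_constant)
  also have "\<dots> \<le> real k * (?W * (1 / r))" by (intro mult_right_mono W0) auto
  finally have sum_le: "(\<Sum>d\<in>{2..<k}. expectation (?e d)) \<le> real k * (?W * (1 / r))" .
  have "expectation (?e k) \<le> expectation ?bound"
    using int_e int_bound pointwise by (intro integral_mono) auto
  also have "\<dots> = 2 * (expectation ?a / ?A\<^sup>2) + 2 * ?R * (real k * (\<Sum>d\<in>{2..<k}. expectation (?e d)))"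
  proof -
    have gen: "expectation (\<lambda>\<omega>. 2 * (f \<omega> / x) + y * (z * S \<omega>)) = 2 * (expectation f / x) + y * (z * expectation S)"
      if "integrable \<Omega> f" "integrable \<Omega> S" for f S and x y z :: real
      using that by simp
    have sum: "expectation (\<lambda>\<omega>. \<Sum>d\<in>{2..<k}. ?e d \<omega>) = (\<Sum>d\<in>{2..<k}. expectation (?e d))"
      by (rule Bochner_Integration.integral_sum) (rule IH(1))
    show ?thesis unfolding sum[symmetric] by (rule gen[OF int_a int_sum])
  qed
  also have "\<dots> \<le> 2 * (?g ^ (6 * k) * \<rho> ^ (3 * k) * (1 / r)) + 2 * ?R * (real k * (real k * (?W * (1 / r))))"
  proof (intro add_mono mult_left_mono sum_le)
    show "expectation ?a / ?A\<^sup>2 \<le> ?g ^ (6 * k) * \<rho> ^ (3 * k) * (1 / r)"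
      using less.prems by (intro stat_error_ratio A_ge) auto
  qed (use R0 in auto)
  also have "\<dots> = (2 * (?g ^ (6 * k) * \<rho> ^ (3 * k)) + 2 * ?R * (real k * (real k * ?W))) * (1 / r)"
    by (simp only: distrib_right mult.assoc)
  also have "\<dots> \<le> Delta big_C n p k"
    unfolding Delta_eq using r_props growth_ge k
    by (intro mult_right_mono delta_recursion(1)) (auto simp: big_C_def)
  finally show ?case using int_e by blast
qed

text \<open>Markov's inequality: on \<open>?bad d\<close> the squared error exceeds 1, while
  \<open>est_risk_le\<close> bounds its mean over \<open>good d\<close>. The sum of fewer than
  \<open>k\<close> failure probabilities stays below \<open>Delta big_C n p k\<close> by the second
  part of \<open>delta_recursion\<close>.\<close>

lemma good_prob_ge:
  assumes A_ge: "\<And>k. 2 \<le> k \<Longrightarrow> k \<le> k0 \<Longrightarrow> real p * (c / \<rho>) ^ k * B ^ (2 * k) \<le> A_sum n p X k"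
    and k: "2 \<le> k" "k \<le> k0"
  shows "1 - Delta big_C n p k \<le> measure \<Omega> (good k)"
proof -
  interpret prob_space \<Omega> by (rule prob_model)
  let ?e = "\<lambda>d \<omega>. (est d \<omega> - \<mu> d)\<^sup>2 * indicator (good d) \<omega> :: real"
  let ?bad = "\<lambda>d. {\<omega> \<in> good d. 1 < \<bar>est d \<omega> - \<mu> d\<bar>}"
  have bad_sets: "?bad d \<in> sets \<Omega>" if "d \<in> {2..<k}" for d
  proof -
    have [measurable]: "est d \<in> borel_measurable \<Omega>" using that by (intro est_measurable) auto
    have "?bad d = good d \<inter> {\<omega> \<in> space \<Omega>. 1 < \<bar>est d \<omega> - \<mu> d\<bar>}" by (auto simp: good_def)
    moreover have "{\<omega> \<in> space \<Omega>. 1 < \<bar>est d \<omega> - \<mu> d\<bar>} \<in> sets \<Omega>" by measurable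
    ultimately show ?thesis using good_sets by auto
  qed
  have cover: "space \<Omega> - good k \<subseteq> (\<Union>d\<in>{2..<k}. ?bad d)"
  proof
    fix \<omega> assume \<omega>: "\<omega> \<in> space \<Omega> - good k"
    let ?P = "\<lambda>d. d \<in> {2..<k} \<and> 1 < \<bar>est d \<omega> - \<mu> d\<bar>"
    have ex: "\<exists>d. ?P d" using \<omega> by (auto simp: good_def not_le)
    \<comment> \<open>the first failure happens on the event \<open>good d\<close>, where the second moment is controlled\<close>
    define d where "d = (LEAST d. ?P d)"
    have d: "?P d" unfolding d_def using ex by (rule LeastI_ex)
    have "\<bar>est i \<omega> - \<mu> i\<bar> \<le> 1" if "i \<in> {2..<d}" for i
    proof (rule ccontr)
      assume "\<not> \<bar>est i \<omega> - \<mu> i\<bar> \<le> 1"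
      then have "?P i" using that d by auto
      then have "d \<le> i" unfolding d_def by (rule Least_le)
      then show False using that by simp
    qed
    then have "\<omega> \<in> good d" using \<omega> by (auto simp: good_def)
    then show "\<omega> \<in> (\<Union>d\<in>{2..<k}. ?bad d)" using d by blast
  qed
  let ?W = "(big_C * real k) ^ (5 * (k - 1)\<^sup>2) * \<rho> ^ (2 * (k - 1)\<^sup>2)"
  have bad_le: "prob (?bad d) \<le> ?W * (1 / r)" if d: "d \<in> {2..<k}" for d
  proof -
    have "prob (?bad d) = expectation (indicator (?bad d))"
      using bad_sets[OF d] by simp
    also have "\<dots> \<le> expectation (?e d)"
    proof (rule integral_mono)
      show "integrable \<Omega> (indicator (?bad d) :: _ \<Rightarrow> real)"
        using bad_sets[OF d] by (simp add: emeasure_eq_measure)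
      show "integrable \<Omega> (?e d)" using est_risk_le[OF A_ge, of k0 d] d k by auto
      show "indicator (?bad d) \<omega> \<le> ?e d \<omega>" for \<omega>
      proof (cases "\<omega> \<in> ?bad d")
        case True
        then have "1 \<le> \<bar>est d \<omega> - \<mu> d\<bar>\<^sup>2" by (intro one_le_power) auto
        then show ?thesis using True by simp
      qed simp
    qed
    also have "\<dots> \<le> Delta big_C n p d" using est_risk_le[OF A_ge, of k0 d] d k by auto
    also have "\<dots> \<le> ?W * (1 / r)" by (rule Delta_le[OF d])
    finally show ?thesis .
  qed
  have W0: "0 \<le> ?W * (1 / r)" using growth_ge r_props by (simp add: big_C_def)
  have "1 - prob (good k) = prob (space \<Omega> - good k)"
    using prob_compl[OF good_sets] by simp
  also have "\<dots> \<le> prob (\<Union>d\<in>{2..<k}. ?bad d)"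
    using bad_sets by (intro finite_measure_mono cover) auto
  also have "\<dots> \<le> (\<Sum>d\<in>{2..<k}. prob (?bad d))"
    using bad_sets by (intro finite_measure_subadditive_finite) auto
  also have "\<dots> \<le> real (card {2..<k}) * (?W * (1 / r))"
    using bad_le by (intro sum_bounded_above) auto
  also have "\<dots> \<le> real k * (?W * (1 / r))" by (intro mult_right_mono W0) auto
  also have "\<dots> = real k * ?W * (1 / r)" by (simp only: mult.assoc)
  also have "\<dots> \<le> Delta big_C n p k"
    unfolding Delta_eq using r_props growth_ge k \<rho>_ge
    by (intro mult_right_mono delta_recursion(2)[of growth]) (auto simp: big_C_def)
  finally show ?thesis by simp
qed

text \<open>Puts the separate hypotheses at order 2 and at orders from 3 on into one form, using r =
  p / \<rho> and min (n / p) 1 = 1 / \<rho>. At order 2 a power of \<rho> is given away.\<close>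

lemma A_sum_lower:
  assumes "A_sum n p X 2 \<ge> c0 * min (real n) (real p) * B ^ 4"
    and "\<And>k. 3 \<le> k \<Longrightarrow> k \<le> k0 \<Longrightarrow>
      A_sum n p X k \<ge> c0 ^ k * B ^ (2 * k) * real p * (min (real n / real p) 1) ^ k"
    and k: "2 \<le> k" "k \<le> k0"
  shows "real p * (c / \<rho>) ^ k * B ^ (2 * k) \<le> A_sum n p X k"
proof (cases "k = 2")
  case True
  have "(c / \<rho>)\<^sup>2 \<le> c0 * (1 / \<rho>)"
  proof -
    have "c * c \<le> c0 * 1" using c_props by (intro mult_mono) auto
    moreover have "1 / \<rho> * (1 / \<rho>) \<le> 1 / \<rho> * 1"
      using \<rho>_ge r_props by (intro mult_left_mono) (auto simp: \<rho>_eq)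
    ultimately have "(c * c) * (1 / \<rho> * (1 / \<rho>)) \<le> (c0 * 1) * (1 / \<rho> * 1)"
      using c_props r_props c0_pos by (intro mult_mono) auto
    then show ?thesis by (simp add: power2_eq_square mult_ac)
  qed
  then have "real p * (c / \<rho>)\<^sup>2 * B ^ 4 \<le> real p * (c0 * (1 / \<rho>)) * B ^ 4"
    by (intro mult_right_mono mult_left_mono) auto
  also have "\<dots> = c0 * r * B ^ 4" using p_ge r_props by simp
  also have "\<dots> \<le> A_sum n p X 2" using assms(1) by (simp add: r_def)
  finally show ?thesis using True by simp
next
  case False
  have "(c / \<rho>) ^ k \<le> (c0 * (1 / \<rho>)) ^ k"
    using c_props r_props by (intro power_mono) (auto intro!: divide_right_mono)
  then have "real p * (c / \<rho>) ^ k * B ^ (2 * k) \<le> real p * (c0 * (1 / \<rho>)) ^ k * B ^ (2 * k)"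
    using B_pos by (intro mult_right_mono mult_left_mono) auto
  also have "\<dots> = c0 ^ k * B ^ (2 * k) * real p * (min (real n / real p) 1) ^ k"
    unfolding \<rho>_eq(2) power_mult_distrib by (simp only: mult_ac)
  also have "\<dots> \<le> A_sum n p X k" using assms(2)[of k] k False by auto
  finally show ?thesis .
qed

end

theorem theorem3:
  fixes c0 M :: real
  assumes "c0 > 0" and "M > 0"
  shows "\<exists>C>0. \<forall>(n::nat) (p::nat) (\<sigma>::real) (X::rmat) (k0::nat) (g::real measure).
    n \<ge> 1 \<longrightarrow> p \<ge> 1 \<longrightarrow> \<sigma> > 0 \<longrightarrow> k0 \<ge> 1 \<longrightarrow>
    op_norm n p X / \<sigma> \<ge> c0 \<longrightarrow>
    A_sum n p X 1 \<ge> c0 * min (real n) (real p) * op_norm n p X ^ 2 \<longrightarrow>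
    A_sum n p X 2 \<ge> c0 * min (real n) (real p) * op_norm n p X ^ 4 \<longrightarrow>
    (\<forall>k. 3 \<le> k \<and> k \<le> k0 \<longrightarrow>
      A_sum n p X k
        \<ge> c0 ^ k * op_norm n p X ^ (2 * k) * real p * (min (real n / real p) 1) ^ k) \<longrightarrow>
    real_distribution g \<longrightarrow> subgaussian M g \<longrightarrow>
    (\<forall>k. 2 \<le> k \<and> k \<le> k0 \<longrightarrow>
      (\<exists>E \<in> sets (response_algebra n p X \<sigma> g).
        measure (model n p \<sigma> g) E \<ge> 1 - Delta C n p k \<and>
        integrable (model n p \<sigma> g)
          (\<lambda>\<omega>. (mu_hat n p X \<sigma> (response n p X \<omega>) k - central_moment g k)\<^sup>2 * indicator E \<omega>) \<and>
        (\<integral>\<omega>. (mu_hat n p X \<sigma> (response n p X \<omega>) k - central_moment g k)\<^sup>2 * indicator E \<omega>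
            \<partial>model n p \<sigma> g) \<le> Delta C n p k))"
proof (intro exI[of _ "max 1 (regression.big_C c0 M)"] conjI allI impI)
  \<comment> \<open>Outside the locale \<open>big_C\<close> has only the parameters
    \<open>c0\<close> and \<open>M\<close>, so the witness is independent of all other data. The
    maximum with \<open>1\<close> gives positivity here and is removed below, where
    \<open>growth_ge\<close> is available.\<close>
  show "0 < max 1 (regression.big_C c0 M)" by simp
  fix n p :: nat and \<sigma> :: real and X :: rmat and k0 :: nat and g :: "real measure" and k :: nat
  assume h: "1 \<le> n" "1 \<le> p" "0 < \<sigma>" "c0 \<le> op_norm n p X / \<sigma>"
    "c0 * min (real n) (real p) * (op_norm n p X)\<^sup>2 \<le> A_sum n p X 1"
    "c0 * min (real n) (real p) * op_norm n p X ^ 4 \<le> A_sum n p X 2"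
    "\<forall>k. 3 \<le> k \<and> k \<le> k0 \<longrightarrow>
      c0 ^ k * op_norm n p X ^ (2 * k) * real p * (min (real n / real p) 1) ^ k \<le> A_sum n p X k"
    "real_distribution g" "subgaussian M g" and k: "2 \<le> k \<and> k \<le> k0"
  interpret regression n p X \<sigma> c0 M g
    by (rule regression.intro) (fact assms h)+
  have A: "real p * (c / (real p / r)) ^ i * op_norm n p X ^ (2 * i) \<le> A_sum n p X i"
    if "2 \<le> i" "i \<le> k0" for i
    using h(7) by (intro A_sum_lower[OF h(6) _ that]) auto
  have C: "max 1 big_C = big_C" using growth_ge by (simp add: big_C_def)
  show "\<exists>E \<in> sets (response_algebra n p X \<sigma> g).
      measure (model n p \<sigma> g) E \<ge> 1 - Delta (max 1 big_C) n p k \<and>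
      integrable (model n p \<sigma> g)
        (\<lambda>\<omega>. (mu_hat n p X \<sigma> (response n p X \<omega>) k - central_moment g k)\<^sup>2 * indicator E \<omega>) \<and>
      (\<integral>\<omega>. (mu_hat n p X \<sigma> (response n p X \<omega>) k - central_moment g k)\<^sup>2 * indicator E \<omega>
          \<partial>model n p \<sigma> g) \<le> Delta (max 1 big_C) n p k"
    unfolding C
  proof (intro bexI[of _ "good k"] conjI good_in_response_algebra)
    show "1 - Delta big_C n p k \<le> measure (model n p \<sigma> g) (good k)"
      using k by (intro good_prob_ge[OF A]) auto
    have "integrable (model n p \<sigma> g) (\<lambda>\<omega>. (est k \<omega> - central_moment g k)\<^sup>2 * indicator (good k) \<omega>) \<and>
        (\<integral>\<omega>. (est k \<omega> - central_moment g k)\<^sup>2 * indicator (good k) \<omega> \<partial>model n p \<sigma> g) \<le> Delta big_C n p k"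
      using k by (intro est_risk_le[OF A]) auto
    then show "integrable (model n p \<sigma> g)
        (\<lambda>\<omega>. (mu_hat n p X \<sigma> (response n p X \<omega>) k - central_moment g k)\<^sup>2 * indicator (good k) \<omega>)"
      and "(\<integral>\<omega>. (mu_hat n p X \<sigma> (response n p X \<omega>) k - central_moment g k)\<^sup>2 * indicator (good k) \<omega>
          \<partial>model n p \<sigma> g) \<le> Delta big_C n p k"
      unfolding est_def by blast+
  qed
qed

end
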